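(* (a) If $X$ is a nuclear sequentially complete Hausdorff locally convex space over $\mathbb{C}$, then $G_a(X)=0$. (b) The following conditions are equivalent for a complex Fréchet space $X$: (i) $X$ is nuclear. (ii) $G_a(X)=0$. (iii) $G_a(X)<1/2$.
   Context: Let $X$ be a sequentially complete Hausdorff locally convex space over $\mathbb{C}$, $X'$ its topological dual and $cs(X)$ the system of all continuous seminorms on $X$. For a Dirichlet series $D=\sum_n a_n\frac1{n^s}$ with coefficients in $X$ (variable $s\in\mathbb{C}$), set $\sigma_c(D):=\inf\{r\in\mathbb{R}:\sum_n a_n\frac1{n^s}\text{ converges in }X\text{ for all } s \text{ with }\operatorname{Re}s>r\}$ and $\sigma_a(D):=\inf\{r\in\mathbb{R}:\sum_n a_n\frac1{n^s}\text{ converges absolutely in }X\text{ for all } s \text{ with }\operatorname{Re}s>r\}$, infima being taken in the extended real line; absolute convergence of $\sum_n y_n$ in $X$ means $\sum_n\alpha(y_n)<+\infty$ for every $\alpha\in cs(X)$. For $x'\in X'$, $x'(D):=\sum_n x'(a_n)\frac1{n^s}$ is a scalar Dirichlet series, and $\sigma_a^w(D):=\sup_{x'\in X'}\sigma_a(x'(D))$. The gap for absolute convergence of Dirichlet series in $X$ is $G_a(X):=\sup_D(\sigma_a(D)-\sigma_a^w(D))$, the supremum being over all Dirichlet series $D$ with coefficients in $X$ such that $\sigma_c(D)<+\infty$ (convention: the difference is taken to be $0$ when both abscissas are $-\infty$). *)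

theory Defs
  imports "HOL-Analysis.Analysis"
begin

text \<open>A complex locally convex space is a type with a Hausdorff group topology together with a
  complex scalar multiplication \<open>smul\<close>. The library's \<^const>\<open>convex\<close> needs a real scalar
  multiplication from a type class, hence the explicit convexity condition.\<close>

locale complex_lcs = vector_space smul
  for smul :: "complex \<Rightarrow> 'a::{topological_ab_group_add,t2_space} \<Rightarrow> 'a" +
  assumes continuous_scale: "continuous_on UNIV (\<lambda>(c, x). smul c x)"
    and locally_convex: "\<And>U. open U \<Longrightarrow> 0 \<in> U \<Longrightarrow> \<exists>V. open V \<and> 0 \<in> V \<and> V \<subseteq> U \<and>
      (\<forall>x\<in>V. \<forall>y\<in>V. \<forall>t\<in>{0..1}. smul (of_real t) x + smul (of_real (1 - t)) y \<in> V)"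

definition sequentially_complete :: "'a::topological_ab_group_add itself \<Rightarrow> bool" where
  "sequentially_complete _ \<longleftrightarrow> (\<forall>x :: nat \<Rightarrow> 'a.
     (\<forall>U. open U \<and> 0 \<in> U \<longrightarrow> (\<exists>N. \<forall>m\<ge>N. \<forall>n\<ge>N. x m - x n \<in> U)) \<longrightarrow> convergent x)"

text \<open>For a metrizable topological vector space, completeness and sequential completeness
  coincide.\<close>

definition frechet_space :: "(complex \<Rightarrow> 'a::{topological_ab_group_add,t2_space} \<Rightarrow> 'a) \<Rightarrow> bool"
  where "frechet_space smul \<longleftrightarrow> complex_lcs smul \<and>
    metrizable_space (euclidean :: 'a topology) \<and> sequentially_complete TYPE('a)"

definition seminorm :: "(complex \<Rightarrow> 'a::ab_group_add \<Rightarrow> 'a) \<Rightarrow> ('a \<Rightarrow> real) \<Rightarrow> bool" where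
  "seminorm smul p \<longleftrightarrow> (\<forall>x. 0 \<le> p x) \<and> (\<forall>x y. p (x + y) \<le> p x + p y) \<and>
     (\<forall>c x. p (smul c x) = norm c * p x)"

definition cs :: "(complex \<Rightarrow> 'a::topological_ab_group_add \<Rightarrow> 'a) \<Rightarrow> ('a \<Rightarrow> real) set" where
  "cs smul = {p. seminorm smul p \<and> continuous_on UNIV p}"

definition topological_dual ::
    "(complex \<Rightarrow> 'a::topological_ab_group_add \<Rightarrow> 'a) \<Rightarrow> ('a \<Rightarrow> complex) set" where
  "topological_dual smul = {f. Vector_Spaces.linear smul (*) f \<and> continuous_on UNIV f}"


text \<open>For a seminorm \<open>q\<close> on \<open>X\<close> let \<open>X\<^sub>q\<close> be the normed space \<open>X / {x. q x = 0}\<close> with the norm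
  induced by \<open>q\<close>. Its dual consists of the linear functionals on \<open>X\<close> bounded by a multiple of \<open>q\<close>,
  and \<open>dual_seminorm q\<close> is the dual norm.\<close>

definition seminorm_dual ::
    "(complex \<Rightarrow> 'a::ab_group_add \<Rightarrow> 'a) \<Rightarrow> ('a \<Rightarrow> real) \<Rightarrow> ('a \<Rightarrow> complex) set" where
  "seminorm_dual smul q =
     {f. Vector_Spaces.linear smul (*) f \<and> (\<exists>C. \<forall>x. norm (f x) \<le> C * q x)}"

definition dual_seminorm :: "('a \<Rightarrow> real) \<Rightarrow> ('a \<Rightarrow> complex) \<Rightarrow> real" where
  "dual_seminorm q f = (SUP x\<in>{x. q x \<le> 1}. norm (f x))"

text \<open>\<open>T\<close> induces a nuclear operator \<open>X\<^sub>q \<rightarrow> Y\<^sub>p\<close>: there are \<open>f\<^sub>n \<in> (X\<^sub>q)'\<close> and \<open>y\<^sub>n \<in> Y\<^sub>p\<close> with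
  \<open>(\<Sum>n. \<parallel>f\<^sub>n\<parallel> * \<parallel>y\<^sub>n\<parallel>) < \<infinity>\<close> and \<open>T x = (\<Sum>n. f\<^sub>n(x) y\<^sub>n)\<close>, convergence being that of \<open>Y\<^sub>p\<close>. Passing
  to the completions of \<open>X\<^sub>q\<close> and \<open>Y\<^sub>p\<close> yields the same notion: functionals extend, and each \<open>y\<^sub>n\<close> in
  the completion is the sum of an absolutely convergent series in \<open>Y\<^sub>p\<close> with sum of norms at most
  \<open>2 * \<parallel>y\<^sub>n\<parallel>\<close>.\<close>

definition nuclear_map ::
    "(complex \<Rightarrow> 'a::ab_group_add \<Rightarrow> 'a) \<Rightarrow> ('a \<Rightarrow> real) \<Rightarrow>
     (complex \<Rightarrow> 'b::ab_group_add \<Rightarrow> 'b) \<Rightarrow> ('b \<Rightarrow> real) \<Rightarrow> ('a \<Rightarrow> 'b) \<Rightarrow> bool" where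
  "nuclear_map smul1 q smul2 p T \<longleftrightarrow> (\<exists>(f :: nat \<Rightarrow> 'a \<Rightarrow> complex) (y :: nat \<Rightarrow> 'b).
     (\<forall>n. f n \<in> seminorm_dual smul1 q) \<and>
     summable (\<lambda>n. dual_seminorm q (f n) * p (y n)) \<and>
     (\<forall>x. (\<lambda>N. p (T x - (\<Sum>n<N. smul2 (f n x) (y n)))) \<longlonglongrightarrow> 0))"

definition nuclear_space :: "(complex \<Rightarrow> 'a::topological_ab_group_add \<Rightarrow> 'a) \<Rightarrow> bool" where
  "nuclear_space smul \<longleftrightarrow>
     (\<forall>p\<in>cs smul. \<exists>q\<in>cs smul. (\<forall>x. p x \<le> q x) \<and> nuclear_map smul q smul p id)"


text \<open>A Dirichlet series is given by its coefficient sequence \<open>a\<close>; as natural numbers start at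
  \<open>0\<close>, \<open>a n\<close> is the coefficient of \<open>1 / (n + 1)\<^sup>s\<close>.\<close>

definition dirichlet_term ::
    "(complex \<Rightarrow> 'a \<Rightarrow> 'a) \<Rightarrow> (nat \<Rightarrow> 'a) \<Rightarrow> complex \<Rightarrow> nat \<Rightarrow> 'a" where
  "dirichlet_term smul a s n = smul (1 / of_nat (Suc n) powr s) (a n)"

definition abs_convergent ::
    "(complex \<Rightarrow> 'a::topological_ab_group_add \<Rightarrow> 'a) \<Rightarrow> (nat \<Rightarrow> 'a) \<Rightarrow> bool" where
  "abs_convergent smul y \<longleftrightarrow> (\<forall>p\<in>cs smul. summable (\<lambda>n. p (y n)))"

definition sigma_c ::
    "(complex \<Rightarrow> 'a::topological_ab_group_add \<Rightarrow> 'a) \<Rightarrow> (nat \<Rightarrow> 'a) \<Rightarrow> ereal" where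
  "sigma_c smul a =
     Inf (ereal ` {r. \<forall>s. Re s > r \<longrightarrow> summable (dirichlet_term smul a s)})"

definition sigma_a ::
    "(complex \<Rightarrow> 'a::topological_ab_group_add \<Rightarrow> 'a) \<Rightarrow> (nat \<Rightarrow> 'a) \<Rightarrow> ereal" where
  "sigma_a smul a =
     Inf (ereal ` {r. \<forall>s. Re s > r \<longrightarrow> abs_convergent smul (dirichlet_term smul a s)})"

text \<open>The scalar Dirichlet series \<open>x'(D)\<close> has coefficients in the space \<open>\<complex>\<close>, whose scalar
  multiplication is \<open>(*)\<close>.\<close>

definition sigma_a_weak ::
    "(complex \<Rightarrow> 'a::topological_ab_group_add \<Rightarrow> 'a) \<Rightarrow> (nat \<Rightarrow> 'a) \<Rightarrow> ereal" where
  "sigma_a_weak smul a = (SUP f\<in>topological_dual smul. sigma_a (*) (\<lambda>n. f (a n)))"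

text \<open>The case distinction is needed because \<open>-\<infinity> - (-\<infinity>) = \<infinity>\<close> in \<^typ>\<open>ereal\<close>.\<close>

definition gap_a :: "(complex \<Rightarrow> 'a::topological_ab_group_add \<Rightarrow> 'a) \<Rightarrow> ereal" where
  "gap_a smul = (SUP a\<in>{a. sigma_c smul a < \<infinity>}.
     if sigma_a smul a = -\<infinity> \<and> sigma_a_weak smul a = -\<infinity> then 0
     else sigma_a smul a - sigma_a_weak smul a)"

end

theory Submission
  imports Defs "Jordan_Normal_Form.Determinant"
begin

text \<open>In a nuclear space, Banach-Steinhaus on the dual of \<open>X\<^sub>q\<close> shows that weakly absolutely
  summable sequences are absolutely summable, which makes the gap vanish.

  Conversely, let the gap of a Frechet space be less than \<open>\<delta> < 1/2\<close>. A gliding hump argument yields, for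
  every \<open>p\<close>, some \<open>q\<close> such that sequences unconditionally bounded for \<open>q\<close> satisfy
  \<open>(\<Sum>n. p(b\<^sub>n) n\<^sup>-\<^sup>\<delta>) \<le> C\<close>. Applied to images of orthonormal systems, this gives decay of order
  \<open>n\<^bsup>\<delta>-1/2\<^esup>\<close> for the Weyl numbers of \<open>X\<^sub>q \<rightarrow> X\<^sub>p\<close>; these are multiplicative, so that long
  compositions have Weyl numbers of arbitrarily fast polynomial decay. Comparing maximal determinants
  \<open>det (f\<^sub>j(x\<^sub>i))\<close> of consecutive sizes turns this into decay of the approximation numbers, at the cost
  of a fixed power of \<open>n\<close>, and hence into nuclearity.\<close>

section \<open>Seminorms and the Hahn-Banach theorem\<close>

text \<open>The bound 1/2 comes from one count: \<open>k\<close> orthonormal vectors divided by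
  \<open>sqrt k\<close> are unconditionally bounded, so if all of them keep size \<theta> under
  \<open>p\<close>, the weighted sum in the summing property is of order \<theta> k^(1/2 -
  \<delta>), and its boundedness forces decay as soon as \<delta> < 1/2. One such step gains only
  the exponent 1/2 - \<delta>, which may be tiny, whereas nuclearity needs a fixed amount; hence the
  detour through a multiplicative quantity. The amount is 7: comparing determinants costs the power
  3, and 4 must remain because rank one terms indexed by \<open>n\<close> and i < 4 (n + 1) are to
  be dominated by a product of order n^-2 i^-2. Good approximation by operators of finite rank does
  not by itself bound the nuclear norms of their differences well, so two approximable maps are
  composed, and each \<open>p\<close> is reached through two chains of seminorms. Metrizability
  enters in the gliding hump, where one sequence has to defeat all continuous seminorms and
  countably many must suffice.\<close>

locale complex_vector_space = vector_space smul
  for smul :: "complex \<Rightarrow> 'a::ab_group_add \<Rightarrow> 'a"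
begin

abbreviation clinear :: "('a \<Rightarrow> complex) \<Rightarrow> bool" where
  "clinear f \<equiv> Vector_Spaces.linear smul (*) f"

lemma clinear_iff:
  "clinear f \<longleftrightarrow> (\<forall>x y. f (x + y) = f x + f y) \<and> (\<forall>c x. f (smul c x) = c * f x)"
proof -
  have "vector_space ((*) :: complex \<Rightarrow> complex \<Rightarrow> complex)"
    by unfold_locales (auto simp: algebra_simps)
  then show ?thesis
    by (simp add: Vector_Spaces.linear_iff vector_space_axioms)
qed

lemma clinear_add: "clinear f \<Longrightarrow> f (x + y) = f x + f y"
  and clinear_scale: "clinear f \<Longrightarrow> f (smul c x) = c * f x"
  by (auto simp: clinear_iff)

lemma clinear_0: "clinear f \<Longrightarrow> f 0 = 0"
  by (metis clinear_scale mult_zero_left scale_zero_left)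

lemma clinear_minus: "clinear f \<Longrightarrow> f (- x) = - f x"
  by (metis clinear_scale mult_minus1 scale_minus_left scale_one)

lemma clinear_diff: "clinear f \<Longrightarrow> f (x - y) = f x - f y"
  using clinear_add[of f x "- y"] clinear_minus[of f y] by simp

lemma clinear_sum: "clinear f \<Longrightarrow> f (\<Sum>i\<in>A. x i) = (\<Sum>i\<in>A. f (x i))"
  by (induction A rule: infinite_finite_induct) (auto simp: clinear_0 clinear_add)

lemma seminorm_nonneg: "seminorm smul p \<Longrightarrow> 0 \<le> p x"
  and seminorm_add: "seminorm smul p \<Longrightarrow> p (x + y) \<le> p x + p y"
  and seminorm_scale: "seminorm smul p \<Longrightarrow> p (smul c x) = norm c * p x"
  by (auto simp: seminorm_def)

lemma seminorm_0: "seminorm smul p \<Longrightarrow> p 0 = 0"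
  by (metis mult_zero_left norm_zero scale_zero_left seminorm_scale)

lemma seminorm_minus: "seminorm smul p \<Longrightarrow> p (- x) = p x"
  by (metis mult_1 norm_minus_cancel norm_one scale_minus_left scale_one seminorm_scale)

lemma seminorm_diff: "seminorm smul p \<Longrightarrow> p (x - y) \<le> p x + p y"
  using seminorm_add[of p x "- y"] seminorm_minus[of p y] by simp

lemma seminorm_sum: "seminorm smul p \<Longrightarrow> p (\<Sum>i\<in>A. x i) \<le> (\<Sum>i\<in>A. p (x i))"
proof (induction A rule: infinite_finite_induct)
  case (insert i A)
  then show ?case using seminorm_add[of p "x i" "\<Sum>i\<in>A. x i"] by simp
qed (simp_all add: seminorm_0)

lemma seminorm_triangle: "seminorm smul p \<Longrightarrow> \<bar>p x - p y\<bar> \<le> p (x - y)"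
  using seminorm_add[of p "x - y" y] seminorm_add[of p "y - x" x] seminorm_minus[of p "x - y"]
  by (simp add: abs_le_iff)

section \<open>Hahn-Banach by minimal sublinear functionals\<close>

definition rscale :: "real \<Rightarrow> 'a \<Rightarrow> 'a" where
  "rscale r = smul (of_real r)"

lemma rscale_add: "rscale r (x + y) = rscale r x + rscale r y"
  and rscale_plus: "rscale (r + s) x = rscale r x + rscale s x"
  and rscale_rscale: "rscale r (rscale s x) = rscale (r * s) x"
  and rscale_0 [simp]: "rscale 0 x = 0" "rscale r 0 = 0"
  and rscale_1 [simp]: "rscale 1 x = x"
  by (simp_all add: rscale_def scale_right_distrib scale_left_distrib)

text \<open>Homogeneity is asked as an inequality because in this form it passes at once to infima;
  applied to \<open>1 / r\<close> it gives the equality of \<open>sublinear_scale\<close>.\<close>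

definition sublinear :: "('a \<Rightarrow> real) \<Rightarrow> bool" where
  "sublinear l \<longleftrightarrow> l 0 = 0 \<and> (\<forall>x y. l (x + y) \<le> l x + l y) \<and> (\<forall>r>0. \<forall>x. l (rscale r x) \<le> r * l x)"

lemma sublinear_scale:
  assumes "sublinear l" "r \<ge> 0"
  shows "l (rscale r x) = r * l x"
proof (cases "r = 0")
  case True
  then show ?thesis using assms by (simp add: sublinear_def)
next
  case False
  then have r: "r > 0" using assms by simp
  have "l (rscale (1/r) (rscale r x)) \<le> 1/r * l (rscale r x)"
    using assms r unfolding sublinear_def by (metis zero_less_divide_1_iff)
  then have "l x \<le> 1/r * l (rscale r x)" using r by (simp add: rscale_rscale)
  then have "r * l x \<le> l (rscale r x)" using r by (simp add: field_simps)
  moreover have "l (rscale r x) \<le> r * l x" using assms r by (simp add: sublinear_def)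
  ultimately show ?thesis by simp
qed

lemma sublinear_neg: "sublinear l \<Longrightarrow> - l (- x) \<le> l x"
  unfolding sublinear_def by (metis add.right_inverse add.commute neg_le_iff_le le_minus_iff
      add_le_cancel_left add_minus_cancel diff_0 diff_le_eq)

lemma seminorm_sublinear: "seminorm smul p \<Longrightarrow> sublinear p"
  by (simp add: sublinear_def seminorm_0 seminorm_add rscale_def seminorm_scale)

text \<open>Pushing a sublinear functional down along the ray through \<open>y\<close>; a minimal sublinear functional
  is fixed by this operation for every \<open>y\<close> and therefore additive.\<close>

definition ray_inf :: "('a \<Rightarrow> real) \<Rightarrow> 'a \<Rightarrow> 'a \<Rightarrow> real" where
  "ray_inf l y x = (INF t\<in>{0..}. l (x + rscale t y) - t * l y)"

context
  fixes l :: "'a \<Rightarrow> real" and y :: 'a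
  assumes l: "sublinear l"
begin

lemma ray_bdd: "bdd_below ((\<lambda>t. l (x + rscale t y) - t * l y) ` {0..})"
proof (rule bdd_belowI2[of _ "- l (- x)"])
  fix t :: real assume "t \<in> {0..}"
  then have "t * l y = l (- x + (x + rscale t y))" using sublinear_scale[OF l, of t y] by simp
  also have "\<dots> \<le> l (- x) + l (x + rscale t y)" using l unfolding sublinear_def by blast
  finally show "- l (- x) \<le> l (x + rscale t y) - t * l y" by simp
qed

lemma ray_inf_le: "t \<ge> 0 \<Longrightarrow> ray_inf l y x \<le> l (x + rscale t y) - t * l y"
  unfolding ray_inf_def by (rule cINF_lower[OF ray_bdd]) simp

lemma ray_inf_greatest: "(\<And>t. t \<ge> 0 \<Longrightarrow> c \<le> l (x + rscale t y) - t * l y) \<Longrightarrow> c \<le> ray_inf l y x"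
  unfolding ray_inf_def by (rule cINF_greatest) auto

lemma ray_inf_le_self: "ray_inf l y x \<le> l x"
  using ray_inf_le[of 0 x] by simp

text \<open>Rays add: \<open>t\<close> tried at \<open>a\<close> and \<open>s\<close> tried at
  \<open>b\<close> are matched by \<open>s + t\<close> at \<open>a + b\<close>; scaling by
  \<open>r\<close> matches \<open>t\<close> with \<open>r * t\<close>.\<close>

lemma sublinear_ray_inf: "sublinear (ray_inf l y)"
  unfolding sublinear_def
proof (intro conjI allI impI)
  have "0 \<le> ray_inf l y 0"
    by (rule ray_inf_greatest) (simp add: sublinear_scale[OF l])
  moreover have "ray_inf l y 0 \<le> 0" using ray_inf_le_self[of 0] l by (simp add: sublinear_def)
  ultimately show "ray_inf l y 0 = 0" by simp
next
  fix a b
  have *: "ray_inf l y (a + b) - (l (b + rscale s y) - s * l y) \<le> l (a + rscale t y) - t * l y"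
    if "s \<ge> 0" "t \<ge> 0" for s t
  proof -
    have "ray_inf l y (a + b) \<le> l (a + b + rscale (s + t) y) - (s + t) * l y"
      using that by (intro ray_inf_le) simp
    also have "a + b + rscale (s + t) y = (a + rscale t y) + (b + rscale s y)"
      by (simp add: rscale_plus algebra_simps)
    also have "l \<dots> \<le> l (a + rscale t y) + l (b + rscale s y)" using l unfolding sublinear_def by blast
    finally show ?thesis by (simp add: algebra_simps)
  qed
  have "ray_inf l y (a + b) - (l (b + rscale s y) - s * l y) \<le> ray_inf l y a" if "s \<ge> 0" for s
    using * that by (intro ray_inf_greatest) blast
  then have "ray_inf l y (a + b) - ray_inf l y a \<le> ray_inf l y b"
    by (intro ray_inf_greatest) (smt (verit))
  then show "ray_inf l y (a + b) \<le> ray_inf l y a + ray_inf l y b" by simp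
next
  fix r :: real and a assume r: "r > 0"
  have "1/r * ray_inf l y (rscale r a) \<le> l (a + rscale t y) - t * l y" if "t \<ge> 0" for t
  proof -
    have "ray_inf l y (rscale r a) \<le> l (rscale r a + rscale (r * t) y) - (r * t) * l y"
      using that r by (intro ray_inf_le) simp
    also have "rscale r a + rscale (r * t) y = rscale r (a + rscale t y)"
      by (simp add: rscale_add rscale_rscale)
    also have "l \<dots> = r * l (a + rscale t y)" using r sublinear_scale[OF l] by simp
    finally show ?thesis using r by (simp add: field_simps)
  qed
  then have "1/r * ray_inf l y (rscale r a) \<le> ray_inf l y a" by (rule ray_inf_greatest)
  then show "ray_inf l y (rscale r a) \<le> r * ray_inf l y a" using r by (simp add: field_simps)
qed

end

text \<open>Zorn's lemma for the reversed pointwise order. A chain is bounded by its pointwise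
  infimum, which is finite because every sublinear \<open>l\<close> below \<open>p\<close> satisfies
  \<open>- p (- x) \<le> l x\<close>.\<close>

lemma minimal_sublinear_exists:
  assumes p: "sublinear p"
  obtains l where "sublinear l" "\<And>x. l x \<le> p x"
    "\<And>l'. sublinear l' \<Longrightarrow> (\<And>x. l' x \<le> l x) \<Longrightarrow> l' = l"
proof -
  define A where "A = {l. sublinear l \<and> (\<forall>x. l x \<le> p x)}"
  define P :: "('a \<Rightarrow> real) \<Rightarrow> ('a \<Rightarrow> real) \<Rightarrow> bool" where "P a b \<longleftrightarrow> (\<forall>x. b x \<le> a x)" for a b
  have "\<exists>m\<in>A. \<forall>a\<in>A. P m a \<longrightarrow> a = m"
  proof (rule predicate_Zorn)
    show "partial_order_on A (relation_of P A)"
      proof (rule partial_order_on_relation_ofI)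
      show "P a c" if "P a b" "P b c" for a b c
        using that order_trans unfolding P_def by blast
      show "a = b" if "P a b" "P b a" for a b
        using that unfolding P_def by (intro ext order.antisym) auto
    qed (simp add: P_def)
  next
    fix C assume C: "C \<in> Chains (relation_of P A)"
    then have CA: "C \<subseteq> A" and chain: "\<And>a b. a \<in> C \<Longrightarrow> b \<in> C \<Longrightarrow> P a b \<or> P b a"
      by (auto simp: Chains_def relation_of_def)
    show "\<exists>u\<in>A. \<forall>a\<in>C. P a u"
    proof (cases "C = {}")
      case True
      have "p \<in> A" using p by (simp add: A_def)
      with True show ?thesis by auto
    next
      case False
      define u where "u x = (INF l\<in>C. l x)" for x
      have bdd: "bdd_below ((\<lambda>l. l x) ` C)" for x
      proof (rule bdd_belowI2[of _ "- p (- x)"])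
        fix l assume "l \<in> C"
        then have "sublinear l" "l (- x) \<le> p (- x)" using CA by (auto simp: A_def)
        then show "- p (- x) \<le> l x" using sublinear_neg[of l x] by simp
      qed
      have u_le: "u x \<le> l x" if "l \<in> C" for x l
        unfolding u_def using that by (intro cINF_lower[OF bdd])
      have u_ge: "c \<le> u x" if "\<And>l. l \<in> C \<Longrightarrow> c \<le> l x" for c x
        unfolding u_def using that False by (intro cINF_greatest)
      have sub: "l (x + y) \<le> l x + l y" "l 0 = 0" "r > 0 \<Longrightarrow> l (rscale r x) \<le> r * l x"
        if "l \<in> C" for l x y r
        using that CA by (auto simp: A_def sublinear_def)
      have "sublinear u" unfolding sublinear_def
      proof (intro conjI allI impI)
        show "u 0 = 0" using False by (simp add: u_def sub cong: INF_cong_simp)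
      next
        fix x y
        \<comment> \<open>Different members of the chain may be nearly least at \<open>x\<close> and
          at \<open>y\<close>; the smaller of the two serves at both points.\<close>
        have *: "u (x + y) - l x \<le> k y" if "l \<in> C" "k \<in> C" for l k
          using chain[OF that]
        proof
          assume "P l k"
          then show ?thesis using u_le[OF that(2), of "x + y"] sub(1)[OF that(2), of x y]
            by (auto simp: P_def) (smt (verit))
        next
          assume "P k l"
          then show ?thesis using u_le[OF that(1), of "x + y"] sub(1)[OF that(1), of x y]
            by (auto simp: P_def) (smt (verit))
        qed
        have "u (x + y) - l x \<le> u y" if "l \<in> C" for l using * that by (intro u_ge)
        then have "u (x + y) - u y \<le> u x" by (intro u_ge) (smt (verit))
        then show "u (x + y) \<le> u x + u y" by simp
      next
        fix r :: real and x assume r: "r > 0"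
        have "1/r * u (rscale r x) \<le> l x" if "l \<in> C" for l
          using u_le[OF that, of "rscale r x"] sub(3)[OF that r, of x] r by (simp add: field_simps)
        then have "1/r * u (rscale r x) \<le> u x" by (rule u_ge)
        then show "u (rscale r x) \<le> r * u x" using r by (simp add: field_simps)
      qed
      moreover have "u x \<le> p x" for x
      proof -
        obtain l where "l \<in> C" using False by auto
        then show ?thesis using u_le[of l x] CA by (auto simp: A_def intro: order_trans)
      qed
      ultimately have "u \<in> A" by (simp add: A_def)
      then show ?thesis using u_le by (auto simp: P_def)
    qed
  qed
  then obtain m where "m \<in> A" and m: "\<And>a. a \<in> A \<Longrightarrow> P m a \<Longrightarrow> a = m" by blast
  show ?thesis
  proof (rule that[of m])
    fix l' assume "sublinear l'" "\<And>x. l' x \<le> m x"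
    with \<open>m \<in> A\<close> show "l' = m"
      by (intro m) (auto simp: A_def P_def intro: order_trans)
  qed (use \<open>m \<in> A\<close> in \<open>auto simp: A_def\<close>)
qed

text \<open>Minimality is applied below \<open>ray_inf p y\<close> instead of \<open>p\<close>.
  There \<open>l (- y) \<le> - p y\<close>, so a minimal \<open>l\<close>, being additive, reaches
  \<open>p y\<close> at \<open>y\<close>, and nothing has to be extended from a subspace.\<close>

lemma norming_functional:
  assumes p: "seminorm smul p"
  obtains f where "clinear f" "\<And>x. norm (f x) \<le> p x" "norm (f y) = p y"
proof -
  note psub = seminorm_sublinear[OF p]
  note rsub = sublinear_ray_inf[OF psub, of y]
  obtain l where l: "sublinear l" and lr: "\<And>x. l x \<le> ray_inf p y x"
    and min: "\<And>l'. sublinear l' \<Longrightarrow> (\<And>x. l' x \<le> l x) \<Longrightarrow> l' = l"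
    using minimal_sublinear_exists[OF rsub] by blast
  have lp: "l x \<le> p x" for x
    using lr[of x] ray_inf_le_self[OF psub, of y x] by simp
  have add: "l (x + z) = l x + l z" for x z
  proof -
    have "ray_inf l z = l"
      using sublinear_ray_inf[OF l] ray_inf_le_self[OF l] by (intro min)
    then have "l x \<le> l (x + rscale 1 z) - 1 * l z" using ray_inf_le[OF l, of 1 z x] by simp
    moreover have "l (x + z) \<le> l x + l z" using l by (simp add: sublinear_def)
    ultimately show ?thesis by simp
  qed
  have neg: "l (- x) = - l x" for x
    using add[of x "- x"] l by (simp add: sublinear_def)
  have scale: "l (rscale r x) = r * l x" for r x
  proof (cases "r \<ge> 0")
    case False
    have "l (rscale r x) = - l (rscale (- r) x)" by (simp add: rscale_def scale_minus_left neg)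
    also have "\<dots> = r * l x" using False sublinear_scale[OF l, of "- r" x] by simp
    finally show ?thesis .
  qed (rule sublinear_scale[OF l])
  have ly: "p y \<le> l y"
  proof -
    have "l (- y) \<le> p (- y + rscale 1 y) - 1 * p y"
      using lr[of "- y"] ray_inf_le[OF psub, of 1 y "- y"] by linarith
    then show ?thesis using neg[of y] seminorm_0[OF p] by simp
  qed
  \<comment> \<open>The only complex linear functional with real part \<open>l\<close>.\<close>
  define f where "f x = Complex (l x) (- l (smul \<i> x))" for x
  have smul_eq: "smul c x = rscale (Re c) x + rscale (Im c) (smul \<i> x)" for c x
  proof -
    have "c = of_real (Re c) + of_real (Im c) * \<i>" using complex_eq[of c] by (simp add: mult.commute)
    then show ?thesis unfolding rscale_def by (metis scale_left_distrib scale_scale)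
  qed
  have lin: "clinear f" unfolding clinear_iff
  proof (intro conjI allI)
    fix x z show "f (x + z) = f x + f z"
      by (simp add: f_def complex_eq_iff add scale_right_distrib)
  next
    fix c x
    have ii: "smul \<i> (smul \<i> x) = - x" by (simp add: scale_minus_left)
    have "smul \<i> (smul c x) = rscale (Re c) (smul \<i> x) + rscale (Im c) (smul \<i> (smul \<i> x))"
      unfolding smul_eq[of c x] by (simp add: rscale_def scale_right_distrib mult.commute)
    then have 1: "l (smul \<i> (smul c x)) = Re c * l (smul \<i> x) - Im c * l x"
      unfolding ii by (simp add: add scale neg)
    have 2: "l (smul c x) = Re c * l x + Im c * l (smul \<i> x)"
      unfolding smul_eq[of c x] by (simp add: add scale)
    show "f (smul c x) = c * f x"
      unfolding f_def 1 2 by (simp add: complex_eq_iff algebra_simps)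
  qed
  have bound: "norm (f x) \<le> p x" for x
  proof (cases "f x = 0")
    case False
    \<comment> \<open>Rotating \<open>x\<close> by a unimodular \<open>c\<close> makes the value of
      \<open>f\<close> real, so that it is seen by \<open>l\<close>.\<close>
    define c where "c = cnj (f x) / of_real (norm (f x))"
    have "c * f x = (f x * cnj (f x)) / of_real (norm (f x))" by (simp add: c_def)
    also have "\<dots> = of_real ((norm (f x))\<^sup>2) / of_real (norm (f x))"
      by (simp only: complex_norm_square)
    also have "\<dots> = of_real (norm (f x))" using False by (simp add: power2_eq_square)
    finally have "c * f x = of_real (norm (f x))" .
    then have "Re (f (smul c x)) = norm (f x)" using clinear_scale[OF lin] by simp
    then have "norm (f x) = l (smul c x)" by (simp add: f_def)
    also have "\<dots> \<le> p (smul c x)" by (rule lp)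
    also have "\<dots> = p x" using False by (simp add: seminorm_scale[OF p] c_def norm_divide)
    finally show ?thesis .
  qed (simp add: seminorm_nonneg[OF p])
  have "norm (f y) \<ge> Re (f y)" by (rule complex_Re_le_cmod)
  then have "norm (f y) = p y" using ly bound[of y] by (simp add: f_def)
  with lin bound show ?thesis by (rule that)
qed

end

section \<open>Continuous seminorms on a locally convex space\<close>

sublocale complex_lcs \<subseteq> complex_vector_space smul ..

context complex_lcs
begin

lemma continuous_on_smul:
  assumes "continuous_on S c" "continuous_on S g"
  shows "continuous_on S (\<lambda>z. smul (c z) (g z))"
proof -
  have "continuous_on S ((\<lambda>(c, x). smul c x) \<circ> (\<lambda>z. (c z, g z)))"
    by (intro continuous_on_compose continuous_on_Pair assms continuous_on_subset[OF continuous_scale]) auto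
  then show ?thesis by (simp add: o_def)
qed

lemma open_smul_diff:
  assumes "open U"
  shows "open {y. smul c (y - x) \<in> U}"
proof -
  have "continuous_on UNIV (\<lambda>y. smul c (y + (- x)))"
    by (intro continuous_on_smul continuous_on_add continuous_on_const continuous_on_id)
  then have "continuous_on UNIV (\<lambda>y. smul c (y - x))" by simp
  from open_vimage[OF assms this] show ?thesis by (simp add: vimage_def)
qed

lemma cs_seminorm: "p \<in> cs smul \<Longrightarrow> seminorm smul p"
  and cs_continuous: "p \<in> cs smul \<Longrightarrow> continuous_on UNIV p"
  by (simp_all add: cs_def)

lemma open_cs_ball: "p \<in> cs smul \<Longrightarrow> open {x. p x < r}"
  using open_vimage[OF open_lessThan[of r] cs_continuous[of p]] by (simp add: vimage_def)

lemma csI: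
  assumes p: "seminorm smul p" and W: "open W" "0 \<in> W" "\<And>x. x \<in> W \<Longrightarrow> p x \<le> 1"
  shows "p \<in> cs smul"
proof -
  have "isCont p x" for x
    unfolding isCont_def tendsto_iff
  proof (intro allI impI)
    fix e :: real assume e: "e > 0"
    define c :: complex where "c = of_real (2 / e)"
    have "\<forall>\<^sub>F y in nhds x. smul c (y - x) \<in> W"
      unfolding eventually_nhds
      by (rule exI[of _ "{y. smul c (y - x) \<in> W}"]) (use open_smul_diff[OF W(1)] W(2) in auto)
    then have "\<forall>\<^sub>F y in at x. smul c (y - x) \<in> W"
      by (rule filter_leD[OF at_within_le_nhds, rotated]) 
    then show "\<forall>\<^sub>F y in at x. dist (p y) (p x) < e"
    proof (rule eventually_mono)
      fix y assume "smul c (y - x) \<in> W"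
      then have "norm c * p (y - x) \<le> 1" using W(3) seminorm_scale[OF p] by metis
      then have "p (y - x) \<le> e / 2" using e by (simp add: c_def field_simps norm_divide)
      then show "dist (p y) (p x) < e"
        using seminorm_triangle[OF p, of y x] e by (simp add: dist_real_def)
    qed
  qed
  then show ?thesis using p by (simp add: cs_def continuous_on_eq_continuous_at)
qed

lemma cs_mono:
  assumes "q \<in> cs smul" "seminorm smul p" "\<And>x. p x \<le> C * q x"
  shows "p \<in> cs smul"
proof (rule csI[OF assms(2), of "{x. q x < 1 / (\<bar>C\<bar> + 1)}"])
  show "open {x. q x < 1 / (\<bar>C\<bar> + 1)}" by (rule open_cs_ball[OF assms(1)])
  show "0 \<in> {x. q x < 1 / (\<bar>C\<bar> + 1)}" using seminorm_0[OF cs_seminorm[OF assms(1)]] by simp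
next
  fix x assume "x \<in> {x. q x < 1 / (\<bar>C\<bar> + 1)}"
  then have "(\<bar>C\<bar> + 1) * q x \<le> 1" by (simp add: field_simps)
  moreover have "C * q x \<le> (\<bar>C\<bar> + 1) * q x"
    using seminorm_nonneg[OF cs_seminorm[OF assms(1)]] by (intro mult_right_mono) auto
  ultimately show "p x \<le> 1" using assms(3)[of x] by linarith
qed

lemma cs_add:
  assumes "p \<in> cs smul" "q \<in> cs smul"
  shows "(\<lambda>x. p x + q x) \<in> cs smul"
  unfolding cs_def seminorm_def mem_Collect_eq
proof (intro conjI allI continuous_on_add)
  note s = assms[THEN cs_seminorm]
  fix x y c
  show "0 \<le> p x + q x" using s[THEN seminorm_nonneg, of x] by simp
  show "p (x + y) + q (x + y) \<le> p x + q x + (p y + q y)"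
    using s[THEN seminorm_add, of x y] by simp
  show "p (smul c x) + q (smul c x) = norm c * (p x + q x)"
    by (simp add: s[THEN seminorm_scale] algebra_simps)
qed (use assms in \<open>simp_all add: cs_def\<close>)

lemma seminorm_norm_clinear: "clinear f \<Longrightarrow> seminorm smul (\<lambda>x. norm (f x))"
  by (simp add: seminorm_def clinear_add clinear_scale norm_mult norm_triangle_ineq)

lemma dual_cs: "f \<in> topological_dual smul \<Longrightarrow> (\<lambda>x. norm (f x)) \<in> cs smul"
  by (simp add: topological_dual_def cs_def seminorm_norm_clinear continuous_on_norm)

lemma topological_dualI:
  assumes "q \<in> cs smul" "clinear f" "\<And>x. norm (f x) \<le> C * q x"
  shows "f \<in> topological_dual smul"
proof -
  have c: "continuous_on UNIV (\<lambda>x. norm (f x))"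
    by (rule cs_continuous, rule cs_mono[OF assms(1) seminorm_norm_clinear[OF assms(2)] assms(3)])
  have "isCont f x" for x
  proof -
    have "continuous_on UNIV (\<lambda>y. y + (- x))"
      by (intro continuous_on_add continuous_on_const continuous_on_id)
    then have "continuous_on UNIV (\<lambda>y. norm (f (y + - x)))"
      using continuous_on_compose2[OF c] by auto
    then have "isCont (\<lambda>y. norm (f (y - x))) x"
      by (simp add: continuous_on_eq_continuous_at)
    then have "((\<lambda>y. norm (f y - f x)) \<longlongrightarrow> 0) (at x)"
      using clinear_0[OF assms(2)] by (simp add: isCont_def clinear_diff[OF assms(2)])
    then show ?thesis
      unfolding isCont_def by (simp add: tendsto_norm_zero_iff LIM_zero_iff)
  qed
  with assms(2) show ?thesis by (simp add: topological_dual_def continuous_on_eq_continuous_at)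
qed

text \<open>Minkowski functional of the balanced core of a convex neighbourhood.\<close>

lemma cs_ball_subset:
  assumes U: "open U" "0 \<in> U"
  obtains p where "p \<in> cs smul" "\<And>x. p x < 1 \<Longrightarrow> x \<in> U"
proof -
  obtain V where V: "open V" "0 \<in> V" "V \<subseteq> U" and
    conv: "\<And>x y t. x \<in> V \<Longrightarrow> y \<in> V \<Longrightarrow> 0 \<le> t \<Longrightarrow> t \<le> 1 \<Longrightarrow>
      smul (of_real t) x + smul (of_real (1 - t)) y \<in> V"
    using locally_convex[OF U] by (auto simp: Ball_def)
  define B where "B = {x. \<forall>c. norm c \<le> 1 \<longrightarrow> smul c x \<in> V}"
  have "open ((\<lambda>(c, x). smul c x) -` V)" by (rule open_vimage[OF V(1) continuous_scale])
  then obtain S T where S: "open S" "0 \<in> S" and T: "open T" "0 \<in> T"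
    and ST: "S \<times> T \<subseteq> (\<lambda>(c, x). smul c x) -` V"
    using V(2) by (auto elim!: open_prod_elim[where x = "(0, 0)"])
  obtain d where d: "d > 0" "ball 0 d \<subseteq> S" using S open_contains_ball by blast
  \<comment> \<open>Writing \<open>c\<close> as \<open>(d / 2 * c) * (2 / d)\<close> moves the unit
    disc into \<open>S\<close> and \<open>x\<close> into \<open>T\<close>; thus \<open>B\<close>,
    itself perhaps not open, contains the open set \<open>W\<close>.\<close>
  define W where "W = {y. smul (of_real (2 / d)) (y - 0) \<in> T}"
  have W: "open W" "0 \<in> W" unfolding W_def using open_smul_diff[OF T(1)] T(2) by (blast, simp)
  have WB: "x \<in> B" if "x \<in> W" for x
    unfolding B_def
  proof (intro CollectI allI impI)
    fix c :: complex assume c: "norm c \<le> 1"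
    have "norm (of_real (d / 2) * c) = d / 2 * norm c" using d by (simp add: norm_mult)
    also have "\<dots> \<le> d / 2 * 1" using c d by (intro mult_left_mono) auto
    also have "\<dots> < d" using d by simp
    finally have "of_real (d / 2) * c \<in> S" using d(2) by auto
    then have "smul (of_real (d / 2) * c) (smul (of_real (2 / d)) x) \<in> V"
      using ST that by (auto simp: W_def)
    moreover have "of_real (d / 2) * c * of_real (2 / d) = c" using d by (simp add: field_simps)
    ultimately show "smul c x \<in> V" by simp
  qed
  have bal: "smul c x \<in> B" if "x \<in> B" "norm c \<le> 1" for c x
    using that mult_mono[of _ 1 "norm c" 1] by (auto simp: B_def norm_mult)
  have Bconv: "smul (of_real t) x + smul (of_real (1 - t)) y \<in> B"
    if "x \<in> B" "y \<in> B" "0 \<le> t" "t \<le> 1" for x y t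
    unfolding B_def
  proof (intro CollectI allI impI)
    fix c :: complex assume c: "norm c \<le> 1"
    have "smul c (smul (of_real t) x + smul (of_real (1 - t)) y) =
      smul (of_real t) (smul c x) + smul (of_real (1 - t)) (smul c y)"
      by (simp add: scale_right_distrib mult.commute)
    then show "smul c (smul (of_real t) x + smul (of_real (1 - t)) y) \<in> V"
      using conv[of "smul c x" "smul c y" t] that c unfolding B_def by (simp del: scale_scale)
  qed
  define G where "G x = {t. t > 0 \<and> rscale (1 / t) x \<in> B}" for x
  define p where "p x = Inf (G x)" for x
  have Gne: "G x \<noteq> {}" for x
  proof -
    have "open ((\<lambda>c. smul c x) -` W)"
      by (rule open_vimage[OF W(1)]) (intro continuous_on_smul continuous_on_const continuous_on_id)
    moreover have "0 \<in> (\<lambda>c. smul c x) -` W" using W by simp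
    ultimately obtain e where e: "e > 0" "ball 0 e \<subseteq> (\<lambda>c. smul c x) -` W"
      using open_contains_ball by blast
    then have "of_real (e / 2) \<in> (\<lambda>c. smul c x) -` W" by (intro subsetD[OF e(2)]) simp
    then have "2 / e \<in> G x" using e WB by (auto simp: G_def rscale_def)
    then show ?thesis by auto
  qed
  have bdd: "bdd_below (G x)" for x by (auto simp: G_def intro!: bdd_belowI[of _ 0])
  have p_le: "p x \<le> t" if "t > 0" "rscale (1 / t) x \<in> B" for x t
    unfolding p_def using that by (intro cInf_lower[OF _ bdd]) (auto simp: G_def)
  have p_ge: "a \<le> p x" if "\<And>t. t > 0 \<Longrightarrow> rscale (1 / t) x \<in> B \<Longrightarrow> a \<le> t" for x a
    unfolding p_def using that by (intro cInf_greatest[OF Gne]) (auto simp: G_def)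
  have p_nonneg: "0 \<le> p x" for x by (rule p_ge) simp
  have p_add: "p (x + y) \<le> p x + p y" for x y
  proof -
    have "p (x + y) \<le> t + s" if "t > 0" "rscale (1 / t) x \<in> B" "s > 0" "rscale (1 / s) y \<in> B" for s t
    proof (rule p_le)
      have "smul (of_real (t / (t + s))) (rscale (1 / t) x) + smul (of_real (1 - t / (t + s))) (rscale (1 / s) y) \<in> B"
        using that by (intro Bconv) auto
      moreover have "t / (t + s) * (1 / t) = 1 / (t + s)" "(1 - t / (t + s)) * (1 / s) = 1 / (t + s)"
        using that by (simp_all add: field_simps)
      ultimately show "rscale (1 / (t + s)) (x + y) \<in> B"
        unfolding rscale_def[symmetric] rscale_rscale by (simp add: rscale_add)
    qed (use that in simp)
    then have "p (x + y) - s \<le> p x" if "s > 0" "rscale (1 / s) y \<in> B" for s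
      using that by (intro p_ge) (smt (verit))
    then have "p (x + y) - p x \<le> p y" by (intro p_ge) (smt (verit))
    then show ?thesis by simp
  qed
  have p_0: "p 0 = 0"
  proof -
    have "0 \<in> B" using WB W by auto
    then have "p 0 \<le> t" if "t > 0" for t using that by (intro p_le) auto
    then have "p 0 \<le> 0" by (rule field_le_epsilon) simp
    then show ?thesis using p_nonneg[of 0] by simp
  qed
  have scale_le: "p (smul c x) \<le> norm c * p x" for c x
  proof (cases "c = 0")
    case False
    have "p (smul c x) / norm c \<le> p x"
    proof (rule p_ge)
      fix t assume t: "t > 0" "rscale (1 / t) x \<in> B"
      have "smul (c / of_real (norm c)) (rscale (1 / t) x) \<in> B"
        using t False by (intro bal) (auto simp: norm_divide)
      moreover have "c / of_real (norm c) * of_real (1 / t) = of_real (1 / (norm c * t)) * c"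
        by simp
      ultimately have "p (smul c x) \<le> norm c * t"
        using t False by (intro p_le) (auto simp: rscale_def)
      then show "p (smul c x) / norm c \<le> t" using False by (simp add: field_simps)
    qed
    then show ?thesis using False by (simp add: field_simps)
  qed (simp add: p_0)
  have "seminorm smul p" unfolding seminorm_def
  proof (intro conjI allI p_nonneg p_add)
    fix c x
    show "p (smul c x) = norm c * p x"
    proof (cases "c = 0")
      case False
      have "p x \<le> norm (1 / c) * p (smul c x)"
        using scale_le[of "1 / c" "smul c x"] False by simp
      then have "norm c * p x \<le> p (smul c x)" using False by (simp add: norm_divide field_simps)
      then show ?thesis using scale_le[of c x] by simp
    qed (simp add: p_0)
  qed
  moreover have "p x \<le> 1" if "x \<in> W" for x using p_le[of 1 x] WB[OF that] by simp
  ultimately have "p \<in> cs smul" using W by (intro csI) auto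
  moreover have "x \<in> U" if "p x < 1" for x
  proof -
    have "\<exists>t\<in>G x. t < 1" by (rule cInf_lessD[OF Gne that[unfolded p_def]])
    then obtain t where t: "t > 0" "rscale (1 / t) x \<in> B" "t < 1" by (auto simp: G_def)
    have "smul (of_real t) (rscale (1 / t) x) \<in> B" using t by (intro bal) auto
    then have "x \<in> B" using t by (simp add: rscale_def)
    then have "norm (1::complex) \<le> 1 \<longrightarrow> smul 1 x \<in> V" unfolding B_def mem_Collect_eq by (rule spec)
    then show ?thesis using V(3) by auto
  qed
  ultimately show ?thesis by (rule that)
qed

section \<open>Order, completeness and metrizability in terms of seminorms\<close>

lemma cs_leI:
  assumes "p \<in> cs smul" "q \<in> cs smul" "\<And>x. q x < 1 \<Longrightarrow> p x < 1"
  shows "p x \<le> q x"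
proof (rule ccontr)
  assume "\<not> p x \<le> q x"
  then obtain t where t: "q x < t" "t < p x" using dense by (metis not_le)
  then have "t > 0" using seminorm_nonneg[OF cs_seminorm[OF assms(2)], of x] by simp
  have "q (smul (of_real (1 / t)) x) < 1"
    using t \<open>t > 0\<close> by (simp add: seminorm_scale[OF cs_seminorm[OF assms(2)]] norm_divide field_simps)
  then have "p (smul (of_real (1 / t)) x) < 1" by (rule assms(3))
  then show False
    using t \<open>t > 0\<close> by (simp add: seminorm_scale[OF cs_seminorm[OF assms(1)]] norm_divide field_simps)
qed

lemma summable_of_abs_convergent:
  assumes sc: "sequentially_complete TYPE('a)"
    and y: "\<And>p. p \<in> cs smul \<Longrightarrow> summable (\<lambda>n. p (y n))"
  shows "summable y"
proof -
  have "\<exists>N. \<forall>m\<ge>N. \<forall>n\<ge>N. sum y {..<m} - sum y {..<n} \<in> U" if U: "open U" "0 \<in> U" for U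
  proof -
    obtain p where p: "p \<in> cs smul" "\<And>x. p x < 1 \<Longrightarrow> x \<in> U" using cs_ball_subset[OF U] by blast
    note ps = cs_seminorm[OF p(1)]
    obtain N where N: "\<And>m n. m \<ge> N \<Longrightarrow> norm (\<Sum>k=m..<n. p (y k)) < 1"
      using spec[OF iffD1[OF summable_Cauchy y[OF p(1)]], of 1] by auto
    have *: "p (sum y {..<n} - sum y {..<m}) < 1" if "m \<ge> N" "m \<le> n" for m n
    proof -
      have "sum y {..<n} - sum y {..<m} = (\<Sum>k=m..<n. y k)"
        using sum_diff_nat_ivl[of 0 m n y] that by (simp add: atLeast0LessThan)
      then have "p (sum y {..<n} - sum y {..<m}) \<le> (\<Sum>k=m..<n. p (y k))"
        using seminorm_sum[OF ps] by metis
      also have "\<dots> < 1" using N[OF that(1), of n] by simp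
      finally show ?thesis .
    qed
    have "sum y {..<m} - sum y {..<n} \<in> U" if "m \<ge> N" "n \<ge> N" for m n
    proof (cases "m \<le> n")
      case True
      then have "p (- (sum y {..<m} - sum y {..<n})) < 1" using *[of m n] that by simp
      then show ?thesis using p(2) seminorm_minus[OF ps] by metis
    qed (use *[of n m] that p(2) in auto)
    then show ?thesis by blast
  qed
  then have "convergent (\<lambda>n. sum y {..<n})"
    using sc[unfolded sequentially_complete_def, THEN spec[of _ "\<lambda>n. sum y {..<n}"]] by blast
  then show ?thesis by (simp add: summable_iff_convergent)
qed

text \<open>One seminorm is taken for each member of a countable base at 0, and partial sums make
  the list increasing. Comparing unit balls by \<open>cs_leI\<close> gives domination without a
  constant.\<close>

lemma fundamental_seminorms:
  assumes "metrizable_space (euclidean :: 'a topology)"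
  obtains Q where "\<And>k. Q k \<in> cs smul" "\<And>j k x. j \<le> k \<Longrightarrow> Q j x \<le> Q k x"
    "\<And>p. p \<in> cs smul \<Longrightarrow> \<exists>k::nat. \<forall>x. p x \<le> Q k x"
proof -
  have "\<exists>\<B>. countable \<B> \<and> (\<forall>V\<in>\<B>. openin euclidean V) \<and>
      (\<forall>U. openin euclidean U \<and> (0::'a) \<in> U \<longrightarrow> (\<exists>V\<in>\<B>. 0 \<in> V \<and> V \<subseteq> U))"
    using metrizable_imp_first_countable[OF assms] unfolding first_countable_def by simp
  then obtain \<B> :: "'a set set" where \<B>: "countable \<B>" "\<And>V. V \<in> \<B> \<Longrightarrow> open V"
    "\<And>U. open U \<Longrightarrow> 0 \<in> U \<Longrightarrow> \<exists>V\<in>\<B>. 0 \<in> V \<and> V \<subseteq> U"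
    by (metis open_openin)
  define \<B>' where "\<B>' = {V \<in> \<B>. 0 \<in> V}"
  have "\<B>' \<noteq> {}" using \<B>(3)[of UNIV] by (auto simp: \<B>'_def)
  have "countable \<B>'" using \<B>(1) by (simp add: \<B>'_def)
  define V where "V = from_nat_into \<B>'"
  have V: "open (V k)" "0 \<in> V k" for k
    using from_nat_into[OF \<open>\<B>' \<noteq> {}\<close>, of k] \<B>(2) by (auto simp: V_def \<B>'_def)
  have "\<exists>p. p \<in> cs smul \<and> (\<forall>x. p x < 1 \<longrightarrow> x \<in> V k)" for k
    using cs_ball_subset[OF V[of k]] by metis
  then obtain P where P: "\<And>k. P k \<in> cs smul" "\<And>k x. P k x < 1 \<Longrightarrow> x \<in> V k" by metis
  define Q where "Q k x = (\<Sum>i\<le>k. P i x)" for k x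
  have nn: "0 \<le> P k x" for k x using seminorm_nonneg[OF cs_seminorm[OF P(1)]] .
  have Qcs: "Q k \<in> cs smul" for k
  proof (induction k)
    case 0
    have "Q 0 = P 0" by (rule ext) (simp add: Q_def)
    then show ?case using P by simp
  next
    case (Suc k)
    have "Q (Suc k) = (\<lambda>x. Q k x + P (Suc k) x)" by (rule ext) (simp add: Q_def)
    then show ?case using cs_add[OF Suc P(1)] by simp
  qed
  show ?thesis
  proof (rule that[of Q])
    show "Q j x \<le> Q k x" if "j \<le> k" for j k x
      unfolding Q_def using that nn by (intro sum_mono2) auto
    fix p assume p: "p \<in> cs smul"
    have "0 \<in> {x. p x < 1}" using seminorm_0[OF cs_seminorm[OF p]] by simp
    then obtain U where "U \<in> \<B>'" "U \<subseteq> {x. p x < 1}"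
      using \<B>(3)[OF open_cs_ball[OF p]] by (auto simp: \<B>'_def)
    then obtain k where k: "V k \<subseteq> {x. p x < 1}"
      using from_nat_into_surj[OF \<open>countable \<B>'\<close>] unfolding V_def by metis
    have "p x < 1" if "Q k x < 1" for x
    proof -
      have "P k x \<le> Q k x" unfolding Q_def using nn by (intro member_le_sum) auto
      then show ?thesis using that P(2)[of k x] k by auto
    qed
    then show "\<exists>k. \<forall>x. p x \<le> Q k x" using cs_leI[OF p Qcs[of k]] by blast
  qed (rule Qcs)
qed

end

section \<open>Nuclear spaces have no gap\<close>

lemma seminorm_dirichlet_term:
  assumes "seminorm smul p"
  shows "p (dirichlet_term smul a s n) = p (a n) / real (Suc n) powr Re s"
proof -
  have "norm (of_nat (Suc n) powr s :: complex) = real (Suc n) powr Re s"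
    by (subst norm_powr_real_powr) auto
  then have "norm (1 / of_nat (Suc n) powr s :: complex) = 1 / real (Suc n) powr Re s"
    by (simp only: norm_divide norm_one)
  then show ?thesis using assms by (simp add: dirichlet_term_def seminorm_def)
qed

text \<open>The seminorm of a term depends on \<open>s\<close> only through \<open>Re s\<close>, so
  abscissas can be tested at real points, one seminorm at a time.\<close>

lemma sigma_a_less_imp_summable:
  assumes "sigma_a smul a < ereal r" "p \<in> cs smul"
  shows "summable (\<lambda>n. p (a n) / real (Suc n) powr r)"
proof -
  obtain r0 where r0: "r0 < r"
    "\<And>s. Re s > r0 \<Longrightarrow> abs_convergent smul (dirichlet_term smul a s)"
    using assms(1) unfolding sigma_a_def Inf_less_iff by auto
  have "abs_convergent smul (dirichlet_term smul a (of_real r))" using r0 by simp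
  then have "summable (\<lambda>n. p (dirichlet_term smul a (of_real r) n))"
    using assms(2) unfolding abs_convergent_def by blast
  moreover have "seminorm smul p" using assms(2) by (simp add: cs_def)
  ultimately show ?thesis by (simp add: seminorm_dirichlet_term)
qed

lemma sigma_a_leI:
  assumes "\<And>p. p \<in> cs smul \<Longrightarrow> summable (\<lambda>n. p (a n) / real (Suc n) powr r)"
  shows "sigma_a smul a \<le> ereal r"
  unfolding sigma_a_def
proof (rule Inf_lower, intro imageI CollectI allI impI)
  fix s :: complex assume s: "r < Re s"
  show "abs_convergent smul (dirichlet_term smul a s)" unfolding abs_convergent_def
  proof
    fix p assume p: "p \<in> cs smul"
    then have ps: "seminorm smul p" by (simp add: cs_def)
    then have nn: "0 \<le> p x" for x by (simp add: seminorm_def)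
    show "summable (\<lambda>n. p (dirichlet_term smul a s n))"
    proof (rule summable_comparison_test'[OF assms[OF p], of 0])
      fix n :: nat
      have "real (Suc n) powr r \<le> real (Suc n) powr Re s" using s by (intro powr_mono) auto
      then show "norm (p (dirichlet_term smul a s n)) \<le> p (a n) / real (Suc n) powr r"
        unfolding seminorm_dirichlet_term[OF ps] using nn[of "a n"]
        by (simp add: frac_le)
    qed
  qed
qed

lemma cs_complex_mult:
  "(norm :: complex \<Rightarrow> real) \<in> cs (*)"
  "p \<in> cs (*) \<Longrightarrow> p z = norm z * p (1::complex)"
proof -
  show "(norm :: complex \<Rightarrow> real) \<in> cs (*)"
    by (auto simp: cs_def seminorm_def norm_mult norm_triangle_ineq intro: continuous_on_norm_id)
  assume "p \<in> cs (*)"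
  then have "p (z * 1) = norm z * p 1" unfolding cs_def seminorm_def by blast
  then show "p z = norm z * p 1" by simp
qed

lemma sigma_a_complex_leI:
  assumes "summable (\<lambda>n. norm (z n :: complex) / real (Suc n) powr r)"
  shows "sigma_a (*) z \<le> ereal r"
proof (rule sigma_a_leI)
  fix p :: "complex \<Rightarrow> real" assume "p \<in> cs (*)"
  then have "p (z n) / real (Suc n) powr r = norm (z n) / real (Suc n) powr r * p 1" for n
    using cs_complex_mult(2)[of p "z n"] by simp
  then show "summable (\<lambda>n. p (z n) / real (Suc n) powr r)"
    using summable_mult2[OF assms, of "p 1"] by simp
qed

section \<open>Uniform boundedness and sums along nuclear representations\<close>

context complex_vector_space
begin

lemma clinear_scaled: "clinear f \<Longrightarrow> clinear (\<lambda>x. c * f x)"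
  by (simp add: clinear_iff algebra_simps)

lemma clinear_scaled_add: "clinear f \<Longrightarrow> clinear g \<Longrightarrow> clinear (\<lambda>x. f x + c * g x)"
  by (simp add: clinear_iff algebra_simps)

text \<open>The uniform boundedness principle for the Banach space of \<open>q\<close>-bounded functionals, by Sokal's
  argument: if \<open>P\<^sub>j\<close> has norm at least \<open>4\<^sup>j\<close> and is almost normed by \<open>f\<^sub>j\<close>, then for a suitable choice
  of signs the functional \<open>\<Sum>\<^sub>j \<plusminus> 3\<^sup>-\<^sup>j f\<^sub>j\<close> violates the pointwise bound.\<close>

lemma uniform_boundedness:
  assumes q: "seminorm smul q"
    and summ: "\<And>f. clinear f \<Longrightarrow> (\<And>x. norm (f x) \<le> q x) \<Longrightarrow> summable (\<lambda>n. norm (f (b n)))"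
  obtains C where "C \<ge> 0"
    "\<And>f N. clinear f \<Longrightarrow> (\<And>x. norm (f x) \<le> q x) \<Longrightarrow> (\<Sum>n<N. norm (f (b n))) \<le> C"
proof (rule ccontr)
  assume contra: "\<not> thesis"
  define F where "F = {f. clinear f \<and> (\<forall>x. norm (f x) \<le> q x)}"
  define P where "P N f = (\<Sum>n<N. norm (f (b n)))" for N :: nat and f :: "'a \<Rightarrow> complex"
  define S where "S N = (SUP f\<in>F. P N f)" for N
  have zero: "(\<lambda>_. 0) \<in> F" by (simp add: F_def clinear_iff seminorm_nonneg[OF q])
  have bdd: "bdd_above (P N ` F)" for N
    unfolding P_def F_def by (intro bdd_aboveI2[of _ _ "\<Sum>n<N. q (b n)"] sum_mono) auto
  have P_le: "P N f \<le> S N" if "f \<in> F" for f N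
    unfolding S_def using that by (intro cSUP_upper bdd)
  have ex: "\<exists>N. S N \<ge> 4 ^ j" for j
  proof (rule ccontr)
    assume "\<not> (\<exists>N. S N \<ge> 4 ^ j)"
    then have "P N f \<le> 4 ^ j" if "f \<in> F" for f N
      using P_le[OF that, of N] by (meson le_less_trans linear not_le)
    then show False using that[of "4 ^ j"] contra by (simp add: P_def F_def)
  qed
  then obtain N where N: "\<And>j. S (N j) \<ge> 4 ^ j" by metis
  have "\<exists>f\<in>F. P (N j) f \<ge> 2/3 * S (N j)" for j
  proof -
    have "0 < S (N j)" using N[of j] zero_less_power[of "4::real" j] by linarith
    then have "2/3 * S (N j) < S (N j)" by simp
    then have "\<exists>f\<in>F. 2/3 * S (N j) < P (N j) f"
      unfolding S_def[of "N j"] using zero by (subst (asm) less_cSUP_iff[OF _ bdd]) auto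
    then show ?thesis by (meson less_imp_le)
  qed
  then obtain f where f: "\<And>j. f j \<in> F" "\<And>j. P (N j) (f j) \<ge> 2/3 * S (N j)" by metis
  have f_lin: "clinear (f j)" and f_le: "norm (f j x) \<le> q x" for j x
    using f(1)[of j] by (auto simp: F_def)
  define step where "step j g s = (\<lambda>x. g x + s * (1/3) ^ j * f j x)" for j g and s :: complex
  define g where "g = rec_nat (\<lambda>_. 0) (\<lambda>j g. if P (N j) (step j g 1) \<ge> (1/3) ^ j * P (N j) (f j)
    then step j g 1 else step j g (- 1))"
  have g0: "g 0 = (\<lambda>_. 0)" by (simp add: g_def)
  have gS: "g (Suc j) = (if P (N j) (step j (g j) 1) \<ge> (1/3) ^ j * P (N j) (f j)
    then step j (g j) 1 else step j (g j) (- 1))" for j by (simp add: g_def)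
  have gP: "P (N j) (g (Suc j)) \<ge> (1/3) ^ j * P (N j) (f j)" for j
  proof (cases "P (N j) (step j (g j) 1) \<ge> (1/3) ^ j * P (N j) (f j)")
    case False
    \<comment> \<open>The two candidates differ by \<open>2 * (1/3) ^ j * f j\<close>, so their
      values under \<open>P\<close> cannot both be too small.\<close>
    have "2 * ((1/3) ^ j * P (N j) (f j)) \<le> P (N j) (step j (g j) 1) + P (N j) (step j (g j) (- 1))"
      unfolding P_def sum_distrib_left sum.distrib[symmetric]
    proof (rule sum_mono)
      fix n
      have "2 * ((1/3) ^ j * norm (f j (b n))) =
          norm (step j (g j) 1 (b n) - step j (g j) (- 1) (b n))"
        by (simp add: step_def norm_mult norm_power norm_divide flip: mult_2 mult.assoc)
      also have "\<dots> \<le> norm (step j (g j) 1 (b n)) + norm (step j (g j) (- 1) (b n))"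
        by (rule norm_triangle_ineq4)
      finally show "2 * ((1/3) ^ j * norm (f j (b n))) \<le>
        norm (step j (g j) 1 (b n)) + norm (step j (g j) (- 1) (b n))" .
    qed
    then show ?thesis using False by (simp add: gS)
  qed (simp add: gS)
  obtain e where e: "\<And>j. norm (e j) = 1" "\<And>j x. g (Suc j) x = g j x + e j * (1/3) ^ j * f j x"
  proof (rule that[of "\<lambda>j. if P (N j) (step j (g j) 1) \<ge> (1/3) ^ j * P (N j) (f j) then 1 else - 1"])
  qed (simp_all add: gS step_def)
  define h where "h j x = e j * (1/3) ^ j * f j x" for j x
  have h_le: "norm (h j x) \<le> (1/3) ^ j * q x" for j x
    using f_le[of j x] by (simp add: h_def norm_mult e norm_power norm_divide mult_left_mono)
  have geo: "summable (\<lambda>j. (1/3) ^ j * q x)" for x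
    by (intro summable_mult2 summable_geometric) simp
  have h_summ: "summable (\<lambda>j. h j x)" for x
    by (rule summable_comparison_test'[OF geo[of x], of 0]) (rule h_le)
  define G where "G x = (\<Sum>j. h j x)" for x
  have g_sum: "g j x = (\<Sum>i<j. h i x)" for j x
    by (induction j) (simp_all add: g0 e h_def)
  have g_lin: "clinear (g j)" for j
    by (induction j) (simp_all add: clinear_iff g0 e clinear_add[OF f_lin] clinear_scale[OF f_lin] algebra_simps)
  have G_lin: "clinear G" unfolding clinear_iff
  proof (intro conjI allI)
    fix x y c
    have 1: "h j (x + y) = h j x + h j y" for j by (simp add: h_def clinear_add[OF f_lin] algebra_simps)
    show "G (x + y) = G x + G y" unfolding G_def 1 by (rule suminf_add[symmetric]) (rule h_summ)+
    have 2: "h j (smul c x) = c * h j x" for j by (simp add: h_def clinear_scale[OF f_lin])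
    show "G (smul c x) = c * G x" unfolding G_def 2 by (rule suminf_mult) (rule h_summ)
  qed
  have tail: "norm (G x - g j x) \<le> 3/2 * (1/3) ^ j * q x" for j x
  proof -
    have "G x - g j x = (\<Sum>i. h (i + j) x)"
      unfolding G_def g_sum using suminf_minus_initial_segment[OF h_summ] by simp
    also have "norm \<dots> \<le> (\<Sum>i. norm (h (i + j) x))"
      by (rule summable_norm, rule summable_comparison_test'[OF summable_ignore_initial_segment[OF geo[of x], of j], of 0])
        (use h_le in simp)
    also have "\<dots> \<le> (\<Sum>i. (1/3) ^ (i + j) * q x)"
      by (rule suminf_le[OF h_le], rule summable_comparison_test'[OF summable_ignore_initial_segment[OF geo[of x], of j], of 0])
        (use h_le summable_ignore_initial_segment[OF geo[of x], of j] in auto)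
    also have "\<dots> = (\<Sum>i. (1/3) ^ i * ((1/3) ^ j * q x))" by (simp add: power_add mult.assoc)
    also have "\<dots> = (\<Sum>i. (1/3 :: real) ^ i) * ((1/3) ^ j * q x)"
      by (rule suminf_mult2[symmetric]) (rule summable_geometric, simp)
    also have "(\<Sum>i. (1/3 :: real) ^ i) = 3/2" by (subst suminf_geometric) auto
    finally show ?thesis by simp
  qed
  \<comment> \<open>In units of \<open>(1/3) ^ j * S (N j)\<close>: step \<open>j\<close> secures
    \<open>2/3\<close>, and the tail beyond it, bounded by \<open>(1/3) ^ j / 2\<close> times
    \<open>q\<close>, takes away at most \<open>1/2\<close>; this leaves \<open>1/6\<close>.\<close>
  have PG: "P (N j) G \<ge> (1/3) ^ j * S (N j) / 6" for j
  proof -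
    define r :: complex where "r = of_real (2 * 3 ^ j)"
    have r: "norm r = 2 * 3 ^ j" by (simp add: r_def norm_mult norm_power)
    have "(\<lambda>x. r * (G x + (- 1) * g (Suc j) x)) \<in> F" unfolding F_def
    proof (intro CollectI conjI allI clinear_scaled clinear_scaled_add G_lin g_lin)
      fix x
      have "norm (r * (G x + (- 1) * g (Suc j) x)) = 2 * 3 ^ j * norm (G x - g (Suc j) x)"
        by (simp add: norm_mult r)
      also have "\<dots> \<le> 2 * 3 ^ j * (3/2 * (1/3) ^ Suc j * q x)"
        by (intro mult_left_mono tail) simp
      also have "\<dots> = q x" by (simp add: power_divide)
      finally show "norm (r * (G x + (- 1) * g (Suc j) x)) \<le> q x" .
    qed
    from P_le[OF this, of "N j"]
    have "2 * 3 ^ j * (\<Sum>n<N j. norm (G (b n) - g (Suc j) (b n))) \<le> S (N j)"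
      by (simp add: P_def norm_mult r sum_distrib_left)
    then have 1: "(\<Sum>n<N j. norm (G (b n) - g (Suc j) (b n))) \<le> (1/3) ^ j * S (N j) / 2"
      by (simp add: power_divide field_simps)
    have 2: "P (N j) (g (Suc j)) \<le> P (N j) G + (\<Sum>n<N j. norm (G (b n) - g (Suc j) (b n)))"
      unfolding P_def sum.distrib[symmetric]
      by (intro sum_mono) (metis add.commute norm_minus_commute norm_triangle_sub)
    have "(1/3) ^ j * (2/3 * S (N j)) \<le> (1/3) ^ j * P (N j) (f j)"
      by (intro mult_left_mono f) simp
    then show ?thesis using 1 2 gP[of j] by argo
  qed
  \<comment> \<open>The weights \<open>(1/3) ^ j\<close> sum to \<open>3/2\<close>; dividing by it
    puts \<open>G\<close> into the unit ball \<open>F\<close>.\<close>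
  have "(\<lambda>x. (2/3) * G x) \<in> F"
    unfolding F_def mem_Collect_eq
  proof (intro conjI allI clinear_scaled G_lin)
    show "norm ((2/3) * G x) \<le> q x" for x using tail[of x 0] by (simp add: norm_mult g0)
  qed
  then have "summable (\<lambda>n. norm ((\<lambda>x. (2/3) * G x) (b n)))"
    unfolding F_def by (intro summ) blast+
  then have sG: "summable (\<lambda>n. norm (G (b n)))" by (simp add: norm_mult summable_cmult_iff)
  define K where "K = (\<Sum>n. norm (G (b n)))"
  have K: "(4/3) ^ j / 6 \<le> K" for j
  proof -
    have "(4/3 :: real) ^ j = (1/3) ^ j * 4 ^ j" by (simp add: power_divide)
    also have "\<dots> \<le> (1/3) ^ j * S (N j)" by (intro mult_left_mono N) simp
    also have "\<dots> / 6 \<le> P (N j) G" using PG by simp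
    also have "\<dots> \<le> K" unfolding P_def K_def by (rule sum_le_suminf[OF sG]) auto
    finally show ?thesis by simp
  qed
  obtain j where "6 * K < (4/3) ^ j" using real_arch_pow[of "4/3"] by auto
  with K[of j] show False by simp
qed

text \<open>Normalising \<open>x\<close> is impossible where \<open>q\<close> vanishes; there the
  bound by a multiple of \<open>q\<close> in \<open>seminorm_dual\<close> gives
  \<open>f x = 0\<close>. The same bound makes the supremum in \<open>dual_seminorm\<close> a
  genuine one.\<close>

lemma dual_seminorm_bound:
  assumes "seminorm smul q" "f \<in> seminorm_dual smul q"
  shows "norm (f x) \<le> dual_seminorm q f * q x" "0 \<le> dual_seminorm q f"
proof -
  obtain C where f: "clinear f" and C: "\<And>x. norm (f x) \<le> C * q x"
    using assms(2) by (auto simp: seminorm_dual_def)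
  have bdd: "bdd_above ((\<lambda>x. norm (f x)) ` {x. q x \<le> 1})"
  proof (rule bdd_aboveI2)
    fix x assume "x \<in> {x. q x \<le> 1}"
    then have "C * q x \<le> \<bar>C\<bar> * 1" using seminorm_nonneg[OF assms(1)] by (intro mult_mono) auto
    then show "norm (f x) \<le> \<bar>C\<bar>" using C[of x] by simp
  qed
  have le: "norm (f x) \<le> dual_seminorm q f" if "q x \<le> 1" for x
    unfolding dual_seminorm_def using that by (intro cSUP_upper bdd) simp
  show "0 \<le> dual_seminorm q f" using le[of 0] by (simp add: seminorm_0[OF assms(1)] clinear_0[OF f])
  show "norm (f x) \<le> dual_seminorm q f * q x"
  proof (cases "q x = 0")
    case True
    then show ?thesis using C[of x] by simp
  next
    case False
    then have pos: "q x > 0" using seminorm_nonneg[OF assms(1), of x] by simp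
    have "norm (f (smul (of_real (1 / q x)) x)) \<le> dual_seminorm q f"
      using pos by (intro le) (simp add: seminorm_scale[OF assms(1)] norm_divide)
    then show ?thesis using pos by (simp add: clinear_scale[OF f] norm_mult norm_divide field_simps)
  qed
qed

end

context complex_lcs
begin

text \<open>By the nuclear representation, \<open>p (b n)\<close> is at most the sum over
  \<open>k\<close> of \<open>norm (f k (b n)) * p (y k)\<close>. Summing over \<open>n\<close>
  before \<open>k\<close>, each functional contributes at most \<open>C\<close> times its dual norm,
  with \<open>C\<close> from \<open>uniform_boundedness\<close>.\<close>

lemma nuclear_map_summable:
  assumes p: "p \<in> cs smul" and q: "q \<in> cs smul" and nuc: "nuclear_map smul q smul p id"
    and weak: "\<And>f. f \<in> topological_dual smul \<Longrightarrow> summable (\<lambda>n. norm (f (b n)))"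
  shows "summable (\<lambda>n. p (b n))"
proof -
  note ps = cs_seminorm[OF p] and qs = cs_seminorm[OF q]
  obtain f y where f: "\<And>k. f k \<in> seminorm_dual smul q"
    and summ: "summable (\<lambda>k. dual_seminorm q (f k) * p (y k))"
    and lim: "\<And>x. (\<lambda>M. p (x - (\<Sum>k<M. smul (f k x) (y k)))) \<longlonglongrightarrow> 0"
    using nuc unfolding nuclear_map_def by auto
  note D = dual_seminorm_bound[OF qs f]
  obtain C where C: "C \<ge> 0"
    "\<And>f N. clinear f \<Longrightarrow> (\<And>x. norm (f x) \<le> q x) \<Longrightarrow> (\<Sum>n<N. norm (f (b n))) \<le> C"
  proof (rule uniform_boundedness[OF qs])
    fix f assume "clinear f" "\<And>x. norm (f x) \<le> q x"
    then have "f \<in> topological_dual smul" using topological_dualI[OF q, of f 1] by simp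
    then show "summable (\<lambda>n. norm (f (b n)))" by (rule weak)
  qed blast
  have f_le: "(\<Sum>n<N. norm (f k (b n))) \<le> C * dual_seminorm q (f k)" for k N
  proof (cases "dual_seminorm q (f k) = 0")
    case True
    then have "f k x = 0" for x using D(1)[of k x] by simp
    then show ?thesis using True by simp
  next
    case False
    define d where "d = dual_seminorm q (f k)"
    have d: "d > 0" using False D(2)[of k] by (simp add: d_def)
    have "(\<Sum>n<N. norm (of_real (1 / d) * f k (b n))) \<le> C"
    proof (rule C(2))
      show "clinear (\<lambda>x. of_real (1 / d) * f k x)"
        using f[of k] by (intro clinear_scaled) (simp add: seminorm_dual_def)
      fix x show "norm (of_real (1 / d) * f k x) \<le> q x"
        using D(1)[of k x] d by (simp add: norm_mult norm_divide field_simps d_def)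
    qed
    then have "(\<Sum>n<N. norm (f k (b n))) / d \<le> C"
      using d by (simp add: norm_mult norm_divide sum_divide_distrib)
    then show ?thesis using d by (simp add: field_simps d_def)
  qed
  define T where "T = (\<Sum>k. dual_seminorm q (f k) * p (y k))"
  have bound: "(\<Sum>n<N. p (b n)) \<le> C * T" for N
  proof -
    let ?R = "\<lambda>M n. p (b n - (\<Sum>k<M. smul (f k (b n)) (y k)))"
    \<comment> \<open>The representation holds only in the limit, so \<open>N\<close> is kept fixed
      while the finitely many remainders vanish as \<open>M\<close> grows.\<close>
    have "(\<Sum>n<N. p (b n)) \<le> (\<Sum>n<N. ?R M n) + C * T" for M
    proof -
      have "p (b n) \<le> ?R M n + (\<Sum>k<M. norm (f k (b n)) * p (y k))" for n
      proof -
        have "p (b n) \<le> ?R M n + p (\<Sum>k<M. smul (f k (b n)) (y k))"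
          using seminorm_add[OF ps, of "b n - (\<Sum>k<M. smul (f k (b n)) (y k))"] by (metis diff_add_cancel)
        also have "p (\<Sum>k<M. smul (f k (b n)) (y k)) \<le> (\<Sum>k<M. norm (f k (b n)) * p (y k))"
          using seminorm_sum[OF ps, of "\<lambda>k. smul (f k (b n)) (y k)"] by (simp add: seminorm_scale[OF ps])
        finally show ?thesis by simp
      qed
      then have "(\<Sum>n<N. p (b n)) \<le> (\<Sum>n<N. ?R M n) + (\<Sum>n<N. \<Sum>k<M. norm (f k (b n)) * p (y k))"
        unfolding sum.distrib[symmetric] by (rule sum_mono)
      also have "(\<Sum>n<N. \<Sum>k<M. norm (f k (b n)) * p (y k)) = (\<Sum>k<M. (\<Sum>n<N. norm (f k (b n))) * p (y k))"
        by (subst sum.swap) (simp add: sum_distrib_right)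
      also have "\<dots> \<le> (\<Sum>k<M. C * (dual_seminorm q (f k) * p (y k)))"
        using mult_right_mono[OF f_le seminorm_nonneg[OF ps]] by (intro sum_mono) (simp add: mult.assoc)
      also have "\<dots> \<le> C * T"
        unfolding T_def sum_distrib_left[symmetric] using D(2) seminorm_nonneg[OF ps] C(1)
        by (intro mult_left_mono sum_le_suminf[OF summ]) auto
      finally show ?thesis by simp
    qed
    moreover have "(\<lambda>M. (\<Sum>n<N. ?R M n) + C * T) \<longlonglongrightarrow> (\<Sum>n<N. 0) + C * T"
      by (intro tendsto_intros lim)
    ultimately have "(\<Sum>n<N. p (b n)) \<le> (\<Sum>n<N. 0) + C * T" by (intro LIMSEQ_le_const) auto
    then show ?thesis by simp
  qed
  show ?thesis
    using bound seminorm_nonneg[OF ps] by (intro summableI_nonneg_bounded[of _ "C * T"])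
qed

lemma sigma_a_weak_ge: "f \<in> topological_dual smul \<Longrightarrow> sigma_a (*) (\<lambda>n. f (a n)) \<le> sigma_a_weak smul a"
  unfolding sigma_a_weak_def by (rule SUP_upper)

text \<open>The terms of a convergent series are weakly bounded, and two further powers of
  \<open>n\<close> make them weakly absolutely summable, at a point that does not depend on
  \<open>f\<close>. This excludes the difference \<infinity> - \<infinity> in
  \<open>gap_a\<close>.\<close>

lemma sigma_a_weak_less_top:
  assumes "sigma_c smul a < \<infinity>"
  shows "sigma_a_weak smul a < \<infinity>"
proof -
  obtain r where r: "\<And>s. Re s > r \<Longrightarrow> summable (dirichlet_term smul a s)"
    using assms unfolding sigma_c_def Inf_less_iff by auto
  define t where "t = r + 1"
  have summ: "summable (dirichlet_term smul a (of_real t))" by (rule r) (simp add: t_def)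
  have "sigma_a (*) (\<lambda>n. f (a n)) \<le> ereal (t + 2)" if f: "f \<in> topological_dual smul" for f
  proof -
    have lin: "clinear f" and cont: "continuous_on UNIV f" using f by (auto simp: topological_dual_def)
    obtain l where "(\<lambda>N. \<Sum>n<N. dirichlet_term smul a (of_real t) n) \<longlonglongrightarrow> l"
      using summ by (auto simp: summable_def sums_def)
    then have "(\<lambda>N. f (\<Sum>n<N. dirichlet_term smul a (of_real t) n)) \<longlonglongrightarrow> f l"
      using cont by (intro isCont_tendsto_compose[of l f]) (auto simp: continuous_on_eq_continuous_at)
    then have "summable (\<lambda>n. f (dirichlet_term smul a (of_real t) n))"
      by (auto simp: summable_def sums_def clinear_sum[OF lin])
    then have "Bseq (\<lambda>n. f (dirichlet_term smul a (of_real t) n))"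
      by (intro convergent_imp_Bseq) (auto simp: convergent_def dest: summable_LIMSEQ_zero)
    then obtain K where K: "\<And>n. norm (f (dirichlet_term smul a (of_real t) n)) \<le> K"
      by (auto simp: Bseq_def)
    have K': "norm (f (a n)) / real (Suc n) powr t \<le> K" for n
      using K[of n] seminorm_dirichlet_term[OF seminorm_norm_clinear[OF lin], of a "of_real t" n] by simp
    have "summable (\<lambda>n. norm (f (a n)) / real (Suc n) powr (t + 2))"
    proof (rule summable_comparison_test'[of "\<lambda>n. K / real (Suc n) ^ 2" 0])
      have "summable (\<lambda>n. 1 / real n ^ 2)"
        using inverse_power_summable[of 2, where 'a = real] by (simp add: inverse_eq_divide)
      then have "summable (\<lambda>n. K * (1 / real (Suc n) ^ 2))"
        by (subst (asm) summable_Suc_iff[symmetric]) (rule summable_mult)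
      then show "summable (\<lambda>n. K / real (Suc n) ^ 2)" by simp
      fix n :: nat
      have "real (Suc n) powr (t + 2) = real (Suc n) powr t * real (Suc n) ^ 2"
        by (simp add: powr_add flip: powr_numeral)
      then have "norm (f (a n)) / real (Suc n) powr (t + 2) = norm (f (a n)) / real (Suc n) powr t / real (Suc n) ^ 2"
        by simp
      also have "\<dots> \<le> K / real (Suc n) ^ 2" by (intro divide_right_mono K') simp
      finally show "norm (norm (f (a n)) / real (Suc n) powr (t + 2)) \<le> K / real (Suc n) ^ 2" by simp
    qed
    then show ?thesis by (rule sigma_a_complex_leI)
  qed
  then have "sigma_a_weak smul a \<le> ereal (t + 2)" unfolding sigma_a_weak_def by (rule SUP_least)
  then show ?thesis by (rule le_less_trans) simp
qed

lemma nuclear_sigma_a_le: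
  assumes "nuclear_space smul"
  shows "sigma_a smul a \<le> sigma_a_weak smul a"
proof (rule ccontr)
  assume "\<not> ?thesis"
  then obtain r where r: "sigma_a_weak smul a < ereal r" "ereal r < sigma_a smul a"
    using ereal_dense2 by (metis not_le)
  define b where "b n = dirichlet_term smul a (of_real r) n" for n
  have weak: "summable (\<lambda>n. norm (f (b n)))" if f: "f \<in> topological_dual smul" for f
  proof -
    have lin: "clinear f" using f by (simp add: topological_dual_def)
    have "sigma_a (*) (\<lambda>n. f (a n)) < ereal r" using sigma_a_weak_ge[OF f] r(1) by (rule le_less_trans)
    from sigma_a_less_imp_summable[OF this cs_complex_mult(1)]
    show ?thesis
      unfolding b_def using seminorm_dirichlet_term[OF seminorm_norm_clinear[OF lin], of a "of_real r"] by simp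
  qed
  have "summable (\<lambda>n. p (a n) / real (Suc n) powr r)" if p: "p \<in> cs smul" for p
  proof -
    obtain q where "q \<in> cs smul" "nuclear_map smul q smul p id"
      using assms p unfolding nuclear_space_def by blast
    then have "summable (\<lambda>n. p (b n))" using weak by (intro nuclear_map_summable[OF p])
    then show ?thesis
      using seminorm_dirichlet_term[OF cs_seminorm[OF p], of a "of_real r"] by (simp add: b_def)
  qed
  then have "sigma_a smul a \<le> ereal r" by (rule sigma_a_leI)
  then show False using r(2) by simp
qed

text \<open>Witnessed by the zero series: its abscissas are all -\<infinity>, and the convention in
  \<open>gap_a\<close> assigns it 0. It later forces \<delta> > 0.\<close>

lemma gap_a_nonneg: "0 \<le> gap_a smul"
proof -
  have "Inf (range ereal) = -\<infinity>" by (rule ereal_bot) (rule Inf_lower, simp)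
  moreover have "summable (\<lambda>n. dirichlet_term smul (\<lambda>_. 0) s n)" for s
    by (simp add: dirichlet_term_def)
  ultimately have "sigma_c smul (\<lambda>_. 0) = -\<infinity>" by (simp add: sigma_c_def)
  moreover have "sigma_a smul (\<lambda>_. 0) = -\<infinity>"
    by (rule ereal_bot) (rule sigma_a_leI, simp add: seminorm_0[OF cs_seminorm])
  moreover have "sigma_a_weak smul (\<lambda>_. 0) = -\<infinity>"
  proof (rule ereal_bot)
    fix r :: real
    show "sigma_a_weak smul (\<lambda>_. 0) \<le> ereal r" unfolding sigma_a_weak_def
      by (rule SUP_least, rule sigma_a_complex_leI) (auto simp: topological_dual_def clinear_0)
  qed
  ultimately show ?thesis unfolding gap_a_def by (intro SUP_upper2[of "\<lambda>_. 0"]) auto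
qed

lemma nuclear_imp_gap_a_eq_0:
  assumes "nuclear_space smul"
  shows "gap_a smul = 0"
proof (rule antisym)
  show "gap_a smul \<le> 0" unfolding gap_a_def
  proof (rule SUP_least)
    fix a assume "a \<in> {a. sigma_c smul a < \<infinity>}"
    then have "sigma_a_weak smul a < \<infinity>" by (intro sigma_a_weak_less_top) simp
    then show "(if sigma_a smul a = - \<infinity> \<and> sigma_a_weak smul a = - \<infinity> then 0
        else sigma_a smul a - sigma_a_weak smul a) \<le> 0"
      using nuclear_sigma_a_le[OF assms, of a]
      by (cases "sigma_a smul a"; cases "sigma_a_weak smul a") auto
  qed
qed (rule gap_a_nonneg)

end

section \<open>A summing property from a small gap\<close>

context complex_vector_space
begin

text \<open>Equivalently, the operator from m-dimensional l_infinity to \<open>X\<^sub>q\<close>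
  that sends the unit vectors to the \<open>b i\<close> has norm at most 1; dually, the weak l_1
  norm of \<open>b\<close> is at most 1.\<close>

definition unconditionally_bounded :: "('a \<Rightarrow> real) \<Rightarrow> nat \<Rightarrow> (nat \<Rightarrow> 'a) \<Rightarrow> bool" where
  "unconditionally_bounded q m b \<longleftrightarrow>
     (\<forall>\<epsilon>. (\<forall>i<m. norm (\<epsilon> i) \<le> 1) \<longrightarrow> q (\<Sum>i<m. smul (\<epsilon> i) (b i)) \<le> 1)"

text \<open>By the Dvoretzky-Rogers theorem, this holds with \<open>q = p\<close> and \<open>\<delta> < 1/2\<close> only if the space \<open>X\<^sub>p\<close>
  is finite-dimensional.\<close>

definition summing :: "real \<Rightarrow> real \<Rightarrow> ('a \<Rightarrow> real) \<Rightarrow> ('a \<Rightarrow> real) \<Rightarrow> bool" where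
  "summing \<delta> C p q \<longleftrightarrow> (\<forall>m b. unconditionally_bounded q m b \<longrightarrow>
     (\<Sum>i<m. p (b i) / real (Suc i) powr \<delta>) \<le> C)"

lemma unconditionally_bounded_functional:
  assumes "unconditionally_bounded q m b" "clinear f" "\<And>x. norm (f x) \<le> q x"
  shows "(\<Sum>i<m. norm (f (b i))) \<le> 1"
proof -
  \<comment> \<open>Phases that make the values \<open>f (b i)\<close> add up without
    cancellation.\<close>
  define \<epsilon> where "\<epsilon> i = (if f (b i) = 0 then 0 else cnj (f (b i)) / of_real (norm (f (b i))))" for i
  have "\<epsilon> i * f (b i) = of_real (norm (f (b i)))" for i
  proof (cases "f (b i) = 0")
    case False
    then have "\<epsilon> i * f (b i) = (f (b i) * cnj (f (b i))) / of_real (norm (f (b i)))" by (simp add: \<epsilon>_def)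
    also have "\<dots> = of_real ((norm (f (b i)))\<^sup>2) / of_real (norm (f (b i)))"
      by (simp only: complex_norm_square)
    finally show ?thesis using False by (simp add: power2_eq_square)
  qed simp
  then have "f (\<Sum>i<m. smul (\<epsilon> i) (b i)) = of_real (\<Sum>i<m. norm (f (b i)))"
    by (simp add: clinear_sum[OF assms(2)] clinear_scale[OF assms(2)])
  then have "(\<Sum>i<m. norm (f (b i))) = norm (f (\<Sum>i<m. smul (\<epsilon> i) (b i)))"
    by (simp add: sum_nonneg del: of_real_sum)
  also have "\<dots> \<le> q (\<Sum>i<m. smul (\<epsilon> i) (b i))" by (rule assms(3))
  also have "\<dots> \<le> 1"
    using assms(1) unfolding unconditionally_bounded_def
    by (elim allE[of _ \<epsilon>] impE) (auto simp: \<epsilon>_def norm_divide)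
  finally show ?thesis .
qed

lemma unconditionally_bounded_le_1:
  assumes "unconditionally_bounded q m b" "i < m"
  shows "q (b i) \<le> 1"
proof -
  have "(\<Sum>j<m. smul (if j = i then 1 else 0) (b j)) = (\<Sum>j<m. if j = i then b j else 0)"
    by (intro sum.cong) auto
  also have "\<dots> = b i" using assms(2) by simp
  finally have *: "(\<Sum>j<m. smul (if j = i then 1 else 0) (b j)) = b i" .
  have "q (\<Sum>j<m. smul (if j = i then 1 else 0) (b j)) \<le> 1"
    using assms(1)[unfolded unconditionally_bounded_def, THEN spec[of _ "\<lambda>j. if j = i then 1 else 0"]]
    by simp
  then show ?thesis unfolding * .
qed

end

lemma sum_lessThan_add: "(\<Sum>n<M + m. g n) = (\<Sum>n<M. g n) + (\<Sum>i<m. g (M + i))"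
  for m :: nat and g :: "nat \<Rightarrow> 'b::comm_monoid_add"
  by (induction m) (simp_all add: add.assoc)

context complex_lcs
begin

text \<open>If every \<open>R k\<close> fails, blocks that are unconditionally bounded for
  \<open>R k\<close>, scaled by \<open>1 / 2 ^ k\<close> and strung together, form a series of weak
  abscissa at most 0, because each functional is bounded by \<open>R k\<close> for all large
  \<open>k\<close>. The gap makes this series converge absolutely at \<delta>, although every block
  contributes at least 1 there under \<open>p\<close>.\<close>

lemma gap_less_imp_summing:
  assumes sc: "sequentially_complete TYPE('a)"
    and metr: "metrizable_space (euclidean :: 'a topology)"
    and gap: "gap_a smul < ereal \<delta>" and \<delta>: "\<delta> \<le> 1"
    and p: "p \<in> cs smul"
  obtains q C where "q \<in> cs smul" "\<And>x. p x \<le> q x" "summing \<delta> C p q"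
proof (rule ccontr)
  assume contra: "\<not> thesis"
  note ps = cs_seminorm[OF p]
  have "0 < ereal \<delta>" using gap_a_nonneg gap by (rule le_less_trans)
  then have \<delta>0: "\<delta> > 0" by simp
  obtain Q where Q: "\<And>k. Q k \<in> cs smul" "\<And>j k x. j \<le> k \<Longrightarrow> Q j x \<le> Q k x"
    "\<And>r. r \<in> cs smul \<Longrightarrow> \<exists>k::nat. \<forall>x. r x \<le> Q k x"
    using fundamental_seminorms[OF metr] by blast
  \<comment> \<open>Adding \<open>p\<close> puts every candidate above \<open>p\<close>, so that the
    negated claim applies to it.\<close>
  define R where "R k = (\<lambda>x. Q k x + p x)" for k
  have R: "R k \<in> cs smul" "p x \<le> R k x" "Q k x \<le> R k x" for k x
    unfolding R_def using cs_add[OF Q(1) p] seminorm_nonneg[OF ps, of x]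
      seminorm_nonneg[OF cs_seminorm[OF Q(1)], of k x] by auto
  have "\<exists>xs. unconditionally_bounded (R k) (length xs) (nth xs) \<and>
      (\<Sum>i<length xs. p (xs ! i) / real (Suc i) powr \<delta>) > C" for k C
  proof -
    have "\<not> summing \<delta> C p (R k)" using contra that[OF R(1)[of k] R(2)[of _ k], of C] by blast
    then obtain m b where mb: "unconditionally_bounded (R k) m b"
      "C < (\<Sum>i<m. p (b i) / real (Suc i) powr \<delta>)"
      by (auto simp: summing_def not_le)
    show ?thesis
      by (rule exI[of _ "map b [0..<m]"]) (use mb in \<open>auto simp: unconditionally_bounded_def\<close>)
  qed
  then obtain X where X: "\<And>k C. unconditionally_bounded (R k) (length (X k C)) (nth (X k C))"
    "\<And>k C. (\<Sum>i<length (X k C). p (X k C ! i) / real (Suc i) powr \<delta>) > C" by metis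
  \<comment> \<open>The target for the next block covers what will be lost: \<open>2 ^ k\<close> by
    scaling, and \<open>1 + length l\<close> because the block is placed after the entries of
    \<open>l\<close>, where the weights are smaller.\<close>
  define L where "L = rec_nat [] (\<lambda>k l. l @ map (smul (1 / 2 ^ k)) (X k (2 ^ k * (1 + real (length l)))))"
  define B where "B k = X k (2 ^ k * (1 + real (length (L k))))" for k
  define M where "M k = length (L k)" for k
  define m where "m k = length (B k)" for k
  have L0: "L 0 = []" and LS: "L (Suc k) = L k @ map (smul (1 / 2 ^ k)) (B k)" for k
    by (simp_all add: L_def B_def)
  have M0: "M 0 = 0" and MS: "M (Suc k) = M k + m k" for k by (simp_all add: M_def L0 LS m_def)
  have Bunc: "unconditionally_bounded (R k) (m k) (nth (B k))" for k
    unfolding B_def m_def by (rule X)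
  have Bbig: "2 ^ k * (1 + real (M k)) < (\<Sum>i<m k. p (B k ! i) / real (Suc i) powr \<delta>)" for k
    unfolding B_def m_def M_def by (rule X)
  have m_pos: "m k > 0" for k
  proof (rule ccontr)
    assume "\<not> m k > 0"
    then have "2 ^ k * (1 + real (M k)) < 0" using Bbig[of k] by simp
    moreover have "0 \<le> 2 ^ k * (1 + real (M k))" by simp
    ultimately show False by linarith
  qed
  have M_ge: "k \<le> M k" for k
  proof (induction k)
    case (Suc k)
    then show ?case using m_pos[of k] by (simp add: MS)
  qed simp
  have pre: "\<exists>zs. L (j + d) = L j @ zs" for j d
    by (induction d) (auto simp: LS)
  \<comment> \<open>Every block is nonempty, so \<open>L (Suc n)\<close> has more than
    \<open>n\<close> entries, and later lists only extend it.\<close>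
  define a where "a n = L (Suc n) ! n" for n
  have a_eq: "a n = L k ! n" if "n < M k" for n k
  proof -
    have n: "n < length (L (Suc n))" using M_ge[of "Suc n"] by (simp add: M_def)
    show ?thesis
    proof (cases "k \<le> Suc n")
      case True
      then obtain zs where "L (Suc n) = L k @ zs" using pre[of k "Suc n - k"] by auto
      then show ?thesis using that by (simp add: a_def M_def nth_append)
    next
      case False
      then obtain zs where "L k = L (Suc n) @ zs" using pre[of "Suc n" "k - Suc n"] by auto
      then show ?thesis using n by (simp add: a_def nth_append)
    qed
  qed
  have a_block: "a (M k + i) = smul (1 / 2 ^ k) (B k ! i)" if "i < m k" for k i
  proof -
    have "a (M k + i) = L (Suc k) ! (M k + i)" using that by (intro a_eq) (simp add: MS)
    also have "\<dots> = smul (1 / 2 ^ k) (B k ! i)" using that by (simp add: LS M_def m_def nth_append)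
    finally show ?thesis .
  qed
  have blocks: "(\<Sum>n<M K. g n) = (\<Sum>k<K. \<Sum>i<m k. g (M k + i))" for K and g :: "nat \<Rightarrow> real"
    by (induction K) (simp_all add: M0 MS sum_lessThan_add)
  have semi_a: "r (a (M k + i)) = r (B k ! i) / 2 ^ k" if "i < m k" "seminorm smul r" for r k i
    using that by (simp add: a_block seminorm_scale norm_divide norm_power)
  have weak: "summable (\<lambda>n. norm (f (a n)))" if f: "f \<in> topological_dual smul" for f
  proof -
    have lin: "clinear f" using f by (simp add: topological_dual_def)
    obtain k0 where k0: "\<And>x. norm (f x) \<le> Q k0 x" using Q(3)[OF dual_cs[OF f]] by blast
    define W where "W k = (\<Sum>i<m k. norm (f (a (M k + i))))" for k
    have W_nn: "0 \<le> W k" for k unfolding W_def by (intro sum_nonneg) simp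
    have W_le: "W k \<le> (1/2) ^ k" if "k0 \<le> k" for k
    proof -
      have "norm (f x) \<le> R k x" for x using k0[of x] Q(2)[OF that, of x] R(3)[of k x] by linarith
      then have "(\<Sum>i<m k. norm (f (B k ! i))) \<le> 1"
        by (intro unconditionally_bounded_functional[OF Bunc lin])
      moreover have "W k = (\<Sum>i<m k. norm (f (B k ! i))) / 2 ^ k"
        unfolding W_def sum_divide_distrib
        by (intro sum.cong refl semi_a[OF _ seminorm_norm_clinear[OF lin]]) simp
      ultimately show ?thesis by (simp add: power_divide divide_right_mono)
    qed
    have "(\<Sum>n<N. norm (f (a n))) \<le> (\<Sum>k<k0. W k) + 2" for N
    proof -
      have "(\<Sum>n<N. norm (f (a n))) \<le> (\<Sum>n<M N. norm (f (a n)))"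
        using M_ge by (intro sum_mono2) auto
      also have "\<dots> = (\<Sum>k<N. W k)" unfolding blocks W_def ..
      also have "\<dots> \<le> (\<Sum>k<N. (if k < k0 then W k else 0) + (1/2) ^ k)"
        using W_le by (intro sum_mono) auto
      also have "\<dots> = (\<Sum>k<N. if k < k0 then W k else 0) + (\<Sum>k<N. (1/2) ^ k)"
        by (rule sum.distrib)
      also have "(\<Sum>k<N. if k < k0 then W k else 0) = (\<Sum>k\<in>{..<N} \<inter> {..<k0}. W k)"
        by (simp add: sum.If_cases Collect_conj_eq lessThan_def)
      also have "\<dots> \<le> (\<Sum>k<k0. W k)" using W_nn by (intro sum_mono2) auto
      also have "(\<Sum>k<N. (1/2 :: real) ^ k) \<le> (\<Sum>k. (1/2) ^ k)"
        by (intro sum_le_suminf summable_geometric) auto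
      also have "\<dots> = 2" by (subst suminf_geometric) auto
      finally show ?thesis by simp
    qed
    then show ?thesis by (intro summableI_nonneg_bounded) auto
  qed
  have bounded: "\<exists>K. \<forall>n. r (a n) \<le> K" if r: "r \<in> cs smul" for r
  proof -
    note rs = cs_seminorm[OF r]
    obtain k0 where k0: "\<And>x. r x \<le> Q k0 x" using Q(3)[OF r] by blast
    have "r (a n) \<le> (\<Sum>n<M k0. r (a n)) + 1" for n
    proof (cases "n < M k0")
      case True
      then have "r (a n) \<le> (\<Sum>n<M k0. r (a n))"
        using seminorm_nonneg[OF rs] by (intro member_le_sum) auto
      then show ?thesis by simp
    next
      case False
      have "n < M (Suc n)" using M_ge[of "Suc n"] by simp
      then obtain k where k: "n < M (Suc k)" "\<And>j. j < k \<Longrightarrow> \<not> n < M (Suc j)"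
        using exists_least_iff[of "\<lambda>k. n < M (Suc k)"] by blast
      have Mk: "M k \<le> n" using k(2)[of "k - 1"] by (cases k) (auto simp: M0)
      have mono: "M i \<le> M j" if "i \<le> j" for i j
        by (rule lift_Suc_mono_le[OF _ that]) (simp add: MS)
      have "k0 \<le> k"
      proof (rule ccontr)
        assume "\<not> k0 \<le> k"
        then have "M (Suc k) \<le> M k0" by (intro mono) simp
        then show False using False k(1) by simp
      qed
      define i where "i = n - M k"
      have i: "i < m k" "n = M k + i" using k(1) Mk by (auto simp: i_def MS)
      have "r (a n) = r (B k ! i) / 2 ^ k" unfolding i(2) by (rule semi_a[OF i(1) rs])
      also have "\<dots> \<le> r (B k ! i) / 1" by (intro divide_left_mono) (auto simp: seminorm_nonneg[OF rs])
      also have "\<dots> \<le> R k (B k ! i)"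
        using k0[of "B k ! i"] Q(2)[OF \<open>k0 \<le> k\<close>, of "B k ! i"] R(3)[of k "B k ! i"] by simp
      also have "\<dots> \<le> 1" by (rule unconditionally_bounded_le_1[OF Bunc i(1)])
      also have "\<dots> \<le> (\<Sum>n<M k0. r (a n)) + 1" by (simp add: sum_nonneg seminorm_nonneg[OF rs])
      finally show ?thesis .
    qed
    then show ?thesis by blast
  qed
  \<comment> \<open>Boundedness of the coefficients gives convergence to the right of 1, which
    places the series among those that the gap takes into account.\<close>
  have conv: "summable (dirichlet_term smul a s)" if s: "Re s > 1" for s
  proof (rule summable_of_abs_convergent[OF sc])
    fix r assume r: "r \<in> cs smul"
    note rs = cs_seminorm[OF r]
    obtain K where K: "\<And>n. r (a n) \<le> K" using bounded[OF r] by blast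
    show "summable (\<lambda>n. r (dirichlet_term smul a s n))"
    proof (rule summable_comparison_test'[of "\<lambda>n. K * real (Suc n) powr (- Re s)" 0])
      have "summable (\<lambda>n. real n powr (- Re s))" using s by (simp add: summable_real_powr_iff)
      then show "summable (\<lambda>n. K * real (Suc n) powr (- Re s))"
        by (subst (asm) summable_Suc_iff[symmetric]) (rule summable_mult)
      fix n :: nat
      show "norm (r (dirichlet_term smul a s n)) \<le> K * real (Suc n) powr (- Re s)"
        unfolding seminorm_dirichlet_term[OF rs] using K[of n] seminorm_nonneg[OF rs, of "a n"]
        by (simp add: powr_minus_divide divide_right_mono)
    qed
  qed
  have "sigma_c smul a \<le> ereal 1"
    unfolding sigma_c_def by (rule Inf_lower) (use conv in auto)
  then have "sigma_c smul a < \<infinity>" by (rule le_less_trans) simp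
  then have "(if sigma_a smul a = -\<infinity> \<and> sigma_a_weak smul a = -\<infinity> then 0
      else sigma_a smul a - sigma_a_weak smul a) \<le> gap_a smul"
    unfolding gap_a_def by (intro SUP_upper) simp
  then have *: "(if sigma_a smul a = -\<infinity> \<and> sigma_a_weak smul a = -\<infinity> then 0
      else sigma_a smul a - sigma_a_weak smul a) < ereal \<delta>"
    using gap by (rule le_less_trans)
  have "sigma_a_weak smul a \<le> ereal 0"
    unfolding sigma_a_weak_def
  proof (rule SUP_least, rule sigma_a_complex_leI)
    fix f assume "f \<in> topological_dual smul"
    then show "summable (\<lambda>n. norm (f (a n)) / real (Suc n) powr 0)" using weak by simp
  qed
  \<comment> \<open>If the weak abscissa is -\<infinity>, any larger \<open>sigma_a\<close> would
    make the difference \<infinity>; otherwise subtracting a nonpositive number can only enlarge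
    \<open>sigma_a\<close>.\<close>
  then have "sigma_a smul a < ereal \<delta>"
    using * \<delta>0 by (cases "sigma_a smul a"; cases "sigma_a_weak smul a") (auto split: if_splits)
  from sigma_a_less_imp_summable[OF this p]
  have summ: "summable (\<lambda>n. p (a n) / real (Suc n) powr \<delta>)" .
  have block: "1 \<le> (\<Sum>i<m k. p (a (M k + i)) / real (Suc (M k + i)) powr \<delta>)" for k
  proof -
    have "1 = 2 ^ k * (1 + real (M k)) / (2 ^ k * (1 + real (M k)))" by (simp add: add_nonneg_eq_0_iff)
    also have "\<dots> \<le> (\<Sum>i<m k. p (B k ! i) / real (Suc i) powr \<delta>) / (2 ^ k * (1 + real (M k)))"
      using Bbig[of k] by (intro divide_right_mono) auto
    also have "\<dots> = (\<Sum>i<m k. p (B k ! i) / real (Suc i) powr \<delta> / (2 ^ k * (1 + real (M k))))"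
      by (rule sum_divide_distrib)
    also have "\<dots> \<le> (\<Sum>i<m k. p (a (M k + i)) / real (Suc (M k + i)) powr \<delta>)"
    proof (rule sum_mono)
      fix i assume "i \<in> {..<m k}"
      then have i: "i < m k" by simp
      \<comment> \<open>The shift costs at most \<open>(1 + M k) powr \<delta>\<close>, which
        \<delta> \<le> 1 bounds by the factor reserved in the choice of \<open>L\<close>.\<close>
      have "real (Suc (M k + i)) powr \<delta> \<le> (real (Suc i) * (1 + real (M k))) powr \<delta>"
        using \<delta>0 by (intro powr_mono2) (auto simp: algebra_simps)
      also have "\<dots> = real (Suc i) powr \<delta> * (1 + real (M k)) powr \<delta>" by (rule powr_mult)
      also have "(1 + real (M k)) powr \<delta> \<le> (1 + real (M k)) powr 1" using \<delta> by (intro powr_mono) auto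
      finally have "real (Suc (M k + i)) powr \<delta> \<le> real (Suc i) powr \<delta> * (1 + real (M k))"
        by (simp add: mult_left_mono)
      then have "p (B k ! i) / 2 ^ k / (real (Suc i) powr \<delta> * (1 + real (M k))) \<le>
          p (B k ! i) / 2 ^ k / real (Suc (M k + i)) powr \<delta>"
        using seminorm_nonneg[OF ps] by (intro divide_left_mono) auto
      then show "p (B k ! i) / real (Suc i) powr \<delta> / (2 ^ k * (1 + real (M k))) \<le>
          p (a (M k + i)) / real (Suc (M k + i)) powr \<delta>"
        unfolding semi_a[OF i ps] by (simp add: mult_ac)
    qed
    finally show ?thesis .
  qed
  obtain K :: nat where K: "(\<Sum>n. p (a n) / real (Suc n) powr \<delta>) < real K" using reals_Archimedean2 by blast
  have "real K = (\<Sum>k<K. 1)" by simp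
  also have "\<dots> \<le> (\<Sum>k<K. \<Sum>i<m k. p (a (M k + i)) / real (Suc (M k + i)) powr \<delta>)"
    by (intro sum_mono block)
  also have "\<dots> = (\<Sum>n<M K. p (a n) / real (Suc n) powr \<delta>)" by (rule blocks[symmetric])
  also have "\<dots> \<le> (\<Sum>n. p (a n) / real (Suc n) powr \<delta>)"
    using seminorm_nonneg[OF ps] by (intro sum_le_suminf[OF summ]) auto
  finally show False using K by simp
qed

end

section \<open>Decay of Weyl numbers\<close>

definition ip :: "nat \<Rightarrow> (nat \<Rightarrow> complex) \<Rightarrow> (nat \<Rightarrow> complex) \<Rightarrow> complex" where
  "ip n s t = (\<Sum>l<n. s l * cnj (t l))"

definition l2norm :: "nat \<Rightarrow> (nat \<Rightarrow> complex) \<Rightarrow> real" where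
  "l2norm n t = L2_set (\<lambda>l. norm (t l)) {..<n}"

text \<open>A vector is given by the first \<open>n\<close> values of a function and a system by its
  first \<open>K\<close> members, so the dimension stays a variable and a system grows by function
  update.\<close>

definition orthonormal :: "nat \<Rightarrow> (nat \<Rightarrow> nat \<Rightarrow> complex) \<Rightarrow> nat \<Rightarrow> bool" where
  "orthonormal n e K \<longleftrightarrow> (\<forall>i<K. \<forall>j<K. ip n (e i) (e j) = (if i = j then 1 else 0))"

definition perp :: "nat \<Rightarrow> (nat \<Rightarrow> nat \<Rightarrow> complex) \<Rightarrow> nat \<Rightarrow> (nat \<Rightarrow> complex) \<Rightarrow> bool" where
  "perp n e K t \<longleftrightarrow> (\<forall>i<K. ip n t (e i) = 0)"

lemma ip_cnj: "ip n s t = cnj (ip n t s)"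
  by (simp add: ip_def mult.commute)

lemma ip_scale_left: "ip n (\<lambda>l. c * s l) t = c * ip n s t"
  by (simp add: ip_def sum_distrib_left mult.assoc)

lemma ip_sum_left: "ip n (\<lambda>l. \<Sum>i\<in>I. s i l) t = (\<Sum>i\<in>I. ip n (s i) t)"
  by (simp add: ip_def sum_distrib_right sum.swap[of _ I])

lemma ip_self: "ip n t t = of_real ((l2norm n t)\<^sup>2)"
proof -
  have "(l2norm n t)\<^sup>2 = (\<Sum>l<n. (norm (t l))\<^sup>2)"
    unfolding l2norm_def L2_set_def by (rule real_sqrt_pow2) (simp add: sum_nonneg)
  then show ?thesis unfolding ip_def by (simp flip: complex_norm_square)
qed

lemma l2norm_nonneg [simp]: "0 \<le> l2norm n t"
  by (simp add: l2norm_def)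

lemma l2norm_scale: "l2norm n (\<lambda>l. c * t l) = norm c * l2norm n t"
  by (simp add: l2norm_def norm_mult L2_set_right_distrib)

lemma l2norm_eq_0_iff: "l2norm n t = 0 \<longleftrightarrow> (\<forall>l<n. t l = 0)"
  by (auto simp: l2norm_def L2_set_eq_0_iff)

lemma sum_norm_le_l2norm: "(\<Sum>l<n. norm (t l)) \<le> sqrt n * l2norm n t"
  using L2_set_mult_ineq[of "\<lambda>_. 1" "\<lambda>l. norm (t l)" "{..<n}"]
  by (simp add: l2norm_def L2_set_constant)

lemma perp_scale: "perp n e K t \<Longrightarrow> perp n e K (\<lambda>l. c * t l)"
  by (simp add: perp_def ip_scale_left)

lemma orthonormal_extend:
  assumes "orthonormal n e K" "perp n e K t" "ip n t t = 1"
  shows "orthonormal n (e(K := t)) (Suc K)"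
proof -
  have "ip n (e i) t = 0" if "i < K" for i
    using assms(2) that ip_cnj[of n "e i" t] by (simp add: perp_def)
  then show ?thesis
    using assms by (auto simp: orthonormal_def perp_def less_Suc_eq)
qed

text \<open>The \<open>t l\<close> are the residuals of the unit vectors after projection onto the
  span of \<open>e\<close>. If all their diagonal entries vanished, the projection, of trace
  \<open>K\<close>, would have trace \<open>n\<close>.\<close>

lemma exists_nonzero_perp:
  assumes e: "orthonormal n e K" and "K < n"
  shows "\<exists>t. perp n e K t \<and> l2norm n t > 0"
proof -
  define t where "t l j = (if j = l then 1 else 0) - (\<Sum>i<K. cnj (e i l) * e i j)" for l j
  have perp: "perp n e K (t l)" if "l < n" for l
    unfolding perp_def
  proof (intro allI impI)
    fix i assume i: "i < K"
    have "ip n (t l) (e i) = (\<Sum>j<n. (if j = l then 1 else 0) * cnj (e i j)) -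
        ip n (\<lambda>j. \<Sum>i<K. cnj (e i l) * e i j) (e i)"
      by (simp only: ip_def t_def left_diff_distrib sum_subtractf)
    also have "(\<Sum>j<n. (if j = l then 1 else 0) * cnj (e i j)) = (\<Sum>j<n. if j = l then cnj (e i j) else 0)"
      by (intro sum.cong) auto
    also have "\<dots> = cnj (e i l)" using that by simp
    also have "ip n (\<lambda>j. \<Sum>i<K. cnj (e i l) * e i j) (e i) = (\<Sum>k<K. cnj (e k l) * ip n (e k) (e i))"
      by (simp add: ip_sum_left ip_scale_left)
    also have "\<dots> = (\<Sum>k<K. if k = i then cnj (e k l) else 0)"
      using e i by (intro sum.cong) (auto simp: orthonormal_def)
    also have "\<dots> = cnj (e i l)" using i by simp
    finally show "ip n (t l) (e i) = 0" by simp
  qed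
  have "\<exists>l<n. t l l \<noteq> 0"
  proof (rule ccontr)
    assume "\<not> (\<exists>l<n. t l l \<noteq> 0)"
    then have "(\<Sum>i<K. cnj (e i l) * e i l) = 1" if "l < n" for l using that by (simp add: t_def)
    then have "(\<Sum>l<n. \<Sum>i<K. cnj (e i l) * e i l) = of_nat n" by simp
    moreover have "(\<Sum>l<n. \<Sum>i<K. cnj (e i l) * e i l) = (\<Sum>i<K. ip n (e i) (e i))"
      by (subst sum.swap) (simp add: ip_def mult.commute)
    moreover have "\<dots> = of_nat K" using e by (simp add: orthonormal_def)
    ultimately show False using \<open>K < n\<close> by (metis of_nat_eq_iff less_irrefl)
  qed
  then obtain l where l: "l < n" "t l l \<noteq> 0" by blast
  then have "l2norm n (t l) > 0"
    using l2norm_eq_0_iff[of n "t l"] l2norm_nonneg[of n "t l"] by (metis less_eq_real_def)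
  then show ?thesis using perp[OF l(1)] by blast
qed

text \<open>Induction on the number of vectors adjoined. With \<open>R\<close> meaning large under a
  seminorm, the first case is the one to be refuted, and the second yields a complement of small
  codimension on which the seminorm is small.\<close>

lemma orthonormal_greedy:
  assumes e: "orthonormal n e K"
  shows "(\<exists>e'. (\<forall>i<K. e' i = e i) \<and> orthonormal n e' (K + k) \<and> (\<forall>i<k. R (e' (K + i)))) \<or>
    (\<exists>e' k'. k' < k \<and> orthonormal n e' (K + k') \<and> (\<forall>t. perp n e' (K + k') t \<and> ip n t t = 1 \<longrightarrow> \<not> R t))"
proof (induction k)
  case 0
  show ?case using e by (intro disjI1 exI[of _ e]) simp
next
  case (Suc k)
  then show ?case
  proof
    assume "\<exists>e'. (\<forall>i<K. e' i = e i) \<and> orthonormal n e' (K + k) \<and> (\<forall>i<k. R (e' (K + i)))"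
    then obtain e' where e': "\<And>i. i < K \<Longrightarrow> e' i = e i" "orthonormal n e' (K + k)"
      "\<And>i. i < k \<Longrightarrow> R (e' (K + i))" by blast
    show ?thesis
    proof (cases "\<exists>t. perp n e' (K + k) t \<and> ip n t t = 1 \<and> R t")
      case True
      then obtain t where t: "perp n e' (K + k) t" "ip n t t = 1" "R t" by blast
      have "orthonormal n (e'(K + k := t)) (K + Suc k)"
        using orthonormal_extend[OF e'(2) t(1,2)] by simp
      moreover have "\<forall>i<K. (e'(K + k := t)) i = e i" "\<forall>i<Suc k. R ((e'(K + k := t)) (K + i))"
        using e' t by (auto simp: less_Suc_eq)
      ultimately show ?thesis by blast
    next
      case False
      then show ?thesis using e'(2) by (intro disjI2 exI[of _ e'] exI[of _ k]) auto
    qed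
  next
    assume "\<exists>e' k'. k' < k \<and> orthonormal n e' (K + k') \<and> (\<forall>t. perp n e' (K + k') t \<and> ip n t t = 1 \<longrightarrow> \<not> R t)"
    then show ?thesis by (metis less_SucI)
  qed
qed

section \<open>Operators on Hilbert space and their decay under composition\<close>

context complex_vector_space
begin

definition lincomb :: "nat \<Rightarrow> (nat \<Rightarrow> 'a) \<Rightarrow> (nat \<Rightarrow> complex) \<Rightarrow> 'a" where
  "lincomb n x t = (\<Sum>l<n. smul (t l) (x l))"

lemma lincomb_scale: "lincomb n x (\<lambda>l. c * t l) = smul c (lincomb n x t)"
  by (simp add: lincomb_def scale_sum_right)

lemma lincomb_sum: "lincomb n x (\<lambda>l. \<Sum>i\<in>I. t i l) = (\<Sum>i\<in>I. lincomb n x (t i))"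
  by (simp add: lincomb_def scale_sum_left sum.swap[of _ I])

lemma lincomb_bound:
  assumes "seminorm smul q" "\<And>l. l < n \<Longrightarrow> q (x l) \<le> 1"
  shows "q (lincomb n x t) \<le> sqrt n * l2norm n t"
proof -
  have "q (lincomb n x t) \<le> (\<Sum>l<n. q (smul (t l) (x l)))"
    unfolding lincomb_def by (rule seminorm_sum[OF assms(1)])
  also have "\<dots> \<le> (\<Sum>l<n. norm (t l))"
    using assms by (intro sum_mono) (auto simp: seminorm_scale intro: mult_left_le)
  also have "\<dots> \<le> sqrt n * l2norm n t" by (rule sum_norm_le_l2norm)
  finally show ?thesis .
qed

text \<open>If more than \<open>k\<close> orthonormal vectors stayed large under \<open>p\<close>, they would form, after
  normalisation, an unconditionally bounded family contradicting \<open>summing\<close>.\<close>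

lemma summing_step:
  assumes p: "seminorm smul p" and q: "seminorm smul q" and s: "summing \<delta> C p q" and C: "C > 0"
    and \<delta>: "\<delta> \<ge> 0" and e: "orthonormal n e K" and c: "c > 0" and k: "k \<ge> 1"
    and bound: "\<And>t. perp n e K t \<Longrightarrow> q (lincomb n x t) \<le> c * l2norm n t"
  shows "\<exists>e' K'. K' \<le> K + k \<and> orthonormal n e' K' \<and>
    (\<forall>t. perp n e' K' t \<longrightarrow> p (lincomb n x t) \<le> C * c * real k powr (\<delta> - 1/2) * l2norm n t)"
proof -
  \<comment> \<open>Chosen so that \<open>k\<close> vectors of size
    \<open>\<theta> / (c * sqrt k)\<close>, each with weight \<open>1 / k powr \<delta>\<close>, sum
    to exactly \<open>C\<close>; strictly larger ones contradict \<open>summing\<close>.\<close>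
  define \<theta> where "\<theta> = C * c * real k powr (\<delta> - 1/2)"
  have \<theta>: "\<theta> > 0" using C c k by (simp add: \<theta>_def)
  from orthonormal_greedy[OF e, of k "\<lambda>t. p (lincomb n x t) > \<theta>"]
  consider (1) e' where "\<And>i. i < K \<Longrightarrow> e' i = e i" "orthonormal n e' (K + k)"
      "\<And>i. i < k \<Longrightarrow> p (lincomb n x (e' (K + i))) > \<theta>"
    | (2) e' k' where "k' < k" "orthonormal n e' (K + k')"
      "\<And>t. perp n e' (K + k') t \<Longrightarrow> ip n t t = 1 \<Longrightarrow> \<not> p (lincomb n x t) > \<theta>"
    by blast
  then show ?thesis
  proof cases
    case 1
    \<comment> \<open>Combinations of \<open>k\<close> orthonormal vectors with coefficients in the
      unit disc have norm at most \<open>sqrt k\<close>.\<close>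
    define d where "d = c * sqrt k"
    have d: "d > 0" using c k by (simp add: d_def)
    define b where "b i = smul (of_real (1 / d)) (lincomb n x (e' (K + i)))" for i
    have "unconditionally_bounded q k b" unfolding unconditionally_bounded_def
    proof (intro allI impI)
      fix \<epsilon> :: "nat \<Rightarrow> complex" assume \<epsilon>: "\<forall>i<k. norm (\<epsilon> i) \<le> 1"
      define u where "u l = (\<Sum>i<k. \<epsilon> i * e' (K + i) l)" for l
      have ip_u: "ip n u t = (\<Sum>i<k. \<epsilon> i * ip n (e' (K + i)) t)" for t
        unfolding u_def by (simp add: ip_sum_left ip_scale_left)
      have perp: "perp n e K u" unfolding perp_def
      proof (intro allI impI)
        fix j assume j: "j < K"
        have "ip n (e' (K + i)) (e j) = 0" if "i < k" for i
          using 1(1)[OF j, symmetric] 1(2) that j by (simp add: orthonormal_def)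
        then show "ip n u (e j) = 0" by (simp add: ip_u)
      qed
      have "ip n (e' (K + i)) u = cnj (\<epsilon> i)" if i: "i < k" for i
      proof -
        have "ip n u (e' (K + i)) = (\<Sum>j<k. if j = i then \<epsilon> j else 0)"
          unfolding ip_u using 1(2) i by (intro sum.cong) (auto simp: orthonormal_def)
        then have "ip n u (e' (K + i)) = \<epsilon> i" using i by simp
        then show ?thesis by (subst ip_cnj) simp
      qed
      then have "ip n u u = (\<Sum>i<k. \<epsilon> i * cnj (\<epsilon> i))" by (simp add: ip_u[of u])
      also have "\<dots> = of_real (\<Sum>i<k. (norm (\<epsilon> i))\<^sup>2)" by (simp flip: complex_norm_square)
      finally have "(l2norm n u)\<^sup>2 = (\<Sum>i<k. (norm (\<epsilon> i))\<^sup>2)"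
        unfolding ip_self by (simp only: of_real_eq_iff)
      also have "\<dots> \<le> (\<Sum>i<k. 1)" using \<epsilon> by (intro sum_mono) (simp add: power_le_one)
      finally have "l2norm n u \<le> sqrt k" by (intro real_le_rsqrt) simp
      then have "q (lincomb n x u) \<le> d"
        unfolding d_def
        by (intro order_trans[OF bound[OF perp]] mult_left_mono less_imp_le[OF c])
      have "(\<Sum>i<k. smul (\<epsilon> i) (b i)) = smul (of_real (1 / d)) (lincomb n x u)"
        unfolding b_def u_def lincomb_sum by (simp add: lincomb_scale scale_sum_right mult.commute)
      then have "q (\<Sum>i<k. smul (\<epsilon> i) (b i)) = q (lincomb n x u) / d"
        using d by (simp add: seminorm_scale[OF q] norm_divide)
      then show "q (\<Sum>i<k. smul (\<epsilon> i) (b i)) \<le> 1"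
        using \<open>q (lincomb n x u) \<le> d\<close> d by simp
    qed
    then have le: "(\<Sum>i<k. p (b i) / real (Suc i) powr \<delta>) \<le> C" using s by (simp add: summing_def)
    have "C = (\<Sum>i<k. \<theta> / d / real k powr \<delta>)"
    proof -
      have "real k powr (\<delta> - 1/2) = real k powr \<delta> / sqrt k"
        using k by (simp add: powr_diff powr_half_sqrt)
      then have "\<theta> = C * c * (real k powr \<delta> / sqrt k)" by (simp add: \<theta>_def)
      then have "\<theta> / d / real k powr \<delta> = C / (sqrt k * sqrt k)"
        using c k by (simp add: d_def)
      then show ?thesis using k by simp
    qed
    also have "\<dots> < (\<Sum>i<k. p (b i) / real (Suc i) powr \<delta>)"
    proof (rule sum_strict_mono)
      fix i assume "i \<in> {..<k}"
      then have i: "i < k" by simp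
      have "p (b i) = p (lincomb n x (e' (K + i))) / d"
        using d by (simp add: b_def seminorm_scale[OF p] norm_divide)
      then have "\<theta> / d < p (b i)" using 1(3)[OF i] d by (simp add: divide_strict_right_mono)
      moreover have "real (Suc i) powr \<delta> \<le> real k powr \<delta>" using i \<delta> by (intro powr_mono2) auto
      ultimately show "\<theta> / d / real k powr \<delta> < p (b i) / real (Suc i) powr \<delta>"
        using \<theta> d by (intro frac_less) auto
    qed (use k in \<open>auto simp: lessThan_empty_iff\<close>)
    finally show ?thesis using le by simp
  next
    case 2
    have "p (lincomb n x t) \<le> \<theta> * l2norm n t" if t: "perp n e' (K + k') t" for t
    proof (cases "l2norm n t = 0")
      case True
      then have "lincomb n x t = 0" by (simp add: lincomb_def l2norm_eq_0_iff)
      then show ?thesis using True by (simp add: seminorm_0[OF p])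
    next
      case False
      define r where "r = l2norm n t"
      have r: "r > 0" using False l2norm_nonneg[of n t] unfolding r_def by linarith
      have "l2norm n (\<lambda>l. of_real (1 / r) * t l) = 1"
        using r by (simp only: l2norm_scale r_def[symmetric]) (simp add: norm_divide)
      then have "ip n (\<lambda>l. of_real (1 / r) * t l) (\<lambda>l. of_real (1 / r) * t l) = 1" by (simp add: ip_self)
      from 2(3)[OF perp_scale[OF t] this] have "p (lincomb n x t) / r \<le> \<theta>"
        using r unfolding lincomb_scale seminorm_scale[OF p] by (simp add: norm_divide not_less)
      then show ?thesis using r by (simp add: r_def field_simps)
    qed
    then show ?thesis
      using 2(1,2) by (intro exI[of _ e'] exI[of _ "K + k'"]) (auto simp: \<theta>_def)
  qed
qed

text \<open>The orthonormal systems and \<open>lincomb\<close> describe the operators \<open>\<ell>\<^sub>2\<^sup>n \<rightarrow> X\<^sub>q\<close> in the definition of the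
  Weyl numbers of \<open>X\<^sub>q \<rightarrow> X\<^sub>p\<close>. Unlike in the \<open>summing\<close> property, exponents add up under composition.\<close>

definition weyl_decay :: "real \<Rightarrow> nat \<Rightarrow> ('a \<Rightarrow> real) \<Rightarrow> ('a \<Rightarrow> real) \<Rightarrow> bool" where
  "weyl_decay \<delta> m p q \<longleftrightarrow> (\<exists>G>0. \<forall>n x e K c k. orthonormal n e K \<longrightarrow> c > 0 \<longrightarrow> k \<ge> 1 \<longrightarrow>
     (\<forall>t. perp n e K t \<longrightarrow> q (lincomb n x t) \<le> c * l2norm n t) \<longrightarrow>
     (\<exists>e' K'. K' \<le> K + m * k \<and> orthonormal n e' K' \<and> (\<forall>t. perp n e' K' t \<longrightarrow>
        p (lincomb n x t) \<le> G * c * (real k powr (\<delta> - 1/2)) ^ m * l2norm n t)))"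

lemma weyl_decay_0: "weyl_decay \<delta> 0 p p"
  unfolding weyl_decay_def by (intro exI[of _ 1]) auto

text \<open>Since \<open>weyl_decay\<close> starts from an arbitrary orthonormal system and bound
  \<open>c\<close>, the output of \<open>summing_step\<close> for \<open>r\<close> and
  \<open>q\<close> is a legitimate input for \<open>q\<close> and \<open>p\<close>; codimensions add
  and factors multiply.\<close>

lemma weyl_decay_Suc:
  assumes q: "seminorm smul q" and r: "seminorm smul r"
    and W: "weyl_decay \<delta> m p q" and s: "summing \<delta> C q r" and \<delta>: "\<delta> \<ge> 0"
  shows "weyl_decay \<delta> (Suc m) p r"
proof -
  define C' where "C' = max C 1"
  have C': "C' > 0" "summing \<delta> C' q r" using s by (auto simp: C'_def summing_def le_max_iff_disj)
  obtain G where G: "G > 0" "\<And>n x e K c k. orthonormal n e K \<Longrightarrow> c > 0 \<Longrightarrow> k \<ge> 1 \<Longrightarrow>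
     (\<And>t. perp n e K t \<Longrightarrow> q (lincomb n x t) \<le> c * l2norm n t) \<Longrightarrow>
     \<exists>e' K'. K' \<le> K + m * k \<and> orthonormal n e' K' \<and> (\<forall>t. perp n e' K' t \<longrightarrow>
        p (lincomb n x t) \<le> G * c * (real k powr (\<delta> - 1/2)) ^ m * l2norm n t)"
    using W unfolding weyl_decay_def by blast
  show ?thesis unfolding weyl_decay_def
  proof (rule exI[of _ "G * C'"], intro conjI allI impI)
    show "G * C' > 0" using G C' by simp
    fix n x e K c and k :: nat
    assume e: "orthonormal n e K" and c: "(c::real) > 0" and k: "k \<ge> 1"
      and bound: "\<forall>t. perp n e K t \<longrightarrow> r (lincomb n x t) \<le> c * l2norm n t"
    obtain e1 K1 where 1: "K1 \<le> K + k" "orthonormal n e1 K1"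
      "\<And>t. perp n e1 K1 t \<Longrightarrow> q (lincomb n x t) \<le> C' * c * real k powr (\<delta> - 1/2) * l2norm n t"
      using summing_step[OF q r C'(2,1) \<delta> e c k, of x] bound by blast
    have "C' * c * real k powr (\<delta> - 1/2) > 0" using C' c k by simp
    from G(2)[OF 1(2) this k 1(3)]
    obtain e' K' where 2: "K' \<le> K1 + m * k" "orthonormal n e' K'" "\<And>t. perp n e' K' t \<Longrightarrow>
        p (lincomb n x t) \<le> G * (C' * c * real k powr (\<delta> - 1/2)) * (real k powr (\<delta> - 1/2)) ^ m * l2norm n t"
      by blast
    then show "\<exists>e' K'. K' \<le> K + Suc m * k \<and> orthonormal n e' K' \<and> (\<forall>t. perp n e' K' t \<longrightarrow>
        p (lincomb n x t) \<le> G * C' * c * (real k powr (\<delta> - 1/2)) ^ Suc m * l2norm n t)"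
      using 1(1) by (intro exI[of _ e'] exI[of _ K']) (auto simp: mult_ac)
  qed
qed

end

section \<open>Approximation by maximal determinants\<close>

text \<open>Lists the indices other than \<open>i\<close> in increasing order, so that minors of
  \<open>eval_mat\<close> are again determinants of evaluation matrices.\<close>

definition skip :: "nat \<Rightarrow> nat \<Rightarrow> nat" where
  "skip i k = (if k < i then k else Suc k)"

lemma skip_neq [simp]: "skip i k \<noteq> i"
  and skip_less: "i < Suc n \<Longrightarrow> k < n \<Longrightarrow> skip i k < Suc n"
  and skip_last: "k < n \<Longrightarrow> skip n k = k"
  by (auto simp: skip_def)

definition eval_mat :: "nat \<Rightarrow> (nat \<Rightarrow> 'a) \<Rightarrow> (nat \<Rightarrow> 'a \<Rightarrow> complex) \<Rightarrow> complex Matrix.mat" where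
  "eval_mat n x f = Matrix.mat n n (\<lambda>(i, j). f j (x i))"

definition eval_det :: "nat \<Rightarrow> (nat \<Rightarrow> 'a) \<Rightarrow> (nat \<Rightarrow> 'a \<Rightarrow> complex) \<Rightarrow> complex" where
  "eval_det n x f = Determinant.det (eval_mat n x f)"

lemma eval_mat_carrier [simp]: "eval_mat n x f \<in> carrier_mat n n"
  by (simp add: eval_mat_def)

lemma eval_mat_index [simp]: "i < n \<Longrightarrow> j < n \<Longrightarrow> eval_mat n x f $$ (i, j) = f j (x i)"
  by (simp add: eval_mat_def)

lemma eval_mat_dim [simp]: "dim_row (eval_mat n x f) = n" "dim_col (eval_mat n x f) = n"
  by (simp_all add: eval_mat_def)

lemma eval_mat_cong:
  "(\<And>i j. i < n \<Longrightarrow> j < n \<Longrightarrow> f j (x i) = g j (y i)) \<Longrightarrow> eval_mat n x f = eval_mat n y g"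
  by (rule eq_matI) auto

lemma eval_det_cong:
  "(\<And>i j. i < n \<Longrightarrow> j < n \<Longrightarrow> f j (x i) = g j (y i)) \<Longrightarrow> eval_det n x f = eval_det n y g"
  unfolding eval_det_def by (subst eval_mat_cong) auto

lemma cofactor_eval_mat:
  assumes "i < Suc n" "j < Suc n"
  shows "cofactor (eval_mat (Suc n) x f) i j =
    (- 1) ^ (i + j) * eval_det n (\<lambda>k. x (skip i k)) (\<lambda>l. f (skip j l))"
proof -
  have "mat_delete (eval_mat (Suc n) x f) i j = eval_mat n (\<lambda>k. x (skip i k)) (\<lambda>l. f (skip j l))"
    by (rule eq_matI) (use assms in \<open>auto simp: mat_delete_def skip_def\<close>)
  then show ?thesis by (simp add: cofactor_def eval_det_def)
qed

lemma cofactor_eval_mat_update: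
  assumes "i < n" "j < n"
  shows "cofactor (eval_mat n (x(i := y)) f) i j = cofactor (eval_mat n x f) i j"
proof -
  obtain n' where n: "n = Suc n'" using assms by (cases n) auto
  show ?thesis using assms unfolding n by (simp add: cofactor_eval_mat)
qed

text \<open>The cofactors of row \<open>k\<close> do not see the point standing there, so the
  Laplace coefficients survive its replacement; for linear \<open>f j\<close> the determinant is
  thus a linear functional of \<open>y\<close>.\<close>

lemma eval_det_update:
  assumes "k < n"
  shows "eval_det n (x(k := y)) f = (\<Sum>j<n. f j y * cofactor (eval_mat n x f) k j)"
  unfolding eval_det_def using assms
  by (subst laplace_expansion_row[OF eval_mat_carrier assms])
    (intro sum.cong, auto simp: cofactor_eval_mat_update)

lemma eval_det_identical:
  assumes "i < n" "k < n" "i \<noteq> k" "x i = x k"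
  shows "eval_det n x f = 0"
  unfolding eval_det_def
  by (rule det_identical_rows[OF eval_mat_carrier assms(3,1,2)])
    (use assms in \<open>auto intro!: eq_vecI\<close>)

text \<open>A crude Leibniz estimate that makes the supremum \<open>max_det\<close> finite; the
  decay comes from quotients of consecutive values.\<close>

lemma eval_det_bound:
  assumes "\<And>i j. i < n \<Longrightarrow> j < n \<Longrightarrow> norm (f j (x i)) \<le> 1"
  shows "norm (eval_det n x f) \<le> fact n"
proof -
  have "norm (eval_det n x f) \<le> (\<Sum>\<pi> | \<pi> permutes {0..<n}. 1)"
    unfolding eval_det_def det_def'[OF eval_mat_carrier]
  proof (rule order_trans[OF norm_sum sum_mono])
    fix \<pi> assume "\<pi> \<in> {\<pi>. \<pi> permutes {0..<n}}"
    then have \<pi>: "\<pi> i < n" if "i < n" for i using permutes_in_image[of \<pi> "{0..<n}" i] that by auto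
    have "norm (\<Prod>i = 0..<n. eval_mat n x f $$ (i, \<pi> i)) \<le> (\<Prod>i = 0..<n. 1)"
      unfolding prod_norm[symmetric] using \<pi> assms by (intro prod_mono) auto
    then show "norm (of_int (sign \<pi>) * (\<Prod>i = 0..<n. eval_mat n x f $$ (i, \<pi> i))) \<le> 1"
      by (simp add: norm_mult sign_def)
  qed
  also have "\<dots> = fact n" using card_permutations[of "{0..<n}" n] by simp
  finally show ?thesis .
qed

text \<open>Both orders of the product with the adjugate serve: the first recovers the coefficients
  of a combination of the points, the second interpolates at the functionals.\<close>

lemma adjugate_eval_mat:
  assumes "i < n" "k < n"
  shows "(\<Sum>j<n. f j (x i) * cofactor (eval_mat n x f) k j) = (if i = k then eval_det n x f else 0)"
    and "(\<Sum>j<n. cofactor (eval_mat n x f) j i * f k (x j)) = (if i = k then eval_det n x f else 0)"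
proof -
  let ?M = "eval_mat n x f"
  have adj: "adj_mat ?M \<in> carrier_mat n n" "adj_mat ?M $$ (a, b) = cofactor ?M b a" if "a < n" "b < n" for a b
    using adj_mat(1)[OF eval_mat_carrier[of n x f]] that by (auto simp: adj_mat_def)
  have "(?M * adj_mat ?M) $$ (i, k) = (\<Sum>j<n. f j (x i) * cofactor ?M k j)"
    using assms adj by (simp add: times_mat_def scalar_prod_def atLeast0LessThan adj_mat_def)
  moreover have "(?M * adj_mat ?M) $$ (i, k) = (if i = k then eval_det n x f else 0)"
    unfolding adj_mat(2)[OF eval_mat_carrier] using assms by (simp add: eval_det_def)
  ultimately show "(\<Sum>j<n. f j (x i) * cofactor ?M k j) = (if i = k then eval_det n x f else 0)" by simp
  have "(adj_mat ?M * ?M) $$ (i, k) = (\<Sum>j<n. cofactor ?M j i * f k (x j))"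
    using assms adj by (simp add: times_mat_def scalar_prod_def atLeast0LessThan adj_mat_def)
  moreover have "(adj_mat ?M * ?M) $$ (i, k) = (if i = k then eval_det n x f else 0)"
    unfolding adj_mat(3)[OF eval_mat_carrier] using assms by (simp add: eval_det_def)
  ultimately show "(\<Sum>j<n. cofactor ?M j i * f k (x j)) = (if i = k then eval_det n x f else 0)" by simp
qed

section \<open>Maximal determinants and approximability\<close>

context complex_vector_space
begin

definition admissible :: "('a \<Rightarrow> real) \<Rightarrow> ('a \<Rightarrow> real) \<Rightarrow> nat \<Rightarrow> (nat \<Rightarrow> 'a) \<Rightarrow> (nat \<Rightarrow> 'a \<Rightarrow> complex) \<Rightarrow> bool" where
  "admissible p q n x f \<longleftrightarrow>
     (\<forall>i<n. q (x i) \<le> 1) \<and> (\<forall>j<n. clinear (f j) \<and> (\<forall>y. norm (f j y) \<le> p y))"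

text \<open>Without the customary \<open>n\<close>-th root, the \<open>n\<close>-th Grothendieck
  number of \<open>X\<^sub>q \<rightarrow> X\<^sub>p\<close>.\<close>

definition max_det :: "('a \<Rightarrow> real) \<Rightarrow> ('a \<Rightarrow> real) \<Rightarrow> nat \<Rightarrow> real" where
  "max_det p q n = (SUP (x, f)\<in>{(x, f). admissible p q n x f}. norm (eval_det n x f))"

text \<open>Stronger than a bound on an approximation number: the rank one summands are controlled
  individually. The factor 2 is the price of a determinant that reaches its supremum only up to a
  factor 2.\<close>

definition approximable :: "real \<Rightarrow> ('a \<Rightarrow> real) \<Rightarrow> ('a \<Rightarrow> real) \<Rightarrow> nat \<Rightarrow> bool" where
  "approximable \<tau> p q n \<longleftrightarrow> (\<exists>g x.
     (\<forall>i<n. clinear (g i) \<and> (\<forall>y. norm (g i y) \<le> 2 * q y) \<and> q (x i) \<le> 1) \<and>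
     (\<forall>z. p (z - (\<Sum>i<n. smul (g i z) (x i))) \<le> \<tau> * q z))"

lemma approximable_mono:
  assumes q: "seminorm smul q" and a: "approximable \<tau> p q n" and \<tau>: "\<tau> \<le> \<tau>'" and n: "n \<le> n'"
  shows "approximable \<tau>' p q n'"
proof -
  obtain g x where gx: "\<And>i. i < n \<Longrightarrow> clinear (g i)" "\<And>i y. i < n \<Longrightarrow> norm (g i y) \<le> 2 * q y"
    "\<And>i. i < n \<Longrightarrow> q (x i) \<le> 1" "\<And>z. p (z - (\<Sum>i<n. smul (g i z) (x i))) \<le> \<tau> * q z"
    using a unfolding approximable_def by blast
  define g' where "g' i = (if i < n then g i else (\<lambda>_. 0))" for i
  define x' where "x' i = (if i < n then x i else 0)" for i
  show ?thesis unfolding approximable_def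
  proof (rule exI[of _ g'], rule exI[of _ x'], intro conjI allI impI)
    fix i y
    show "clinear (g' i)" using gx(1)[of i] by (simp add: g'_def clinear_iff)
    show "norm (g' i y) \<le> 2 * q y" using gx(2)[of i y] seminorm_nonneg[OF q] by (simp add: g'_def)
    show "q (x' i) \<le> 1" using gx(3)[of i] by (simp add: x'_def seminorm_0[OF q])
  next
    fix z
    have "(\<Sum>i<n'. smul (g' i z) (x' i)) = (\<Sum>i<n. smul (g i z) (x i))"
      using n by (intro sum.mono_neutral_cong_right) (auto simp: g'_def x'_def)
    then show "p (z - (\<Sum>i<n'. smul (g' i z) (x' i))) \<le> \<tau>' * q z"
      using gx(4)[of z] mult_right_mono[OF \<tau> seminorm_nonneg[OF q, of z]] by simp
  qed
qed

context
  fixes p q :: "'a \<Rightarrow> real"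
  assumes p: "seminorm smul p" and q: "seminorm smul q" and pq: "\<And>x. p x \<le> q x"
begin

lemma max_det_bdd: "bdd_above ((\<lambda>(x, f). norm (eval_det n x f)) ` {(x, f). admissible p q n x f})"
proof (rule bdd_aboveI2[of _ _ "fact n"], clarify)
  fix x f assume a: "admissible p q n x f"
  show "norm (eval_det n x f) \<le> fact n"
  proof (rule eval_det_bound)
    fix i j assume "i < n" "j < n"
    then have "norm (f j (x i)) \<le> p (x i)" "q (x i) \<le> 1" using a by (auto simp: admissible_def)
    then show "norm (f j (x i)) \<le> 1" using pq[of "x i"] by linarith
  qed
qed

lemma eval_det_le_max_det: "admissible p q n x f \<Longrightarrow> norm (eval_det n x f) \<le> max_det p q n"
  unfolding max_det_def by (rule cSUP_upper2[OF max_det_bdd, of "(x, f)"]) auto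

lemma admissible_zero: "admissible p q n (\<lambda>_. 0) (\<lambda>_ _. 0)"
  by (simp add: admissible_def seminorm_0[OF q] seminorm_nonneg[OF p] clinear_iff)

lemma max_det_nonneg: "0 \<le> max_det p q n"
  using eval_det_le_max_det[OF admissible_zero] norm_ge_zero order_trans by blast

lemma max_det_0: "max_det p q 0 > 0"
proof -
  have "eval_det 0 (\<lambda>_. 0 :: 'a) (\<lambda>_ _. 0) = 1"
    by (simp add: eval_det_def det_dim_zero)
  then show ?thesis using eval_det_le_max_det[OF admissible_zero, of 0] by simp
qed

lemma max_det_attained_half:
  assumes "max_det p q n > 0"
  obtains x f where "admissible p q n x f" "norm (eval_det n x f) > max_det p q n / 2"
proof -
  have "max_det p q n / 2 < max_det p q n" using assms by simp
  then have "\<exists>z\<in>{(x, f). admissible p q n x f}. max_det p q n / 2 < (case z of (x, f) \<Rightarrow> norm (eval_det n x f))"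
    using admissible_zero
    by (subst (asm) (2) max_det_def, subst (asm) less_cSUP_iff[OF _ max_det_bdd]) auto
  then show ?thesis using that by auto
qed

lemma admissible_skip:
  assumes "admissible p q (Suc n) x f" "i < Suc n" "j < Suc n"
  shows "admissible p q n (\<lambda>k. x (skip i k)) (\<lambda>l. f (skip j l))"
  using assms skip_less unfolding admissible_def by blast

lemma cofactor_le_max_det:
  assumes "admissible p q (Suc n) x f" "i < Suc n" "j < Suc n"
  shows "norm (cofactor (eval_mat (Suc n) x f) i j) \<le> max_det p q n"
  using eval_det_le_max_det[OF admissible_skip[OF assms]]
  by (simp add: cofactor_eval_mat[OF assms(2,3)] norm_mult norm_power)

lemma homogeneous_bound:
  assumes r: "seminorm smul r" and le: "\<And>x. q x \<le> 1 \<Longrightarrow> r x \<le> C" and null: "\<And>x. q x = 0 \<Longrightarrow> r x = 0"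
  shows "r x \<le> C * q x"
proof (cases "q x = 0")
  case False
  then have pos: "q x > 0" using seminorm_nonneg[OF q, of x] by simp
  have "r (smul (of_real (1 / q x)) x) \<le> C"
    using pos by (intro le) (simp add: seminorm_scale[OF q] norm_divide)
  then show ?thesis using pos by (simp add: seminorm_scale[OF r] norm_divide field_simps)
qed (simp add: null)

text \<open>Interpolating at a nearly maximal determinant. By Cramer's rule the coefficient functionals are
  quotients of determinants of size \<open>n\<close>, and evaluating the error at a functional gives a quotient of
  a determinant of size \<open>n + 1\<close> (a Schur complement).\<close>

lemma approximable_max_det:
  assumes pos: "max_det p q n > 0"
  shows "approximable (2 * max_det p q (Suc n) / max_det p q n) p q n"
proof -
  obtain x f where a: "admissible p q n x f" and half: "norm (eval_det n x f) > max_det p q n / 2"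
    using max_det_attained_half[OF pos] .
  define d where "d = eval_det n x f"
  have d: "d \<noteq> 0" using half pos by (auto simp: d_def)
  have lin: "clinear (f j)" and fp: "norm (f j y) \<le> p y" if "j < n" for j y
    using a that by (auto simp: admissible_def)
  have xq: "q (x i) \<le> 1" if "i < n" for i using a that by (auto simp: admissible_def)
  have pnull: "p z = 0" if "q z = 0" for z
    using pq[of z] seminorm_nonneg[OF p, of z] that by simp
  have fnull: "f j z = 0" if "q z = 0" "j < n" for z j
    using fp[OF that(2), of z] pnull[OF that(1)] by simp
  define M where "M = eval_mat n x f"
  define g where "g k y = (\<Sum>j<n. f j y * cofactor M k j) / d" for k y
  have g_lin: "clinear (g k)" for k
    unfolding clinear_iff g_def
    by (auto simp: clinear_add[OF lin] clinear_scale[OF lin] ring_distribs sum.distrib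
      add_divide_distrib sum_distrib_left mult.assoc)
  have g_det: "g k y = eval_det n (x(k := y)) f / d" if "k < n" for k y
    unfolding g_def M_def eval_det_update[OF that] ..
  have g_null: "g k z = 0" if "q z = 0" for k z
    by (simp add: g_def fnull[OF that])
  have g_le: "norm (g k y) \<le> 2 * q y" if "k < n" for k y
  proof (rule homogeneous_bound)
    show "seminorm smul (\<lambda>y. norm (g k y))"
      using g_lin by (simp add: seminorm_def clinear_add clinear_scale norm_mult norm_triangle_ineq)
    show "norm (g k y) = 0" if "q y = 0" for y using g_null[OF that] by simp
    fix y assume "q y \<le> 1"
    then have "admissible p q n (x(k := y)) f" using a by (auto simp: admissible_def)
    then have "norm (eval_det n (x(k := y)) f) \<le> max_det p q n" by (rule eval_det_le_max_det)
    also have "\<dots> \<le> 2 * norm d" using half by (simp add: d_def)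
    finally show "norm (g k y) \<le> 2" using d by (simp add: g_det[OF that] norm_divide field_simps)
  qed
  define E where "E z = z - (\<Sum>k<n. smul (g k z) (x k))" for z
  have fE: "f j (E z) = 0" if j: "j < n" for j z
  proof -
    have "(\<Sum>k<n. g k z * f j (x k)) = (\<Sum>k<n. \<Sum>l<n. f l z * (cofactor M k l * f j (x k)) / d)"
      by (simp add: g_def sum_distrib_right sum_divide_distrib mult.assoc)
    also have "\<dots> = (\<Sum>l<n. f l z * (\<Sum>k<n. cofactor M k l * f j (x k)) / d)"
      by (subst sum.swap) (simp add: sum_distrib_left sum_divide_distrib)
    also have "\<dots> = (\<Sum>l<n. if l = j then f l z else 0)"
      using j d by (intro sum.cong refl) (simp add: M_def adjugate_eval_mat(2) d_def)
    also have "\<dots> = f j z" using j by simp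
    finally show ?thesis
      unfolding E_def by (simp add: clinear_diff[OF lin[OF j]] clinear_sum[OF lin[OF j]] clinear_scale[OF lin[OF j]])
  qed
  have E_bound: "p (E z) \<le> 2 * max_det p q (Suc n) / max_det p q n * q z" for z
  proof (rule homogeneous_bound)
    show "seminorm smul (\<lambda>z. p (E z))" unfolding seminorm_def
    proof (intro conjI allI)
      fix u v c
      show "0 \<le> p (E u)" by (rule seminorm_nonneg[OF p])
      have "E (u + v) = E u + E v"
        by (simp add: E_def clinear_add[OF g_lin] scale_left_distrib sum.distrib algebra_simps)
      then show "p (E (u + v)) \<le> p (E u) + p (E v)" using seminorm_add[OF p] by simp
      have "E (smul c u) = smul c (E u)"
        by (simp add: E_def clinear_scale[OF g_lin] scale_right_diff_distrib scale_sum_right)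
      then show "p (E (smul c u)) = norm c * p (E u)" by (simp add: seminorm_scale[OF p])
    qed
    show "p (E z) = 0" if "q z = 0" for z by (simp add: E_def g_null[OF that] pnull[OF that])
    fix z assume z: "q z \<le> 1"
    obtain \<phi> where \<phi>: "clinear \<phi>" "\<And>y. norm (\<phi> y) \<le> p y" "norm (\<phi> (E z)) = p (E z)"
      using norming_functional[OF p] by blast
    define F where "F = f(n := \<phi>)"
    have F_lin: "clinear (F j)" if "j < Suc n" for j
      using that lin \<phi>(1) by (auto simp: F_def less_Suc_eq)
    define c where "c j = cofactor (eval_mat (Suc n) x F) n j" for j
    \<comment> \<open>As a functional of its last point, the determinant of size
      \<open>n + 1\<close> vanishes at every \<open>x k\<close>, so it agrees at \<open>z\<close>
      and \<open>E z\<close>; at \<open>E z\<close> only the entry of \<phi> in the last row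
      survives.\<close>
    define h where "h w = (\<Sum>j<Suc n. F j w * c j)" for w
    have h_det: "h w = eval_det (Suc n) (x(n := w)) F" for w
      unfolding h_def c_def by (rule eval_det_update[symmetric]) simp
    have h_lin: "clinear h"
      unfolding clinear_iff h_def
      by (auto simp: clinear_add[OF F_lin] clinear_scale[OF F_lin] ring_distribs sum.distrib
        sum_distrib_left mult.assoc simp del: sum.lessThan_Suc)
    have h_x: "h (x k) = 0" if "k < n" for k
      unfolding h_det by (rule eval_det_identical[of k _ n]) (use that in auto)
    have "h z = h (E z)"
      by (simp add: E_def clinear_diff[OF h_lin] clinear_sum[OF h_lin] clinear_scale[OF h_lin] h_x)
    also have "\<dots> = \<phi> (E z) * c n" by (simp add: h_def F_def fE)
    also have "c n = d"
    proof -
      have "c n = eval_det n (\<lambda>k. x (skip n k)) (\<lambda>l. F (skip n l))"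
        unfolding c_def by (subst cofactor_eval_mat) (simp_all flip: mult_2)
      also have "\<dots> = eval_det n x f" by (rule eval_det_cong) (simp add: skip_last F_def)
      finally show ?thesis by (simp add: d_def)
    qed
    finally have "norm (h z) = p (E z) * norm d" by (simp add: norm_mult \<phi>)
    moreover have "admissible p q (Suc n) (x(n := z)) F"
      using z xq lin fp \<phi> by (auto simp: admissible_def F_def less_Suc_eq)
    then have "norm (h z) \<le> max_det p q (Suc n)" unfolding h_det by (rule eval_det_le_max_det)
    ultimately have "p (E z) * norm d \<le> max_det p q (Suc n)" by simp
    moreover have "p (E z) * (max_det p q n / 2) \<le> p (E z) * norm d"
      using half seminorm_nonneg[OF p] by (intro mult_left_mono) (auto simp: d_def)
    ultimately show "p (E z) \<le> 2 * max_det p q (Suc n) / max_det p q n"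
      using pos by (simp add: field_simps)
  qed
  show ?thesis unfolding approximable_def
    by (rule exI[of _ g], rule exI[of _ x]) (use g_lin g_le xq E_bound in \<open>auto simp: E_def\<close>)
qed

text \<open>A nonzero \<open>t\<close> orthogonal to \<open>e\<close> gives a combination
  \<open>y\<close> of the \<open>N = n + 1\<close> points with small \<open>p y\<close>. Cramer's
  rule expresses each \<open>t i\<close> times the determinant by the values \<open>f j y\<close>
  and cofactors of size \<open>n\<close>, so the determinant itself is small. In the power 3, the
  sums over \<open>j\<close> and over \<open>i\<close> cost \<open>N\<close> each, and
  \<open>sqrt N\<close> comes from \<open>lincomb_bound\<close>.\<close>

lemma max_det_ratio:
  assumes G: "G > 0" "\<And>n x e K c k. orthonormal n e K \<Longrightarrow> c > 0 \<Longrightarrow> k \<ge> 1 \<Longrightarrow>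
     (\<And>t. perp n e K t \<Longrightarrow> q (lincomb n x t) \<le> c * l2norm n t) \<Longrightarrow>
     \<exists>e' K'. K' \<le> K + m * k \<and> orthonormal n e' K' \<and> (\<forall>t. perp n e' K' t \<longrightarrow>
        p (lincomb n x t) \<le> G * c * (real k powr (\<delta> - 1/2)) ^ m * l2norm n t)"
    and pos: "max_det p q (Suc n) > 0" and k: "k \<ge> 1" "m * k < Suc n"
  shows "max_det p q (Suc n) \<le> 2 * G * real (Suc n) ^ 3 * (real k powr (\<delta> - 1/2)) ^ m * max_det p q n"
proof -
  define N where "N = Suc n"
  obtain x f where a: "admissible p q N x f" and half: "norm (eval_det N x f) > max_det p q N / 2"
    using max_det_attained_half[OF pos] unfolding N_def .
  define d where "d = eval_det N x f"
  have d: "d \<noteq> 0" using half pos by (auto simp: d_def N_def)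
  have lin: "clinear (f j)" and fp: "norm (f j y) \<le> p y" if "j < N" for j y
    using a that by (auto simp: admissible_def)
  have xq: "q (x i) \<le> 1" if "i < N" for i using a that by (auto simp: admissible_def)
  define M where "M = eval_mat N x f"
  define \<kappa> where "\<kappa> = (real k powr (\<delta> - 1/2)) ^ m"
  have \<kappa>: "\<kappa> \<ge> 0" by (simp add: \<kappa>_def)
  have "\<exists>e K. K \<le> 0 + m * k \<and> orthonormal N e K \<and>
      (\<forall>t. perp N e K t \<longrightarrow> p (lincomb N x t) \<le> G * sqrt N * (real k powr (\<delta> - 1/2)) ^ m * l2norm N t)"
  proof (rule G(2)[OF _ _ k(1)])
    show "orthonormal N (\<lambda>_ _. 0) 0" by (simp add: orthonormal_def)
    show "sqrt N > 0" by (simp add: N_def)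
    show "q (lincomb N x t) \<le> sqrt N * l2norm N t" for t by (rule lincomb_bound[OF q xq])
  qed
  then obtain e K where e: "K \<le> m * k" "orthonormal N e K"
    "\<And>t. perp N e K t \<Longrightarrow> p (lincomb N x t) \<le> G * sqrt N * \<kappa> * l2norm N t"
    unfolding \<kappa>_def add_0 by blast
  obtain t where t: "perp N e K t" "l2norm N t > 0"
    using exists_nonzero_perp[OF e(2)] e(1) k(2) by (auto simp: N_def)
  define y where "y = lincomb N x t"
  have coeff: "norm (t i) \<le> real N * p y * max_det p q n / norm d" if i: "i < N" for i
  proof -
    have "(\<Sum>j<N. f j y * cofactor M i j) = (\<Sum>j<N. \<Sum>l<N. t l * (f j (x l) * cofactor M i j))"
      unfolding y_def lincomb_def
      by (simp add: clinear_sum[OF lin] clinear_scale[OF lin] sum_distrib_right mult.assoc)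
    also have "\<dots> = (\<Sum>l<N. t l * (\<Sum>j<N. f j (x l) * cofactor M i j))"
      by (subst sum.swap) (simp add: sum_distrib_left)
    also have "\<dots> = (\<Sum>l<N. if l = i then t l * d else 0)"
      using i by (intro sum.cong refl) (simp add: M_def adjugate_eval_mat(1) d_def)
    also have "\<dots> = t i * d" using i by simp
    finally have "norm (t i) * norm d = norm (\<Sum>j<N. f j y * cofactor M i j)" by (simp add: norm_mult)
    also have "\<dots> \<le> (\<Sum>j<N. p y * max_det p q n)"
    proof (rule order_trans[OF norm_sum sum_mono])
      fix j assume "j \<in> {..<N}"
      then have j: "j < N" by simp
      show "norm (f j y * cofactor M i j) \<le> p y * max_det p q n"
        unfolding norm_mult M_def
        using fp[OF j, of y] cofactor_le_max_det[OF a[unfolded N_def] i[unfolded N_def] j[unfolded N_def]]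
        by (intro mult_mono) (auto simp: N_def seminorm_nonneg[OF p])
    qed
    finally show ?thesis using d by (simp add: field_simps)
  qed
  have "l2norm N t \<le> (\<Sum>i<N. norm (t i))" unfolding l2norm_def by (rule L2_set_le_sum) simp
  also have "\<dots> \<le> (\<Sum>i<N. real N * p y * max_det p q n / norm d)" using coeff by (intro sum_mono) auto
  also have "\<dots> = real N ^ 2 * max_det p q n / norm d * p y" by (simp add: power2_eq_square)
  also have "\<dots> \<le> real N ^ 2 * max_det p q n / norm d * (G * sqrt N * \<kappa> * l2norm N t)"
    unfolding y_def using max_det_nonneg by (intro mult_left_mono e(3) t(1)) simp
  finally have "1 * l2norm N t \<le> real N ^ 2 * max_det p q n / norm d * (G * sqrt N * \<kappa>) * l2norm N t"
    by (simp only: mult_1 mult.assoc)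
  then have "1 \<le> real N ^ 2 * max_det p q n / norm d * (G * sqrt N * \<kappa>)"
    using t(2) by (rule mult_right_le_imp_le)
  then have "norm d \<le> real N ^ 2 * max_det p q n * (G * sqrt N * \<kappa>)" using d by (simp add: field_simps)
  also have "\<dots> = real N ^ 2 * sqrt N * (max_det p q n * G * \<kappa>)" by simp
  also have "\<dots> \<le> real N ^ 2 * real N * (max_det p q n * G * \<kappa>)"
    using max_det_nonneg[of n] G(1) \<kappa>
    by (intro mult_right_mono mult_left_mono) (auto simp: real_le_lsqrt N_def power2_eq_square)
  finally have "norm d \<le> real N ^ 2 * real N * (max_det p q n * G * \<kappa>)" .
  then show ?thesis using half unfolding d_def[symmetric] \<kappa>_def[symmetric] N_def[symmetric]
    by (simp add: power2_eq_square power3_eq_cube mult_ac)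
qed

lemma weyl_decay_imp_approximable:
  assumes W: "weyl_decay \<delta> m p q" and m: "real m * (1/2 - \<delta>) \<ge> 7"
  obtains B where "\<And>n. approximable (B / real (Suc n) ^ 4) p q n"
proof -
  obtain G where G: "G > 0" "\<And>n x e K c k. orthonormal n e K \<Longrightarrow> c > 0 \<Longrightarrow> k \<ge> 1 \<Longrightarrow>
     (\<And>t. perp n e K t \<Longrightarrow> q (lincomb n x t) \<le> c * l2norm n t) \<Longrightarrow>
     \<exists>e' K'. K' \<le> K + m * k \<and> orthonormal n e' K' \<and> (\<forall>t. perp n e' K' t \<longrightarrow>
        p (lincomb n x t) \<le> G * c * (real k powr (\<delta> - 1/2)) ^ m * l2norm n t)"
    using W unfolding weyl_decay_def by blast
  have m0: "m > 0" using m by (cases m) auto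
  define A where "A = 2 * G * (2 * real m) ^ 7"
  have A: "A > 0" using G m0 by (simp add: A_def)
  have ratio: "max_det p q (Suc n) \<le> A / real (Suc n) ^ 4 * max_det p q n"
    if pos: "max_det p q (Suc n) > 0" and n: "n \<ge> m" for n
  proof -
    \<comment> \<open>The largest \<open>k\<close> with \<open>m * k \<le> n\<close>, which leaves a
      nonzero vector in dimension \<open>n + 1\<close>; it is still at least
      \<open>(n + 1) / (2 * m)\<close>.\<close>
    define k where "k = n div m"
    have k: "k \<ge> 1" using n m0 by (simp add: k_def Suc_le_eq div_greater_zero_iff)
    have mk: "m * k < Suc n" by (simp add: k_def less_Suc_eq_le)
    have "Suc n \<le> m * Suc k"
      using dividend_less_times_div[OF m0, of n] by (simp add: k_def Suc_le_eq)
    also have "\<dots> \<le> m * (2 * k)" using k by (intro mult_left_mono) auto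
    finally have nk: "real (Suc n) \<le> 2 * real m * real k" by (metis mult.assoc mult.left_commute of_nat_le_iff of_nat_mult of_nat_numeral)
    have "(real k powr (\<delta> - 1/2)) ^ m = real k powr ((\<delta> - 1/2) * real m)"
      using k by (simp add: powr_realpow[symmetric] powr_powr)
    also have "\<dots> \<le> real k powr (- 7)" using m k by (intro powr_mono) (auto simp: algebra_simps)
    also have "\<dots> = 1 / real k ^ 7" using k by (simp add: powr_minus_divide powr_numeral)
    also have "\<dots> \<le> (2 * real m) ^ 7 / real (Suc n) ^ 7"
    proof -
      have "real (Suc n) ^ 7 \<le> (2 * real m * real k) ^ 7" by (intro power_mono nk) simp
      then show ?thesis using k by (simp add: power_mult_distrib field_simps del: of_nat_Suc)
    qed
    finally have \<kappa>: "(real k powr (\<delta> - 1/2)) ^ m \<le> (2 * real m) ^ 7 / real (Suc n) ^ 7" .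
    have "max_det p q (Suc n) \<le> 2 * G * real (Suc n) ^ 3 * (real k powr (\<delta> - 1/2)) ^ m * max_det p q n"
      by (rule max_det_ratio[OF G pos k mk])
    also have "\<dots> \<le> 2 * G * real (Suc n) ^ 3 * ((2 * real m) ^ 7 / real (Suc n) ^ 7) * max_det p q n"
      using G max_det_nonneg by (intro mult_right_mono mult_left_mono \<kappa>) auto
    also have "\<dots> = A / real (Suc n) ^ 4 * max_det p q n"
    proof -
      have *: "2 * G * u * (X / (u * v)) * D = 2 * G * X / v * D" if "u \<noteq> 0" for u v X D :: real
        using that by simp
      have "real (Suc n) ^ 7 = real (Suc n) ^ 3 * real (Suc n) ^ 4" by (simp flip: power_add)
      then show ?thesis unfolding A_def by (simp only:) (rule *, simp)
    qed
    finally show ?thesis .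
  qed
  \<comment> \<open>The second entry makes the bound at least 1 for \<open>n < m\<close>, where
    approximation by 0 is enough because \<open>p\<close> lies below \<open>q\<close>.\<close>
  define B where "B = max (2 * A) (real (Suc m) ^ 4)"
  have "approximable (B / real (Suc n) ^ 4) p q n" for n
  proof (cases "n < m")
    case True
    have "real (Suc n) ^ 4 \<le> real (Suc m) ^ 4" using True by (intro power_mono) auto
    also have "\<dots> \<le> B" by (simp add: B_def)
    finally have le: "1 \<le> B / real (Suc n) ^ 4" by simp
    have "approximable 1 p q 0" unfolding approximable_def by (simp add: pq)
    then show ?thesis by (rule approximable_mono[OF q _ le]) simp
  next
    case False
    show ?thesis
    proof (cases "max_det p q n > 0")
      case True
      have "2 * max_det p q (Suc n) / max_det p q n \<le> 2 * A / real (Suc n) ^ 4"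
      proof (cases "max_det p q (Suc n) > 0")
        case pos: True
        show ?thesis using ratio[OF pos] False True by (simp add: field_simps del: of_nat_Suc)
      next
        case False
        then have "max_det p q (Suc n) = 0" using max_det_nonneg[of "Suc n"] by simp
        then show ?thesis using A by simp
      qed
      also have "\<dots> \<le> B / real (Suc n) ^ 4" by (intro divide_right_mono) (auto simp: B_def)
      finally show ?thesis by (rule approximable_mono[OF q approximable_max_det[OF True]]) simp
    next
      case False
      \<comment> \<open>Just before the maximal determinant first vanishes, the quotient is 0 and
        the approximation of finite rank has no error; \<open>max_det_0\<close> ensures that there
        is a preceding size.\<close>
      define N where "N = (LEAST N. \<not> max_det p q N > 0)"
      have N: "\<not> max_det p q N > 0" "N \<le> n"
        unfolding N_def using LeastI[of "\<lambda>N. \<not> max_det p q N > 0" n] Least_le[of "\<lambda>N. \<not> max_det p q N > 0" n] False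
        by auto
      obtain N' where N': "N = Suc N'" using N(1) max_det_0 by (cases N) auto
      have pos: "max_det p q N' > 0" using not_less_Least[of N' "\<lambda>N. \<not> max_det p q N > 0"] N' N_def by auto
      have "max_det p q (Suc N') = 0" using N(1) N' max_det_nonneg[of N] by simp
      then have "approximable 0 p q N'" using approximable_max_det[OF pos] by simp
      moreover have "0 \<le> B / real (Suc n) ^ 4" by (simp add: B_def le_max_iff_disj)
      ultimately show ?thesis by (rule approximable_mono[OF q]) (use N N' in simp)
    qed
  qed
  then show ?thesis by (rule that)
qed

end

end

section \<open>Nuclearity from approximability\<close>

context complex_vector_space
begin

text \<open>The representation arrives in blocks of \<open>m n\<close> terms, while
  \<open>nuclear_map\<close> wants one sequence, so the pairs are enumerated by
  \<open>prod_decode\<close>. The product bound \<open>v n * u i\<close> controls the nuclear sum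
  and makes any finite set of terms from late blocks small.\<close>

lemma nuclear_mapI:
  assumes p: "seminorm smul p" and q: "seminorm smul q"
    and f: "\<And>n i. clinear (f n i)" "\<And>n i z. norm (f n i z) \<le> c n i * q z"
    and c: "\<And>n i. 0 \<le> c n i"
    and W: "\<And>n i. c n i * p (y n i) \<le> v n * u i"
    and vu: "\<And>n. 0 \<le> v n" "\<And>i. 0 \<le> u i" "summable v" "summable u"
    and zero: "\<And>n i. m n \<le> i \<Longrightarrow> y n i = 0"
    and lim: "\<And>z. (\<lambda>N. p (z - (\<Sum>n<N. \<Sum>i<m n. smul (f n i z) (y n i)))) \<longlonglongrightarrow> 0"
  shows "nuclear_map smul q smul p id"
proof -
  define F where "F k = (case prod_decode k of (n, i) \<Rightarrow> f n i)" for k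
  define Y where "Y k = (case prod_decode k of (n, i) \<Rightarrow> y n i)" for k
  define D where "D M = prod_decode ` {..<M}" for M
  have D_sub: "D M \<subseteq> {..<M} \<times> {..<M}" for M
  proof
    fix a assume "a \<in> D M"
    then obtain k where k: "k < M" "a = prod_decode k" by (auto simp: D_def)
    obtain n i where ni: "a = (n, i)" by (cases a)
    then have "k = prod_encode (n, i)" using k by (metis prod_decode_inverse)
    then have "n \<le> k" "i \<le> k" using le_prod_encode_1 le_prod_encode_2 by auto
    then show "a \<in> {..<M} \<times> {..<M}" unfolding ni using k(1) by simp
  qed
  have D_fin: "finite (D M)" for M by (simp add: D_def)
  have sum_D: "(\<Sum>k<M. case prod_decode k of (n, i) \<Rightarrow> h n i) = (\<Sum>(n, i)\<in>D M. h n i)"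
    for M and h :: "nat \<Rightarrow> nat \<Rightarrow> 'c::comm_monoid_add"
    unfolding D_def by (subst sum.reindex) (auto simp: inj_on_def inj_prod_decode[THEN inj_eq])
  define U where "U = suminf u"
  have U: "0 \<le> U" "(\<Sum>i<M. u i) \<le> U" for M
    unfolding U_def using vu by (auto intro: suminf_nonneg sum_le_suminf)
  have dual: "F k \<in> seminorm_dual smul q" for k
  proof -
    obtain n i where "prod_decode k = (n, i)" by (cases "prod_decode k")
    then have "F k = f n i" by (simp add: F_def)
    then show ?thesis using f[of n i] unfolding seminorm_dual_def by auto
  qed
  have dual_le: "dual_seminorm q (f n i) \<le> c n i" for n i
    unfolding dual_seminorm_def
  proof (rule cSUP_least)
    show "{x. q x \<le> 1} \<noteq> {}" using seminorm_0[OF q] by (auto intro!: exI[of _ 0])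
    fix x assume "x \<in> {x. q x \<le> 1}"
    then have "c n i * q x \<le> c n i * 1" by (intro mult_left_mono c) simp
    then show "norm (f n i x) \<le> c n i" using f(2)[of n i x] by simp
  qed
  have "summable (\<lambda>k. dual_seminorm q (F k) * p (Y k))"
  proof (rule summableI_nonneg_bounded)
    show "0 \<le> dual_seminorm q (F k) * p (Y k)" for k
      using dual_seminorm_bound(2)[OF q dual[of k]] seminorm_nonneg[OF p] by simp
    fix M
    have "(\<Sum>k<M. dual_seminorm q (F k) * p (Y k)) =
        (\<Sum>k<M. case prod_decode k of (n, i) \<Rightarrow> dual_seminorm q (f n i) * p (y n i))"
      by (intro sum.cong refl) (auto simp: F_def Y_def split: prod.split)
    also have "\<dots> = (\<Sum>(n, i)\<in>D M. dual_seminorm q (f n i) * p (y n i))" by (rule sum_D)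
    also have "\<dots> \<le> (\<Sum>(n, i)\<in>D M. v n * u i)"
    proof (intro sum_mono, clarify)
      fix n i
      have "dual_seminorm q (f n i) * p (y n i) \<le> c n i * p (y n i)"
        by (intro mult_right_mono dual_le seminorm_nonneg[OF p])
      then show "dual_seminorm q (f n i) * p (y n i) \<le> v n * u i" using W[of n i] by linarith
    qed
    also have "\<dots> \<le> (\<Sum>(n, i)\<in>{..<M} \<times> {..<M}. v n * u i)"
      using D_sub vu by (intro sum_mono2) auto
    also have "\<dots> = (\<Sum>n<M. v n) * (\<Sum>i<M. u i)"
      by (simp add: sum_product sum.cartesian_product)
    also have "\<dots> \<le> suminf v * U"
      using vu U by (intro mult_mono sum_le_suminf suminf_nonneg sum_nonneg) auto
    finally show "(\<Sum>k<M. dual_seminorm q (F k) * p (Y k)) \<le> suminf v * U" .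
  qed
  moreover have "(\<lambda>M. p (id z - (\<Sum>k<M. smul (F k z) (Y k)))) \<longlonglongrightarrow> 0" for z
  proof (rule LIMSEQ_I)
    fix \<epsilon> :: real assume \<epsilon>: "\<epsilon> > 0"
    \<comment> \<open>The summand 1 keeps the denominator positive when
      \<open>U * q z = 0\<close>.\<close>
    define \<eta> where "\<eta> = \<epsilon> / (2 * (U * q z + 1))"
    have Uq: "0 \<le> U * q z" using U seminorm_nonneg[OF q] by simp
    then have \<eta>: "\<eta> > 0" using \<epsilon> by (simp add: \<eta>_def)
    obtain N1 where N1: "\<And>a b. N1 \<le> a \<Longrightarrow> norm (sum v {a..<b}) < \<eta>"
      using spec[OF iffD1[OF summable_Cauchy vu(3)], of \<eta>] \<eta> by auto
    obtain N2 where N2: "\<And>N. N2 \<le> N \<Longrightarrow>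
        norm (p (z - (\<Sum>n<N. \<Sum>i<m n. smul (f n i z) (y n i))) - 0) < \<epsilon> / 2"
      using LIMSEQ_D[OF lim[of z], of "\<epsilon> / 2"] \<epsilon> by auto
    define N where "N = max N1 N2"
    \<comment> \<open>The pairs of the first \<open>N\<close> blocks. Once the enumeration has
      passed them, every other term it contains is zero or comes from a block
      \<open>n \<ge> N\<close>.\<close>
    define J where "J = Sigma {..<N} (\<lambda>n. {..<m n})"
    have J_fin: "finite J" by (simp add: J_def)
    define M0 where "M0 = Suc (Max (insert 0 (prod_encode ` J)))"
    have J_sub: "J \<subseteq> D M" if "M0 \<le> M" for M
    proof
      fix a assume "a \<in> J"
      then have "prod_encode a \<le> Max (insert 0 (prod_encode ` J))" using J_fin by (intro Max_ge) auto
      then have "prod_encode a < M" using that by (simp add: M0_def)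
      moreover have "a = prod_decode (prod_encode a)" by simp
      ultimately show "a \<in> D M" unfolding D_def by blast
    qed
    have "p (id z - (\<Sum>k<M. smul (F k z) (Y k))) < \<epsilon>" if M: "M0 \<le> M" for M
    proof -
      define T where "T = (\<lambda>(n, i). smul (f n i z) (y n i))"
      have "(\<Sum>k<M. smul (F k z) (Y k)) = (\<Sum>k<M. case prod_decode k of (n, i) \<Rightarrow> smul (f n i z) (y n i))"
        by (intro sum.cong refl) (auto simp: F_def Y_def split: prod.split)
      also have "\<dots> = sum T (D M)" unfolding T_def by (rule sum_D)
      also have "\<dots> = sum T (D M - J) + sum T J" by (rule sum.subset_diff[OF J_sub[OF M] D_fin])
      also have "sum T J = (\<Sum>n<N. \<Sum>i<m n. smul (f n i z) (y n i))"
        unfolding J_def T_def by (subst sum.Sigma) auto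
      finally have "id z - (\<Sum>k<M. smul (F k z) (Y k)) =
          (z - (\<Sum>n<N. \<Sum>i<m n. smul (f n i z) (y n i))) - sum T (D M - J)" by simp
      then have "p (id z - (\<Sum>k<M. smul (F k z) (Y k))) \<le>
          p (z - (\<Sum>n<N. \<Sum>i<m n. smul (f n i z) (y n i))) + p (sum T (D M - J))"
        by (simp only: seminorm_diff[OF p])
      moreover have "p (z - (\<Sum>n<N. \<Sum>i<m n. smul (f n i z) (y n i))) < \<epsilon> / 2"
        using N2[of N] by (simp add: N_def abs_less_iff)
      moreover have "p (sum T (D M - J)) < \<epsilon> / 2"
      proof -
        have "p (sum T (D M - J)) \<le> (\<Sum>a\<in>D M - J. p (T a))" by (rule seminorm_sum[OF p])
        also have "\<dots> \<le> (\<Sum>(n, i)\<in>D M - J. if N \<le> n then v n * u i * q z else 0)"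
        proof (intro sum_mono, clarify)
          fix n i assume ni: "(n, i) \<in> D M" "(n, i) \<notin> J"
          show "p (T (n, i)) \<le> (if N \<le> n then v n * u i * q z else 0)"
          proof (cases "N \<le> n")
            case True
            have "p (T (n, i)) = norm (f n i z) * p (y n i)" by (simp add: T_def seminorm_scale[OF p])
            also have "\<dots> \<le> c n i * q z * p (y n i)" by (intro mult_right_mono f seminorm_nonneg[OF p])
            also have "\<dots> = c n i * p (y n i) * q z" by simp
            also have "\<dots> \<le> v n * u i * q z" by (intro mult_right_mono W seminorm_nonneg[OF q])
            finally show ?thesis using True by simp
          next
            case False
            then have "m n \<le> i" using ni by (auto simp: J_def)
            then show ?thesis using False by (simp add: T_def zero seminorm_0[OF p])
          qed
        qed
        also have "\<dots> = (\<Sum>(n, i)\<in>(D M - J) \<inter> {(n, i). N \<le> n}. v n * u i * q z)"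
          using D_fin by (subst sum.inter_restrict) (auto intro!: sum.cong)
        also have "\<dots> \<le> (\<Sum>(n, i)\<in>{N..<M} \<times> {..<M}. v n * u i * q z)"
          using D_sub[of M] vu seminorm_nonneg[OF q] by (intro sum_mono2) auto
        also have "\<dots> = (\<Sum>n\<in>{N..<M}. v n) * (\<Sum>i<M. u i) * q z"
          unfolding sum_product sum.cartesian_product by (simp add: sum_distrib_right case_prod_unfold)
        also have "\<dots> \<le> \<eta> * U * q z"
          using N1[of N M] vu U \<eta> seminorm_nonneg[OF q]
          by (intro mult_right_mono mult_mono sum_nonneg) (auto simp: N_def)
        also have "\<dots> \<le> \<eta> * (U * q z)" by (simp add: mult.assoc)
        also have "\<dots> < \<eta> * (U * q z + 1)" using \<eta> by (intro mult_strict_left_mono) auto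
        also have "\<dots> = \<epsilon> / 2"
        proof -
          have *: "\<epsilon> / (2 * w) * w = \<epsilon> / 2" if "w > 0" for w :: real using that by simp
          show ?thesis unfolding \<eta>_def by (rule *) (use Uq in simp)
        qed
        finally show ?thesis .
      qed
      ultimately show ?thesis by linarith
    qed
    then show "\<exists>M0. \<forall>M\<ge>M0. norm (p (id z - (\<Sum>k<M. smul (F k z) (Y k))) - 0) < \<epsilon>"
      using seminorm_nonneg[OF p] by (intro exI[of _ M0]) auto
  qed
  ultimately show ?thesis unfolding nuclear_map_def using dual by blast
qed

text \<open>Zero vectors beyond \<open>n\<close> let consecutive operators, of \<open>n\<close> and
  \<open>n + 1\<close> terms, be subtracted as sums over the same range.\<close>

lemma approximable_padded:
  assumes "seminorm smul q" "approximable \<tau> p q n"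
  shows "\<exists>g x. (\<forall>i. clinear (g i)) \<and> (\<forall>i y. norm (g i y) \<le> 2 * q y) \<and> (\<forall>i. q (x i) \<le> 1) \<and>
    (\<forall>i\<ge>n. x i = 0) \<and> (\<forall>z. p (z - (\<Sum>i<n. smul (g i z) (x i))) \<le> \<tau> * q z)"
proof -
  obtain g x where gx: "\<And>i. i < n \<Longrightarrow> clinear (g i)" "\<And>i y. i < n \<Longrightarrow> norm (g i y) \<le> 2 * q y"
    "\<And>i. i < n \<Longrightarrow> q (x i) \<le> 1" "\<And>z. p (z - (\<Sum>i<n. smul (g i z) (x i))) \<le> \<tau> * q z"
    using assms(2) unfolding approximable_def by blast
  show ?thesis
  proof (rule exI[of _ "\<lambda>i. if i < n then g i else (\<lambda>_. 0)"], rule exI[of _ "\<lambda>i. if i < n then x i else 0"],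
      intro conjI allI impI)
    show "clinear (if i < n then g i else (\<lambda>_. 0))" for i using gx(1) by (simp add: clinear_iff)
    show "norm ((if i < n then g i else (\<lambda>_. 0)) y) \<le> 2 * q y" for i y
      using gx(2)[of i y] seminorm_nonneg[OF assms(1)] by simp
    show "q (if i < n then x i else 0) \<le> 1" for i using gx(3) by (simp add: seminorm_0[OF assms(1)])
    show "p (z - (\<Sum>i<n. smul ((if i < n then g i else (\<lambda>_. 0)) z) (if i < n then x i else 0))) \<le> \<tau> * q z" for z
      using gx(4)[of z] by simp
  qed simp
qed

lemma sum_lessThan_4_mult:
  "(\<Sum>i<4 * n. h i) = (\<Sum>j<n. h (4 * j) + h (4 * j + 1) + h (4 * j + 2) + h (4 * j + 3))"
  for h :: "nat \<Rightarrow> 'b::comm_monoid_add"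
proof (induction n)
  case (Suc n)
  have "4 * Suc n = Suc (Suc (Suc (Suc (4 * n))))" by simp
  then show ?case using Suc by (simp add: add.assoc numeral_eq_Suc)
qed simp

text \<open>With \<open>R\<^sub>n\<close> and \<open>R'\<^sub>n\<close> the remainders of the approximations of \<open>X\<^sub>r \<rightarrow> X\<^sub>p\<close> and \<open>X\<^sub>q \<rightarrow> X\<^sub>r\<close>,
  the differences of consecutive \<open>E\<^sub>n = R\<^sub>n R'\<^sub>n\<close> are
  \<open>R\<^sub>n (P'\<^bsub>n+1\<^esub> - P'\<^sub>n) + (P\<^bsub>n+1\<^esub> - P\<^sub>n) R'\<^bsub>n+1\<^esub>\<close>: each rank one summand carries a small factor,
  so that no control of the norms of projections onto the ranges is needed.\<close>

lemma approximable_imp_nuclear_map: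
  assumes p: "seminorm smul p" and r: "seminorm smul r" and q: "seminorm smul q"
    and pr: "\<And>x. p x \<le> r x" and rq: "\<And>x. r x \<le> q x"
    and a1: "\<And>n. approximable (B1 / real (Suc n) ^ 4) p r n"
    and a2: "\<And>n. approximable (B2 / real (Suc n) ^ 4) r q n"
  shows "nuclear_map smul q smul p id"
proof -
  define B where "B = max (max B1 B2) 0"
  define b where "b n = B / real (Suc n) ^ 4" for n
  have b_nn: "0 \<le> b n" for n by (simp add: b_def B_def)
  have b_Suc: "b (Suc n) \<le> b n" for n
    unfolding b_def by (intro divide_left_mono power_mono) (auto simp: B_def)
  have a: "approximable (b n) p r n" "approximable (b n) r q n" for n
    using approximable_mono[OF r a1[of n], of "b n" n] approximable_mono[OF q a2[of n], of "b n" n]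
    by (simp_all add: b_def B_def divide_right_mono)
  define \<Phi> where "\<Phi> p q n g x \<longleftrightarrow> (\<forall>i. clinear (g i)) \<and> (\<forall>i y. norm (g i y) \<le> 2 * q y) \<and>
      (\<forall>i. q (x i) \<le> 1) \<and> (\<forall>i\<ge>n. x i = 0) \<and>
      (\<forall>z. p (z - (\<Sum>i<n. smul (g i z) (x i))) \<le> b n * q z)"
    for p q :: "'a \<Rightarrow> real" and n :: nat and g x
  have "\<exists>g x. \<Phi> p r n g x" "\<exists>g x. \<Phi> r q n g x" for n
    unfolding \<Phi>_def by (rule approximable_padded r q a)+
  then obtain g x g' x' where \<Phi>: "\<And>n. \<Phi> p r n (g n) (x n)" "\<And>n. \<Phi> r q n (g' n) (x' n)" by metis
  have g: "clinear (g n i)" "norm (g n i y) \<le> 2 * r y" "r (x n i) \<le> 1" "n \<le> i \<Longrightarrow> x n i = 0"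
      "p (z - (\<Sum>i<n. smul (g n i z) (x n i))) \<le> b n * r z" for n i y z
    using \<Phi>(1)[of n] unfolding \<Phi>_def by blast+
  have g': "clinear (g' n i)" "norm (g' n i y) \<le> 2 * q y" "q (x' n i) \<le> 1" "n \<le> i \<Longrightarrow> x' n i = 0"
      "r (z - (\<Sum>i<n. smul (g' n i z) (x' n i))) \<le> b n * q z" for n i y z
    using \<Phi>(2)[of n] unfolding \<Phi>_def by blast+
  define P where "P n z = (\<Sum>i<n. smul (g n i z) (x n i))" for n z
  define P' where "P' n z = (\<Sum>i<n. smul (g' n i z) (x' n i))" for n z
  define R where "R n z = z - P n z" for n z
  define R' where "R' n z = z - P' n z" for n z
  have R: "p (R n z) \<le> b n * r z" for n z unfolding R_def P_def by (rule g)
  have R': "r (R' n z) \<le> b n * q z" for n z unfolding R'_def P'_def by (rule g')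
  have P_pad: "P n z = (\<Sum>i<k. smul (g n i z) (x n i))" if "n \<le> k" for n k z
    unfolding P_def using that g(4) by (intro sum.mono_neutral_left) auto
  have P'_pad: "P' n z = (\<Sum>i<k. smul (g' n i z) (x' n i))" if "n \<le> k" for n k z
    unfolding P'_def using that g'(4) by (intro sum.mono_neutral_left) auto
  have P_add: "P n (z + w) = P n z + P n w" and P_scale: "P n (smul a z) = smul a (P n z)" for n z w a
    unfolding P_def by (simp_all add: clinear_add[OF g(1)] clinear_scale[OF g(1)] scale_left_distrib
      sum.distrib scale_sum_right)
  have P'_add: "P' n (z + w) = P' n z + P' n w" and P'_scale: "P' n (smul a z) = smul a (P' n z)" for n z w a
    unfolding P'_def by (simp_all add: clinear_add[OF g'(1)] clinear_scale[OF g'(1)] scale_left_distrib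
      sum.distrib scale_sum_right)
  have R_add: "R n (z + w) = R n z + R n w" and R_scale: "R n (smul a z) = smul a (R n z)" for n z w a
    by (simp_all add: R_def P_add P_scale scale_right_diff_distrib)
  have R_0: "R n 0 = 0" for n using R_scale[of n 0 0] by simp
  have R_diff: "R n (z - w) = R n z - R n w" for n z w
    using R_add[of n "z - w" w] by (simp add: algebra_simps)
  have R_sum: "R n (\<Sum>i\<in>A. h i) = (\<Sum>i\<in>A. R n (h i))" for n h and A :: "nat set"
    by (induction A rule: infinite_finite_induct) (auto simp: R_0 R_add)
  have gR_lin: "clinear (\<lambda>z. g n i (R' k z))" for n i k
    unfolding clinear_iff R'_def
    by (auto simp: P'_add P'_scale clinear_diff[OF g(1)] clinear_add[OF g(1)] clinear_scale[OF g(1)] algebra_simps)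
  have gR_le: "norm (g n i (R' (Suc k) z)) \<le> 2 * b k * q z" for n i k z
  proof -
    have "norm (g n i (R' (Suc k) z)) \<le> 2 * (b (Suc k) * q z)"
      using g(2)[of n i "R' (Suc k) z"] R'[of "Suc k" z] by linarith
    also have "\<dots> \<le> 2 * (b k * q z)"
      using mult_right_mono[OF b_Suc[of k] seminorm_nonneg[OF q, of z]] by simp
    finally show ?thesis by simp
  qed
  have Rx_le: "p (R n (x' k i)) \<le> b n" for n k i
  proof -
    have "r (x' k i) \<le> 1" using rq[of "x' k i"] g'(3)[of k i] by linarith
    then have "b n * r (x' k i) \<le> b n * 1" by (intro mult_left_mono b_nn)
    then show ?thesis using R[of n "x' k i"] by simp
  qed
  \<comment> \<open>Residues mod 4 interleave the rank one terms of
    \<open>R n (P' (Suc n) z)\<close>, \<open>- R n (P' n z)\<close>,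
    \<open>P (Suc n) (R' (Suc n) z)\<close> and \<open>- P n (R' (Suc n) z)\<close>. In the first
    two the vector is small, in the last two the functional, as \<open>c\<close> records.\<close>
  define f where "f n i = (let j = i div 4 in if i mod 4 = 0 then g' (Suc n) j
     else if i mod 4 = 1 then (\<lambda>z. (- 1) * g' n j z)
     else if i mod 4 = 2 then (\<lambda>z. g (Suc n) j (R' (Suc n) z))
     else (\<lambda>z. (- 1) * g n j (R' (Suc n) z)))" for n i
  define y where "y n i = (let j = i div 4 in if i mod 4 = 0 then R n (x' (Suc n) j)
     else if i mod 4 = 1 then R n (x' n j) else if i mod 4 = 2 then x (Suc n) j else x n j)" for n i
  define c where "c n i = (if i mod 4 < 2 then 2 else 2 * b n)" for n and i :: nat
  define E where "E n z = R n (R' n z)" for n z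
  have step: "(\<Sum>i<4 * Suc n. smul (f n i z) (y n i)) = E n z - E (Suc n) z" for n z
  proof -
    have 1: "smul (f n (4 * j) z) (y n (4 * j)) = smul (g' (Suc n) j z) (R n (x' (Suc n) j))"
      "smul (f n (4 * j + 1) z) (y n (4 * j + 1)) = - smul (g' n j z) (R n (x' n j))"
      "smul (f n (4 * j + 2) z) (y n (4 * j + 2)) = smul (g (Suc n) j (R' (Suc n) z)) (x (Suc n) j)"
      "smul (f n (4 * j + 3) z) (y n (4 * j + 3)) = - smul (g n j (R' (Suc n) z)) (x n j)" for j
    proof -
      have d: "4 * j div 4 = j" "(4 * j + 1) div 4 = j" "(4 * j + 2) div 4 = j" "(4 * j + 3) div 4 = j"
        "4 * j mod 4 = 0" "(4 * j + 1) mod 4 = 1" "(4 * j + 2) mod 4 = 2" "(4 * j + 3) mod 4 = 3"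
        by presburger+
      show "smul (f n (4 * j) z) (y n (4 * j)) = smul (g' (Suc n) j z) (R n (x' (Suc n) j))"
        unfolding f_def y_def Let_def d by simp
      show "smul (f n (4 * j + 1) z) (y n (4 * j + 1)) = - smul (g' n j z) (R n (x' n j))"
        unfolding f_def y_def Let_def d by (simp add: scale_minus_left)
      show "smul (f n (4 * j + 2) z) (y n (4 * j + 2)) = smul (g (Suc n) j (R' (Suc n) z)) (x (Suc n) j)"
        unfolding f_def y_def Let_def d by simp
      show "smul (f n (4 * j + 3) z) (y n (4 * j + 3)) = - smul (g n j (R' (Suc n) z)) (x n j)"
        unfolding f_def y_def Let_def d by (simp add: scale_minus_left)
    qed
    have "(\<Sum>i<4 * Suc n. smul (f n i z) (y n i)) =
        (\<Sum>j<Suc n. smul (g' (Suc n) j z) (R n (x' (Suc n) j))) - (\<Sum>j<Suc n. smul (g' n j z) (R n (x' n j)))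
        + (\<Sum>j<Suc n. smul (g (Suc n) j (R' (Suc n) z)) (x (Suc n) j))
        - (\<Sum>j<Suc n. smul (g n j (R' (Suc n) z)) (x n j))"
      unfolding sum_lessThan_4_mult 1 sum.distrib sum_negf by simp
    also have "(\<Sum>j<Suc n. smul (g' (Suc n) j z) (R n (x' (Suc n) j))) = R n (P' (Suc n) z)"
      unfolding P'_def R_sum R_scale ..
    also have "(\<Sum>j<Suc n. smul (g' n j z) (R n (x' n j))) = R n (P' n z)"
      by (subst P'_pad[of n "Suc n"]) (simp_all only: R_sum R_scale le_SucI order_refl)
    also have "(\<Sum>j<Suc n. smul (g (Suc n) j (R' (Suc n) z)) (x (Suc n) j)) = P (Suc n) (R' (Suc n) z)"
      by (simp only: P_def)
    also have "(\<Sum>j<Suc n. smul (g n j (R' (Suc n) z)) (x n j)) = P n (R' (Suc n) z)"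
      by (rule P_pad[symmetric]) simp
    also have "R n (P' (Suc n) z) - R n (P' n z) = R n (R' n z) - R n (R' (Suc n) z)"
      by (simp add: R_diff[symmetric] R'_def)
    also have "\<dots> + P (Suc n) (R' (Suc n) z) - P n (R' (Suc n) z) = E n z - E (Suc n) z"
      by (simp add: E_def R_def[of _ "R' (Suc n) z"])
    finally show ?thesis .
  qed
  have E_bound: "p (E n z) \<le> b n * b n * q z" for n z
  proof -
    have "p (E n z) \<le> b n * r (R' n z)" unfolding E_def by (rule R)
    also have "\<dots> \<le> b n * (b n * q z)" by (intro mult_left_mono R' b_nn)
    finally show ?thesis by (simp add: mult.assoc)
  qed
  have "(\<lambda>n. B * inverse (real (Suc n)) ^ 4) \<longlonglongrightarrow> B * 0 ^ 4"
    by (intro tendsto_intros LIMSEQ_inverse_real_of_nat)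
  then have b_lim: "b \<longlonglongrightarrow> 0"
    by (simp add: b_def[abs_def] field_simps del: of_nat_Suc)
  have vsum: "summable (\<lambda>n. 1 / real (Suc n) ^ 2)"
  proof -
    have "summable (\<lambda>n. 1 / real n ^ 2)"
      using inverse_power_summable[of 2, where 'a = real] by (simp add: inverse_eq_divide)
    then show ?thesis by (subst (asm) summable_Suc_iff[symmetric])
  qed
  show ?thesis
  proof (rule nuclear_mapI[OF p q, of f c y "\<lambda>n. 32 * B * (1 / real (Suc n) ^ 2)"
        "\<lambda>i. 1 / real (Suc i) ^ 2" "\<lambda>n. 4 * Suc n"])
    show "clinear (f n i)" for n i
      unfolding f_def Let_def
      using g'(1) gR_lin clinear_scaled[OF g'(1), of "- 1"] clinear_scaled[OF gR_lin, of "- 1"] by auto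
    show "norm (f n i z) \<le> c n i * q z" for n i z
      using g'(2)[of n "i div 4" z] g'(2)[of "Suc n" "i div 4" z] gR_le
      by (auto simp: f_def c_def Let_def)
    show "0 \<le> c n i" for n i using b_nn by (simp add: c_def)
    show zero: "y n i = 0" if "4 * Suc n \<le> i" for n i
    proof -
      have "Suc n \<le> i div 4" using that by presburger
      then show ?thesis by (simp add: y_def Let_def g(4) g'(4) R_0)
    qed
    show "c n i * p (y n i) \<le> 32 * B * (1 / real (Suc n) ^ 2) * (1 / real (Suc i) ^ 2)" for n i
    proof (cases "4 * Suc n \<le> i")
      case True
      then show ?thesis by (simp add: zero seminorm_0[OF p] B_def)
    next
      case False
      have px: "p (x k j) \<le> 1" for k j using pr[of "x k j"] g(3)[of k j] by linarith
      have "c n i * p (y n i) \<le> 2 * b n"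
        using Rx_le px b_nn[of n] by (auto simp: c_def y_def Let_def intro: mult_left_le)
      \<comment> \<open>For \<open>i < 4 * (n + 1)\<close> the square of \<open>i + 1\<close> is at
        most 16 times that of \<open>n + 1\<close>; with the factor 2 this makes 32 and uses up the
        power 4 in \<open>b\<close>.\<close>
      also have "\<dots> = 32 * B / (real (Suc n) ^ 2 * (4 * real (Suc n)) ^ 2)"
      proof -
        have "real (Suc n) ^ 4 = real (Suc n) ^ 2 * real (Suc n) ^ 2" by (simp flip: power_add)
        then show ?thesis by (simp add: b_def power_mult_distrib del: of_nat_Suc)
      qed
      also have "\<dots> \<le> 32 * B / (real (Suc n) ^ 2 * real (Suc i) ^ 2)"
        using False by (intro divide_left_mono mult_left_mono power_mono) (auto simp: B_def)
      finally show ?thesis by simp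
    qed
    show "(\<lambda>N. p (z - (\<Sum>n<N. \<Sum>i<4 * Suc n. smul (f n i z) (y n i)))) \<longlonglongrightarrow> 0" for z
    proof -
      \<comment> \<open>The sum telescopes from \<open>E 0\<close>, which is the identity because
        \<open>P 0\<close> and \<open>P' 0\<close> are empty sums.\<close>
      have "(\<Sum>n<N. E n z - E (Suc n) z) = E 0 z - E N z" for N by (induction N) auto
      moreover have "E 0 z = z" by (simp add: E_def R_def R'_def P_def P'_def)
      ultimately have eq: "z - (\<Sum>n<N. \<Sum>i<4 * Suc n. smul (f n i z) (y n i)) = E N z" for N
        unfolding step by simp
      have "(\<lambda>N. b N * b N * q z) \<longlonglongrightarrow> 0 * 0 * q z" by (intro tendsto_intros b_lim)
      then have "(\<lambda>N. b N * b N * q z) \<longlonglongrightarrow> 0" by simp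
      then show ?thesis unfolding eq
        by (rule tendsto_sandwich[OF _ _ tendsto_const, rotated 2])
          (auto simp: E_bound seminorm_nonneg[OF p])
    qed
    show "summable (\<lambda>n. 32 * B * (1 / real (Suc n) ^ 2))" by (rule summable_mult[OF vsum])
    show "summable (\<lambda>i. 1 / real (Suc i) ^ 2)" by (rule vsum)
  qed (simp_all add: B_def)
qed

end

context complex_lcs
begin

text \<open>One \<delta> serves all seminorms, so enlarging \<open>q\<close> step by step gains one
  more decaying factor each time while \<open>p\<close> stays fixed.\<close>

lemma exists_weyl_decay:
  assumes summing: "\<And>p. p \<in> cs smul \<Longrightarrow> \<exists>q\<in>cs smul. \<exists>C. (\<forall>x. p x \<le> q x) \<and> summing \<delta> C p q"
    and \<delta>: "\<delta> \<ge> 0" and p: "p \<in> cs smul"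
  shows "\<exists>q\<in>cs smul. (\<forall>x. p x \<le> q x) \<and> weyl_decay \<delta> m p q"
proof (induction m)
  case 0
  show ?case using p weyl_decay_0 by blast
next
  case (Suc m)
  then obtain q where q: "q \<in> cs smul" "\<And>x. p x \<le> q x" "weyl_decay \<delta> m p q" by blast
  obtain r C where r: "r \<in> cs smul" "\<And>x. q x \<le> r x" "summing \<delta> C q r"
    using summing[OF q(1)] by blast
  have "weyl_decay \<delta> (Suc m) p r"
    by (rule weyl_decay_Suc[OF cs_seminorm[OF q(1)] cs_seminorm[OF r(1)] q(3) r(3) \<delta>])
  moreover have "p x \<le> r x" for x using q(2)[of x] r(2)[of x] by linarith
  ultimately show ?case using r(1) by blast
qed

lemma gap_less_half_imp_nuclear:
  assumes sc: "sequentially_complete TYPE('a)"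
    and metr: "metrizable_space (euclidean :: 'a topology)"
    and gap: "gap_a smul < 1/2"
  shows "nuclear_space smul"
proof -
  have "gap_a smul < ereal (1/2)" using gap by (simp add: one_ereal_def divide_ereal_def)
  then obtain \<delta> where \<delta>: "gap_a smul < ereal \<delta>" "\<delta> < 1/2"
    using ereal_dense2 by (metis ereal_less_eq(3) less_ereal.simps(1))
  have "0 < ereal \<delta>" using gap_a_nonneg \<delta>(1) by (rule le_less_trans)
  then have \<delta>0: "\<delta> \<ge> 0" by simp
  have summing: "\<exists>q\<in>cs smul. \<exists>C. (\<forall>x. p x \<le> q x) \<and> summing \<delta> C p q" if "p \<in> cs smul" for p
  proof -
    have "\<delta> \<le> 1" using \<delta>(2) by simp
    from gap_less_imp_summing[OF sc metr \<delta>(1) this that] show ?thesis by blast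
  qed
  obtain m :: nat where "7 / (1/2 - \<delta>) \<le> real m" using real_arch_simple by blast
  then have m: "7 \<le> real m * (1/2 - \<delta>)" using \<delta>(2) by (simp add: field_simps)
  show ?thesis unfolding nuclear_space_def
  proof
    fix p assume p: "p \<in> cs smul"
    obtain r where r: "r \<in> cs smul" "\<And>x. p x \<le> r x" "weyl_decay \<delta> m p r"
      using exists_weyl_decay[OF summing \<delta>0 p] by blast
    obtain q where q: "q \<in> cs smul" "\<And>x. r x \<le> q x" "weyl_decay \<delta> m r q"
      using exists_weyl_decay[OF summing \<delta>0 r(1)] by blast
    note s = cs_seminorm[OF p] cs_seminorm[OF r(1)] cs_seminorm[OF q(1)]
    obtain B1 where B1: "\<And>n. approximable (B1 / real (Suc n) ^ 4) p r n"
      using weyl_decay_imp_approximable[OF s(1,2) r(2,3) m] by blast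
    obtain B2 where B2: "\<And>n. approximable (B2 / real (Suc n) ^ 4) r q n"
      using weyl_decay_imp_approximable[OF s(2,3) q(2,3) m] by blast
    have "nuclear_map smul q smul p id"
      by (rule approximable_imp_nuclear_map[OF s r(2) q(2) B1 B2])
    moreover have "p x \<le> q x" for x using r(2)[of x] q(2)[of x] by linarith
    ultimately show "\<exists>q\<in>cs smul. (\<forall>x. p x \<le> q x) \<and> nuclear_map smul q smul p id"
      using q(1) by blast
  qed
qed

end

theorem theorem3p10:
  fixes smul :: "complex \<Rightarrow> 'a::{topological_ab_group_add,t2_space} \<Rightarrow> 'a"
  shows "(complex_lcs smul \<and> sequentially_complete TYPE('a) \<and> nuclear_space smul
            \<longrightarrow> gap_a smul = 0) \<and>
         (frechet_space smul
            \<longrightarrow> (nuclear_space smul \<longleftrightarrow> gap_a smul = 0) \<and>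
                (gap_a smul = 0 \<longleftrightarrow> gap_a smul < 1/2))"
proof -
  have "gap_a smul < 1/2" if "gap_a smul = 0"
    unfolding that by (simp add: one_ereal_def divide_ereal_def)
  then show ?thesis
    using complex_lcs.nuclear_imp_gap_a_eq_0 complex_lcs.gap_less_half_imp_nuclear
    unfolding frechet_space_def by blast
qed

end
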